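(* Let $\mathbb{K}$ be an algebraically closed field of arbitrary characteristic, let $q\in\mathbb{K}^*$ be a primitive $m$-th root of unity and let $n\ge1$. Then $$\mathrm{PI\text{-}deg}(\mathcal{M}at_n(q))=\mathrm{PI\text{-}deg}(\mathcal{O}_{\mathbf{q}}(\mathbb{K}^{n^2}))=\begin{cases} m^{n^2/2}, & n \text{ even},\\ m^{(n^2-1)/2}, & n\text{ odd}.\end{cases}$$
   Context: $\mathcal{M}at_n(q)$ (the Dipper–Donkin quantized matrix algebra) is the associative unital $\mathbb{K}$-algebra generated by $Z_{ij}$, $1\le i,j\le n$, with relations $Z_{ij}Z_{st}=qZ_{st}Z_{ij}$ if $i>s$, $j\le t$; $Z_{ij}Z_{st}=Z_{st}Z_{ij}+(q-1)Z_{sj}Z_{it}$ if $i>s$, $j>t$; $Z_{ij}Z_{ik}=Z_{ik}Z_{ij}$ for all $i,j,k$. $\mathcal{O}_{\mathbf{q}}(\mathbb{K}^{n^2})$ is the quantum affine space obtained by erasing the derivations: the $\mathbb{K}$-algebra generated by $x_{ij}$, $1\le i,j\le n$, subject only to $x_{ij}x_{st}=qx_{st}x_{ij}$ if $i>s$, $j\le t$; $x_{ij}x_{st}=x_{st}x_{ij}$ if $i>s$, $j>t$; $x_{ij}x_{ik}=x_{ik}x_{ij}$ for all $i,j,k$. Both algebras are prime PI algebras when $q$ is a root of unity; $\mathrm{PI\text{-}deg}$ denotes the PI degree. *)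

theory Defs
  imports
    "HOL-Algebra.QuotRing"
    "HOL-Computational_Algebra.Polynomial"
    "HOL-Library.Poly_Mapping"
begin

section \<open>Free associative algebras\<close>

text \<open>Words under concatenation, written additively: with words as exponents, the convolution
  product of \<^theory>\<open>HOL-Library.Poly_Mapping\<close> turns finitely supported functions on words
  into the free associative algebra.\<close>

datatype 'v word = Word (letters: "'v list")

instantiation word :: (type) monoid_add
begin

definition zero_word :: "'a word" where "0 = Word []"

definition plus_word :: "'a word \<Rightarrow> 'a word \<Rightarrow> 'a word"
  where "u + w = Word (letters u @ letters w)"

instance
  by standard (auto simp: zero_word_def plus_word_def)

end

type_synonym ('v, 'k) ncpoly = "'v word \<Rightarrow>\<^sub>0 'k"

definition ncvar :: "'v \<Rightarrow> ('v, 'k::ring_1) ncpoly"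
  where "ncvar v = Poly_Mapping.single (Word [v]) 1"

definition ncconst :: "'k::ring_1 \<Rightarrow> ('v, 'k) ncpoly"
  where "ncconst c = Poly_Mapping.single 0 c"

definition free_algebra :: "'v set \<Rightarrow> ('v, 'k::ring_1) ncpoly ring"
  where "free_algebra X =
    \<lparr>carrier = {p. \<forall>w \<in> Poly_Mapping.keys p. set (letters w) \<subseteq> X},
     monoid.mult = (*), one = 1, zero = 0, add = (+)\<rparr>"

lemma ring_free_algebra: "ring (free_algebra X :: ('v, 'k::ring_1) ncpoly ring)"
proof -
  let ?A = "free_algebra X :: ('v, 'k) ncpoly ring"
  have mult: "p * r \<in> carrier ?A" if "p \<in> carrier ?A" "r \<in> carrier ?A" for p r
  proof -
    have "set (letters w) \<subseteq> X" if w: "w \<in> Poly_Mapping.keys (p * r)" for w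
    proof -
      obtain u v where "w = u + v" "u \<in> Poly_Mapping.keys p" "v \<in> Poly_Mapping.keys r"
        using keys_mult[of p r] w by blast
      then show ?thesis
        using \<open>p \<in> carrier ?A\<close> \<open>r \<in> carrier ?A\<close>
        by (simp add: free_algebra_def plus_word_def)
    qed
    then show ?thesis
      by (simp add: free_algebra_def)
  qed
  have add: "p + r \<in> carrier ?A" if "p \<in> carrier ?A" "r \<in> carrier ?A" for p r
    using that Poly_Mapping.keys_add[of p r] unfolding free_algebra_def by (simp, blast)
  have one: "1 \<in> carrier ?A"
    by (simp add: free_algebra_def zero_word_def)
  have neg: "- p \<in> carrier ?A" if "p \<in> carrier ?A" for p
    using that by (simp add: free_algebra_def)
  have zero: "0 \<in> carrier ?A"
    by (simp add: free_algebra_def)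
  have sel: "x \<otimes>\<^bsub>?A\<^esub> y = x * y" "x \<oplus>\<^bsub>?A\<^esub> y = x + y" "\<one>\<^bsub>?A\<^esub> = 1" "\<zero>\<^bsub>?A\<^esub> = 0" for x y
    by (simp_all add: free_algebra_def)
  show ?thesis
  proof (rule ringI)
    show "abelian_group ?A"
    proof (rule abelian_groupI, unfold sel)
      show "\<exists>y\<in>carrier ?A. y + x = 0" if "x \<in> carrier ?A" for x
        using neg[OF that] by (intro bexI[of _ "- x"]) simp_all
    qed (simp_all add: add zero ac_simps)
    show "Group.monoid ?A"
      by (rule monoidI, unfold sel) (simp_all add: mult one mult.assoc)
  qed (simp_all add: sel distrib_left distrib_right)
qed

text \<open>The algebra with generators \<open>X\<close> and relations \<open>r = 0\<close> for \<open>r \<in> R\<close>. Here \<open>Idl\<close> is the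
  generated two-sided ideal. The scalars \<open>c\<close> are the classes of \<open>ncconst c\<close>.\<close>

definition presented_algebra ::
    "'v set \<Rightarrow> ('v, 'k::ring_1) ncpoly set \<Rightarrow> ('v, 'k) ncpoly set ring"
  where "presented_algebra X R = free_algebra X Quot (Idl\<^bsub>free_algebra X\<^esub> R)"

lemma ring_presented_algebra:
  assumes "R \<subseteq> carrier (free_algebra X)"
  shows "ring (presented_algebra X R)"
  unfolding presented_algebra_def
  by (intro ideal.quotient_is_ring ring.genideal_ideal ring_free_algebra assms)

section \<open>Polynomial identities and PI degree\<close>

definition word_eval :: "('a, 'b) ring_scheme \<Rightarrow> (nat \<Rightarrow> 'a) \<Rightarrow> nat word \<Rightarrow> 'a"
  where "word_eval A a w = foldr (\<lambda>i x. a i \<otimes>\<^bsub>A\<^esub> x) (letters w) \<one>\<^bsub>A\<^esub>"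

definition nc_eval :: "('a, 'b) ring_scheme \<Rightarrow> (nat \<Rightarrow> 'a) \<Rightarrow> (nat, int) ncpoly \<Rightarrow> 'a"
  where "nc_eval A a f =
    (\<Oplus>\<^bsub>A\<^esub> w \<in> Poly_Mapping.keys f. [Poly_Mapping.lookup f w] \<cdot>\<^bsub>A\<^esub> word_eval A a w)"

definition polynomial_identity :: "('a, 'b) ring_scheme \<Rightarrow> (nat, int) ncpoly \<Rightarrow> bool"
  where "polynomial_identity A f \<longleftrightarrow>
    (\<forall>a. (\<forall>i. a i \<in> carrier A) \<longrightarrow> nc_eval A a f = \<zero>\<^bsub>A\<^esub>)"

text \<open>Total degree \<open>d\<close>, and some word of length \<open>d\<close> has coefficient \<open>1\<close>.\<close>

definition nc_monic :: "nat \<Rightarrow> ('v, int) ncpoly \<Rightarrow> bool"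
  where "nc_monic d f \<longleftrightarrow>
    (\<forall>w \<in> Poly_Mapping.keys f. length (letters w) \<le> d) \<and>
    (\<exists>w. length (letters w) = d \<and> Poly_Mapping.lookup f w = 1)"

definition PI_min_degree :: "('a, 'b) ring_scheme \<Rightarrow> nat"
  where "PI_min_degree A = (LEAST d. \<exists>f. nc_monic d f \<and> polynomial_identity A f)"

text \<open>Meaningful for prime PI rings only. By Posner's theorem the minimal degree \<open>d\<close> of such a
  ring is even and \<open>d / 2\<close> is the square root of the dimension of its central quotient ring
  over the fraction field of its centre. The value is a real number so that
  nothing is lost to truncated division.\<close>

definition PI_deg :: "('a, 'b) ring_scheme \<Rightarrow> real"
  where "PI_deg A = real (PI_min_degree A) / 2"

section \<open>The Dipper--Donkin quantized matrix algebra and its quantum affine space\<close>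

definition grid :: "nat \<Rightarrow> (nat \<times> nat) set"
  where "grid n = {1..n} \<times> {1..n}"

abbreviation Zgen :: "nat \<Rightarrow> nat \<Rightarrow> (nat \<times> nat, 'k::ring_1) ncpoly"
  where "Zgen i j \<equiv> ncvar (i, j)"

definition matq_relations :: "nat \<Rightarrow> 'k::field \<Rightarrow> (nat \<times> nat, 'k) ncpoly set"
  where "matq_relations n q =
    {Zgen i j * Zgen s t - ncconst q * (Zgen s t * Zgen i j) | i j s t.
       (i, j) \<in> grid n \<and> (s, t) \<in> grid n \<and> i > s \<and> j \<le> t} \<union>
    {Zgen i j * Zgen s t - (Zgen s t * Zgen i j + ncconst (q - 1) * (Zgen s j * Zgen i t)) | i j s t.
       (i, j) \<in> grid n \<and> (s, t) \<in> grid n \<and> i > s \<and> j > t} \<union>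
    {Zgen i j * Zgen i k - Zgen i k * Zgen i j | i j k.
       (i, j) \<in> grid n \<and> (i, k) \<in> grid n}"

definition quantum_matrix_algebra ::
    "nat \<Rightarrow> 'k::field \<Rightarrow> (nat \<times> nat, 'k) ncpoly set ring"
  where "quantum_matrix_algebra n q = presented_algebra (grid n) (matq_relations n q)"

definition affine_relations :: "nat \<Rightarrow> 'k::field \<Rightarrow> (nat \<times> nat, 'k) ncpoly set"
  where "affine_relations n q =
    {Zgen i j * Zgen s t - ncconst q * (Zgen s t * Zgen i j) | i j s t.
       (i, j) \<in> grid n \<and> (s, t) \<in> grid n \<and> i > s \<and> j \<le> t} \<union>
    {Zgen i j * Zgen s t - Zgen s t * Zgen i j | i j s t.
       (i, j) \<in> grid n \<and> (s, t) \<in> grid n \<and> i > s \<and> j > t} \<union>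
    {Zgen i j * Zgen i k - Zgen i k * Zgen i j | i j k.
       (i, j) \<in> grid n \<and> (i, k) \<in> grid n}"

definition quantum_affine_space ::
    "nat \<Rightarrow> 'k::field \<Rightarrow> (nat \<times> nat, 'k) ncpoly set ring"
  where "quantum_affine_space n q = presented_algebra (grid n) (affine_relations n q)"

lemma free_algebra_carrierI:
  "v \<in> X \<Longrightarrow> ncvar v \<in> carrier (free_algebra X)"
  "ncconst c \<in> carrier (free_algebra X)"
  "p \<in> carrier (free_algebra X) \<Longrightarrow> r \<in> carrier (free_algebra X) \<Longrightarrow> p * r \<in> carrier (free_algebra X)"
  "p \<in> carrier (free_algebra X) \<Longrightarrow> r \<in> carrier (free_algebra X) \<Longrightarrow> p + r \<in> carrier (free_algebra X)"
  "p \<in> carrier (free_algebra X) \<Longrightarrow> r \<in> carrier (free_algebra X) \<Longrightarrow> p - r \<in> carrier (free_algebra X)"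
proof -
  interpret A: ring "free_algebra X" by (rule ring_free_algebra)
  show "ncvar v \<in> carrier (free_algebra X)" if "v \<in> X"
    using that by (simp add: free_algebra_def ncvar_def)
  show "ncconst c \<in> carrier (free_algebra X)"
    by (simp add: free_algebra_def ncconst_def zero_word_def)
  show "p * r \<in> carrier (free_algebra X)"
    if "p \<in> carrier (free_algebra X)" "r \<in> carrier (free_algebra X)"
    using A.m_closed[OF that] by (simp add: free_algebra_def)
  show "p + r \<in> carrier (free_algebra X)"
    if "p \<in> carrier (free_algebra X)" "r \<in> carrier (free_algebra X)"
    using A.a_closed[OF that] by (simp add: free_algebra_def)
  show "p - r \<in> carrier (free_algebra X)"
    if "p \<in> carrier (free_algebra X)" "r \<in> carrier (free_algebra X)"
    using that keys_diff[of p r] unfolding free_algebra_def by (simp, blast)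
qed

lemma ring_quantum_matrix_algebra: "ring (quantum_matrix_algebra n q)"
  unfolding quantum_matrix_algebra_def matq_relations_def
  by (rule ring_presented_algebra) (auto intro!: free_algebra_carrierI simp: grid_def)

lemma ring_quantum_affine_space: "ring (quantum_affine_space n q)"
  unfolding quantum_affine_space_def affine_relations_def
  by (rule ring_presented_algebra) (auto intro!: free_algebra_carrierI simp: grid_def)

definition primitive_root_of_unity :: "nat \<Rightarrow> 'k::field \<Rightarrow> bool"
  where "primitive_root_of_unity m q \<longleftrightarrow>
    m > 0 \<and> q ^ m = 1 \<and> (\<forall>k. 0 < k \<and> k < m \<longrightarrow> q ^ k \<noteq> 1)"

end

theory Submission
  imports
    Defs
    "HOL-Combinatorics.Combinatorics"
    "HOL-Library.Function_Algebras"
    "HOL-Library.Multiset"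
    "HOL-Library.Product_Plus"
begin

text \<open>
  Both algebras act by operators on functions \<open>\<int>\<^sup>W \<rightarrow> \<^bold>K\<close> built from clock and shift
  operators, where \<open>W\<close> is the set of odd cells of the \<open>n \<times> n\<close> chessboard, \<open>|W| = n\<^sup>2 div 2\<close>. These operators
  preserve the functions that are periodic modulo \<open>m\<close>, and this gives matrices of size \<open>N = m ^ |W|\<close>. A
  parameter \<open>z\<close> scales the generators with rapidly growing weights, which makes the family of these
  representations jointly faithful.

  The upper bound \<open>2 N\<close> for the degree of an identity is the theorem of Amitsur and Levitzki. For the
  faithfulness, straightening reduces to combinations of sorted words, and such a combination has
  only one leading term in \<open>z\<close>, a nonzero multiple of an element of the quantum torus. For the lower bound one
  representation maps onto the full matrix algebra, where the staircase of matrix units excludes identities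
  of degree less than \<open>2 N\<close>.

  For the quantum affine space the exponent matrix of \<open>q\<close> must therefore be congruent over \<open>\<int>\<close> to \<open>|W|\<close>
  hyperbolic planes and a zero block. In a suitable basis this amounts to the bijectivity of the neighbour
  sum on a grid graph, a discrete wave equation. The generators of the quantum matrix algebra are written as
  sums over generators of the affine space, adding one row at a time; conversely these are recovered
  from the row operations, and they are the leading terms in \<open>z\<close>.
\<close>

section \<open>The theorem of Amitsur and Levitzki\<close>

text \<open>The value has to come out for every order \<open>m\<close> and every characteristic. The
  rank of the exponent matrix over the rationals is therefore not enough: an elementary divisor
  sharing a factor with \<open>m\<close> would shrink the image of the representation. So the basis
  is changed over the integers, and the wave equation is solved modulo an arbitrary subgroup instead
  of in a vector space. For the same reason the trace argument, which cancels factors 2 and a number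
  of permutations, is carried out for integer matrices and reaches other commutative rings by
  multilinearity. A second obstacle is that the algebras are infinite-dimensional, so no single
  representation by matrices over the field is faithful; the parameter \<open>z\<close> supplies a
  family, and since an algebraically closed field is infinite, a polynomial in \<open>z\<close>
  vanishing at all nonzero points is zero. Finally, the generators have no inverses in the algebras
  while lattice arguments need negative exponents: on periodic functions the power
  \<open>m - 1\<close> of a torus operator is a multiple of its inverse.\<close>

definition alt_cycle_sum ::
    "'i set \<Rightarrow> nat \<Rightarrow> (nat \<Rightarrow> 'i \<Rightarrow> 'i \<Rightarrow> 'a::comm_ring_1) \<Rightarrow> (nat \<Rightarrow> nat) \<Rightarrow> 'a"
  where "alt_cycle_sum S m A N = (\<Sum>\<tau> | \<tau> permutes {..<m}. \<Sum>i\<in>{..m} \<rightarrow>\<^sub>E S.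
    of_int (sign \<tau>) * (\<Prod>p\<le>m. A (\<tau> p) (i p) (i (N p))))"

lemma bij_betw_PiE_comp:
  assumes "\<rho> permutes T"
  shows "bij_betw (\<lambda>i. i \<circ> \<rho>) (T \<rightarrow>\<^sub>E S) (T \<rightarrow>\<^sub>E S)"
proof (rule bij_betwI[where g = "\<lambda>i. i \<circ> inv_into UNIV \<rho>"])
  have *: "i \<circ> \<sigma> \<in> T \<rightarrow>\<^sub>E S" if "\<sigma> permutes T" "i \<in> T \<rightarrow>\<^sub>E S" for \<sigma> i
    using that by (auto simp: PiE_iff extensional_def permutes_in_image permutes_not_in)
  show "(\<lambda>i. i \<circ> \<rho>) \<in> (T \<rightarrow>\<^sub>E S) \<rightarrow> (T \<rightarrow>\<^sub>E S)" using * assms by blast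
  show "(\<lambda>i. i \<circ> inv_into UNIV \<rho>) \<in> (T \<rightarrow>\<^sub>E S) \<rightarrow> (T \<rightarrow>\<^sub>E S)" using * permutes_inv[OF assms] by blast
qed (auto simp: o_assoc[symmetric] permutes_inv_o[OF assms])

text \<open>A permutation \<open>N\<close> of the positions encodes a product of traces, one for
  each cycle of \<open>N\<close>, antisymmetrized over the matrices with index below
  \<open>m\<close> while matrix \<open>m\<close> stays in place. Conjugation only renames positions,
  so reindexing \<open>i\<close> and \<open>\<tau>\<close> by the inverse of \<open>\<rho>\<close>
  leaves each product alone and costs the sign of \<open>\<rho>\<close>. If \<open>\<rho>\<close> is
  odd and commutes with \<open>N\<close>, the sum is thus its own negative.\<close>

lemma alt_cycle_sum_conj:
  fixes A :: "nat \<Rightarrow> 'i \<Rightarrow> 'i \<Rightarrow> 'a::comm_ring_1"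
  assumes \<rho>: "\<rho> permutes {..<m}" and N: "N permutes {..m}"
  shows "alt_cycle_sum S m A (\<rho> \<circ> N \<circ> inv_into UNIV \<rho>) = of_int (sign \<rho>) * alt_cycle_sum S m A N"
proof -
  have \<rho>': "\<rho> permutes {..m}" using \<rho> by (rule permutes_subset) auto
  have perm: "permutation \<rho>" using \<rho> by (rule permutes_imp_permutation[rotated]) auto
  have "alt_cycle_sum S m A (\<rho> \<circ> N \<circ> inv_into UNIV \<rho>) =
     (\<Sum>\<tau> | \<tau> permutes {..<m}. \<Sum>i\<in>{..m} \<rightarrow>\<^sub>E S.
    of_int (sign (\<tau> \<circ> inv_into UNIV \<rho>)) * (\<Prod>p\<le>m. A ((\<tau> \<circ> inv_into UNIV \<rho>) p) ((i \<circ> inv_into UNIV \<rho>) p) ((i \<circ> inv_into UNIV \<rho>) ((\<rho> \<circ> N \<circ> inv_into UNIV \<rho>) p))))"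
    unfolding alt_cycle_sum_def
    by (subst sum.reindex_bij_betw[OF bij_betw_PiE_comp[OF permutes_inv[OF \<rho>']], symmetric],
        subst sum_permutations_compose_right[OF permutes_inv[OF \<rho>]]) (rule refl)
  also have "\<dots> = (\<Sum>\<tau> | \<tau> permutes {..<m}. \<Sum>i\<in>{..m} \<rightarrow>\<^sub>E S.
    of_int (sign \<rho>) * (of_int (sign \<tau>) * (\<Prod>p\<le>m. A (\<tau> p) (i p) (i (N p)))))"
  proof (intro sum.cong refl)
    fix \<tau> :: "nat \<Rightarrow> nat" and i :: "nat \<Rightarrow> 'i" assume t: "\<tau> \<in> {\<tau>. \<tau> permutes {..<m}}"
    have "permutation \<tau>" using t permutes_imp_permutation[of "{..<m}" \<tau>] by auto
    then have s: "sign (\<tau> \<circ> inv_into UNIV \<rho>) = sign \<tau> * sign \<rho>"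
      using perm by (simp add: sign_compose sign_inverse permutation_inverse)
    have "(\<Prod>p\<le>m. A ((\<tau> \<circ> inv_into UNIV \<rho>) p) ((i \<circ> inv_into UNIV \<rho>) p) ((i \<circ> inv_into UNIV \<rho>) ((\<rho> \<circ> N \<circ> inv_into UNIV \<rho>) p))) =
       (\<Prod>p\<le>m. (\<lambda>p. A (\<tau> p) (i p) (i (N p))) (inv_into UNIV \<rho> p))"
      using permutes_inverses[OF \<rho>] by (intro prod.cong) auto
    also have "\<dots> = (\<Prod>p\<le>m. A (\<tau> p) (i p) (i (N p)))"
      using prod.permute[OF permutes_inv[OF \<rho>'], of "\<lambda>p. A (\<tau> p) (i p) (i (N p))"] by (simp add: o_def)
    finally show "of_int (sign (\<tau> \<circ> inv_into UNIV \<rho>)) * (\<Prod>p\<le>m. A ((\<tau> \<circ> inv_into UNIV \<rho>) p) ((i \<circ> inv_into UNIV \<rho>) p) ((i \<circ> inv_into UNIV \<rho>) ((\<rho> \<circ> N \<circ> inv_into UNIV \<rho>) p)))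
      = of_int (sign \<rho>) * (of_int (sign \<tau>) * (\<Prod>p\<le>m. A (\<tau> p) (i p) (i (N p))))"
      by (simp add: s mult_ac)
  qed
  finally show ?thesis by (simp add: alt_cycle_sum_def sum_distrib_left)
qed

text \<open>Pigeonhole: \<open>i\<close> takes the same value at two positions of \<open>H\<close>,
  and composing \<open>\<sigma>\<close> with their transposition changes no factor but reverses the
  sign.\<close>

lemma sum_sign_alt_cycle_sum_eq_0:
  fixes A :: "nat \<Rightarrow> 'i \<Rightarrow> 'i \<Rightarrow> int"
  assumes "finite S" "card S < card H" "H \<subseteq> {..m}" and N: "N permutes {..m}"
  shows "(\<Sum>\<sigma> | \<sigma> permutes H. sign \<sigma> * alt_cycle_sum S m A (\<sigma> \<circ> N)) = 0"
proof -
  have fH: "finite H" using assms finite_subset by blast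
  have zero: "(\<Sum>\<sigma> | \<sigma> permutes H. sign \<sigma> * (\<Prod>p\<le>m. A (\<tau> p) (i p) (i (\<sigma> (N p))))) = 0" (is "sum ?f _ = 0")
    if i: "i \<in> {..m} \<rightarrow>\<^sub>E S" for \<tau> i
  proof -
    have "i ` H \<subseteq> S" using i assms by (auto simp: PiE_iff)
    then have "\<not> inj_on i H" using assms(1,2) card_inj_on_le[of i H S] by auto
    then obtain a b where ab: "a \<in> H" "b \<in> H" "a \<noteq> b" "i a = i b" by (auto simp: inj_on_def)
    let ?t = "transpose a b"
    have t: "?t permutes H" using ab by (simp add: permutes_swap_id)
    have it: "i (?t x) = i x" for x using ab by (auto simp: transpose_def)
    have "sum ?f {\<sigma>. \<sigma> permutes H} = sum (\<lambda>\<sigma>. ?f (?t \<circ> \<sigma>)) {\<sigma>. \<sigma> permutes H}"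
      by (rule setum_permutations_compose_left[OF t])
    also have "\<dots> = sum (\<lambda>\<sigma>. - ?f \<sigma>) {\<sigma>. \<sigma> permutes H}"
    proof (intro sum.cong refl)
      fix \<sigma> assume "\<sigma> \<in> {\<sigma>. \<sigma> permutes H}"
      then have "permutation \<sigma>" using fH permutes_imp_permutation by auto
      then have "sign (?t \<circ> \<sigma>) = - sign \<sigma>"
        using ab by (simp add: sign_compose permutation_swap_id sign_swap_id)
      then show "?f (?t \<circ> \<sigma>) = - ?f \<sigma>" by (simp add: it)
    qed
    finally show ?thesis by (simp add: sum_negf)
  qed
  have "(\<Sum>\<sigma> | \<sigma> permutes H. sign \<sigma> * alt_cycle_sum S m A (\<sigma> \<circ> N)) =
    (\<Sum>\<sigma> | \<sigma> permutes H. \<Sum>\<tau> | \<tau> permutes {..<m}. \<Sum>i\<in>{..m} \<rightarrow>\<^sub>E S.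
      sign \<tau> * (sign \<sigma> * (\<Prod>p\<le>m. A (\<tau> p) (i p) (i (\<sigma> (N p))))))"
    by (simp add: alt_cycle_sum_def sum_distrib_left mult_ac)
  also have "\<dots> = (\<Sum>\<tau> | \<tau> permutes {..<m}. \<Sum>i\<in>{..m} \<rightarrow>\<^sub>E S. \<Sum>\<sigma> | \<sigma> permutes H.
      sign \<tau> * (sign \<sigma> * (\<Prod>p\<le>m. A (\<tau> p) (i p) (i (\<sigma> (N p))))))"
    by (subst sum.swap, intro sum.cong refl sum.swap)
  also have "\<dots> = 0"
  proof (rule sum.neutral, rule ballI, rule sum.neutral, rule ballI)
    fix \<tau> :: "nat \<Rightarrow> nat" and i :: "nat \<Rightarrow> 'i" assume "i \<in> {..m} \<rightarrow>\<^sub>E S"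
    from zero[OF this, of \<tau>]
    show "(\<Sum>\<sigma> | \<sigma> permutes H. sign \<tau> * (sign \<sigma> * (\<Prod>p\<le>m. A (\<tau> p) (i p) (i (\<sigma> (N p)))))) = 0"
      by (simp flip: sum_distrib_left)
  qed
  finally show ?thesis .
qed

lemma sign_cycle_of_list:
  "distinct (x # xs) \<Longrightarrow> sign (cycle_of_list (x # xs)) = (-1) ^ length xs"
proof (induction xs arbitrary: x)
  case (Cons y ys)
  then have "sign (cycle_of_list (x # y # ys)) = - sign (cycle_of_list (y # ys))"
    by (simp add: sign_compose permutation_swap_id permutation_of_cycle sign_swap_id)
  with Cons show ?case by (simp del: cycle_of_list.simps)
qed simp

text \<open>For every permutation \<open>\<sigma>\<close> of the even positions,
  \<open>\<sigma> \<circ> pair_swap d\<close> leads from an even position below \<open>2 * d\<close>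
  to its successor, so the two matrices of a pair remain adjacent in the trace.\<close>

definition pair_swap :: "nat \<Rightarrow> nat \<Rightarrow> nat"
  where "pair_swap d p = (if p < 2 * d then if even p then p + 1 else p - 1 else p)"

definition shift_cycle :: "nat \<Rightarrow> nat \<Rightarrow> nat"
  where "shift_cycle m p = (if p < m then p + 1 else if p = m then 0 else p)"

lemma pair_swap_involution: "pair_swap d (pair_swap d p) = p"
  by (auto simp: pair_swap_def elim!: evenE oddE)

lemma pair_swap_permutes: "pair_swap d permutes {..<2 * d}"
  by (rule bij_imp_permutes, rule bij_betwI[where g = "pair_swap d"])
     (auto simp: pair_swap_involution, auto simp: pair_swap_def elim!: evenE oddE)

lemma shift_cycle_permutes: "shift_cycle m permutes {..m}"
  by (rule bij_imp_permutes, rule bij_betwI[where g = "\<lambda>p. if p = 0 then m else p - 1"])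
     (auto simp: shift_cycle_def)

text \<open>Polarised Cayley--Hamilton: the antisymmetrizer on \<open>d + 1\<close> indices vanishes on a set of \<open>d\<close>
  elements. With the products \<open>A (2 k) A (2 k + 1)\<close> as arguments, antisymmetrized over the \<open>A\<close>'s,
  every permutation with more than one cycle contributes zero, since it contains the trace of a
  product of an even number of factors.\<close>

lemma alt_cycle_sum_shift_cycle_int:
  fixes A :: "nat \<Rightarrow> 'i \<Rightarrow> 'i \<Rightarrow> int"
  assumes S: "finite S" and d: "card S = d"
  shows "alt_cycle_sum S (2 * d) A (shift_cycle (2 * d)) = 0"
proof -
  define m where "m = 2 * d"
  define H where "H = {p. p \<le> m \<and> even p}"
  define N0 where "N0 = pair_swap d"
  define full where "full N \<longleftrightarrow> (\<forall>p\<le>m. \<exists>r. (N ^^ r) m = p)" for N :: "nat \<Rightarrow> nat"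
  let ?F = "alt_cycle_sum S m A"
  let ?c = "shift_cycle m"
  have "H = (\<lambda>k. 2 * k) ` {..d}"
    by (auto simp: H_def m_def elim!: evenE)
  then have "card H = d + 1" by (simp add: card_image inj_on_def)
  then have cH: "card S < card H" using d by simp
  have Hm: "H \<subseteq> {..m}" by (auto simp: H_def)
  have fH: "finite H" using Hm finite_subset by blast
  have N0: "N0 permutes {..<m}" by (simp add: N0_def m_def pair_swap_permutes)
  have N0': "N0 permutes {..m}" using N0 by (rule permutes_subset) auto
  have N0N0: "N0 (N0 p) = p" for p by (simp add: N0_def pair_swap_involution)
  have Nperm: "\<sigma> \<circ> N0 permutes {..m}" if "\<sigma> permutes H" for \<sigma>
    using permutes_compose[OF N0' permutes_subset[OF that Hm]] .
  have Neven: "(\<sigma> \<circ> N0) p = p + 1" if "\<sigma> permutes H" "even p" "p < m" for \<sigma> p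
    using that permutes_not_in[OF that(1), of "p + 1"] by (simp add: N0_def m_def pair_swap_def H_def)
  have Neven': "even ((\<sigma> \<circ> N0) p)" if "\<sigma> permutes H" "odd p \<or> p = m" "p \<le> m" for \<sigma> p
  proof -
    have "N0 p \<in> H"
    proof (cases "p = m")
      case False
      then have "odd p" "p < m" using that by auto
      then show ?thesis by (simp add: N0_def m_def pair_swap_def H_def)
    qed (simp add: N0_def m_def pair_swap_def H_def)
    then have "\<sigma> (N0 p) \<in> H" using that(1) by (simp add: permutes_in_image)
    then show ?thesis by (simp add: H_def)
  qed
  \<comment> \<open>A cycle \<open>C\<close> that misses \<open>m\<close> consists of pairs
    \<open>p\<close>, \<open>p + 1\<close> with \<open>p\<close> even, so its length is even. The
    cyclic permutation \<open>\<rho>\<close> of \<open>C\<close> is then odd, fixes \<open>m\<close>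
    and commutes with \<open>N\<close>; conjugating by it shows that the integer \<open>?F N\<close>
    equals its negative.\<close>
  have not_full: "?F (\<sigma> \<circ> N0) = 0" if \<sigma>: "\<sigma> permutes H" and nf: "\<not> full (\<sigma> \<circ> N0)" for \<sigma>
  proof -
    define N where "N = \<sigma> \<circ> N0"
    have N: "N permutes {..m}" unfolding N_def by (rule Nperm[OF \<sigma>])
    obtain x where x: "x \<le> m" and nx: "\<And>r. (N ^^ r) m \<noteq> x" using nf by (auto simp: full_def N_def)
    have perm: "permutation N" using N by (rule permutes_imp_permutation[rotated]) auto
    define C where "C = set (support N x)"
    define \<rho> where "\<rho> = cycle_of_list (support N x)"
    have dist: "distinct (support N x)" using cycle_of_permutation[OF perm] .
    have Cr: "C = range (\<lambda>i. (N ^^ i) x)" unfolding C_def using support_set[OF perm] .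
    have \<rho>C: "\<rho> p = N p" if "p \<in> C" for p
      unfolding \<rho>_def using cycle_restrict[OF perm that[unfolded C_def]] by simp
    have \<rho>nC: "\<rho> p = p" if "p \<notin> C" for p unfolding \<rho>_def by (rule id_outside_supp[OF that[unfolded C_def]])
    have Cm: "p \<le> m" if "p \<in> C" for p
      using that x permutes_in_image[OF permutes_funpow[OF N]] by (auto simp: Cr)
    have fwd: "N p \<in> C" if "p \<in> C" for p
    proof -
      from that obtain i where "p = (N ^^ i) x" by (auto simp: Cr)
      then have "N p = (N ^^ Suc i) x" by simp
      then show ?thesis unfolding Cr by blast
    qed
    have bwd: "p \<in> C" if p: "N p \<in> C" for p
    proof -
      have "\<rho> ` C = C" unfolding \<rho>_def C_def using cycle_is_surj[OF dist] .
      then have "N p \<in> \<rho> ` C" using p by simp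
      then obtain r where "r \<in> C" "\<rho> r = N p" by (metis (no_types, lifting) imageE)
      then have "N r = N p" using \<rho>C by simp
      then have "r = p" using permutes_inj[OF N] by (simp add: inj_eq)
      then show ?thesis using \<open>r \<in> C\<close> by simp
    qed
    have mC: "m \<notin> C"
    proof
      assume "m \<in> C"
      then obtain i where i: "m = (N ^^ i) x" by (auto simp: Cr)
      obtain k where k: "(N ^^ k) = id" "k > 0" using permutation_is_nilpotent[OF perm] by blast
      have "(N ^^ (k * i)) x = x" using k(1) by (simp add: funpow_mult[symmetric])
      moreover have "i \<le> k * i" using k(2) by simp
      ultimately have "(N ^^ (k * i - i)) m = x"
        unfolding i by (metis comp_apply funpow_add le_add_diff_inverse2)
      then show False using nx by blast
    qed
    have Clt: "p < m" if "p \<in> C" for p using Cm[OF that] mC that by (metis le_neq_implies_less)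
    define E where "E = {p \<in> C. even p}"
    have "C = E \<union> Suc ` E"
    proof (intro equalityI subsetI)
      fix p assume p: "p \<in> C"
      show "p \<in> E \<union> Suc ` E"
      proof (cases "even p")
        case False
        then obtain k where k: "p = Suc (2 * k)" by (elim oddE) simp
        have "N (2 * k) = p" using Neven[OF \<sigma>, of "2 * k"] Clt[OF p] k by (simp add: N_def)
        then have "2 * k \<in> C" using bwd[of "2 * k"] p by simp
        then show ?thesis using k by (auto simp: E_def)
      qed (simp add: E_def p)
    next
      fix p assume "p \<in> E \<union> Suc ` E"
      then show "p \<in> C"
      proof
        assume "p \<in> Suc ` E"
        then obtain k where k: "k \<in> C" "even k" "p = Suc k" by (auto simp: E_def)
        then show ?thesis using Neven[OF \<sigma>, of k] Clt[of k] fwd[of k] by (simp add: N_def)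
      qed (simp add: E_def)
    qed
    moreover have "card (E \<union> Suc ` E) = card E + card (Suc ` E)"
      by (rule card_Un_disjoint) (auto simp: E_def C_def)
    ultimately have "card C = 2 * card E" by (simp add: card_image)
    then have "even (length (support N x))" using distinct_card[OF dist] unfolding C_def by (metis dvd_triv_left)
    moreover have "support N x \<noteq> []" using Cr by (metis C_def empty_set range_eqI empty_iff)
    ultimately have sg: "sign \<rho> = -1"
      using sign_cycle_of_list[of "hd (support N x)" "tl (support N x)"] dist
      by (simp add: \<rho>_def)
    have \<rho>: "\<rho> permutes {..<m}"
      unfolding \<rho>_def by (rule permutes_subset[OF cycle_permutes]) (use Clt in \<open>auto simp: C_def\<close>)
    have "\<rho> (N p) = N (\<rho> p)" for p
      using \<rho>C \<rho>nC fwd bwd by (cases "p \<in> C") metis+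
    then have "\<rho> \<circ> N \<circ> inv_into UNIV \<rho> = N"
      using permutes_inverses[OF \<rho>] by (simp add: fun_eq_iff)
    then have "?F N = - ?F N"
      using alt_cycle_sum_conj[OF \<rho> N, of S A] sg by simp
    then show ?thesis by (simp add: N_def)
  qed
  \<comment> \<open>A permutation with only one cycle is conjugate to the standard cycle by some
    \<open>\<pi>\<close> fixing \<open>m\<close>. The point is that \<open>\<pi>\<close> is even, so
    that all these terms agree and add up instead of cancelling.\<close>
  have full_eq: "?F (\<sigma> \<circ> N0) = ?F ?c \<and> sign \<sigma> = sign ?c * sign N0"
    if \<sigma>: "\<sigma> permutes H" and fl: "full (\<sigma> \<circ> N0)" for \<sigma>
  proof -
    define N where "N = \<sigma> \<circ> N0"
    have N: "N permutes {..m}" unfolding N_def by (rule Nperm[OF \<sigma>])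
    have perm: "permutation N" using N by (rule permutes_imp_permutation[rotated]) auto
    let ?L = "least_power N m"
    have "set (support N m) = {..m}"
    proof -
      have "set (support N m) \<subseteq> {..m}"
        unfolding support_set[OF perm] using permutes_in_image[OF permutes_funpow[OF N]] by auto
      moreover have "{..m} \<subseteq> set (support N m)"
        unfolding support_set[OF perm] using fl by (force simp: full_def N_def)
      ultimately show ?thesis by blast
    qed
    then have "card {..m} = length (support N m)"
      using distinct_card[OF cycle_of_permutation[OF perm]] by metis
    then have L: "?L = m + 1" by simp
    have Lm: "(N ^^ (m + 1)) m = m" using least_power_of_permutation(1)[OF perm, of m] by (simp add: L)
    define \<pi> where "\<pi> r = (if r \<le> m then (N ^^ Suc r) m else r)" for r
    have inj0: "inj_on (\<lambda>r. (N ^^ r) m) {..<m + 1}"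
      using cycle_of_permutation[OF perm, of m] unfolding L distinct_map set_upt atLeast0LessThan by blast
    have Ninj: "inj N" by (rule permutes_inj[OF N])
    have "inj_on \<pi> {..m}"
    proof (rule inj_onI)
      fix a b assume "a \<in> {..m}" "b \<in> {..m}" "\<pi> a = \<pi> b"
      then have "(N ^^ a) m = (N ^^ b) m" using Ninj by (simp add: \<pi>_def inj_eq)
      then show "a = b" using inj0 \<open>a \<in> _\<close> \<open>b \<in> _\<close> by (auto simp: inj_on_def)
    qed
    moreover have "\<pi> ` {..m} \<subseteq> {..m}"
      using permutes_in_image[OF permutes_funpow[OF N]] by (auto simp: \<pi>_def simp del: funpow.simps)
    ultimately have bij: "bij_betw \<pi> {..m} {..m}"
      by (simp add: bij_betw_def endo_inj_surj)
    have \<pi>m: "\<pi> m = m" using Lm by (simp add: \<pi>_def)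
    have \<pi>': "\<pi> permutes {..m}"
      by (rule bij_imp_permutes[OF bij]) (simp add: \<pi>_def)
    have \<pi>: "\<pi> permutes {..<m}"
    proof -
      have "x \<notin> {..<m} \<Longrightarrow> \<pi> x = x" for x using \<pi>m by (cases "x = m") (auto simp: \<pi>_def)
      then show ?thesis using \<pi>' unfolding permutes_def by blast
    qed
    have com: "\<pi> (?c p) = N (\<pi> p)" for p
    proof (cases "p < m")
      case True then show ?thesis by (simp add: shift_cycle_def \<pi>_def)
    next
      case False
      then show ?thesis
        using \<pi>m permutes_not_in[OF N, of p]
        by (cases "p = m") (auto simp: shift_cycle_def, simp_all add: \<pi>_def)
    qed
    then have conj: "N = \<pi> \<circ> ?c \<circ> inv_into UNIV \<pi>"
      using permutes_inverses[OF \<pi>'] by (auto simp: fun_eq_iff)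
    have cperm: "permutation ?c" using shift_cycle_permutes by (rule permutes_imp_permutation[rotated]) auto
    have \<pi>perm: "permutation \<pi>" using \<pi> by (rule permutes_imp_permutation[rotated]) auto
    have N0perm: "permutation N0" using N0 by (rule permutes_imp_permutation[rotated]) auto
    have \<sigma>perm: "permutation \<sigma>" using \<sigma> fH by (rule permutes_imp_permutation[rotated])
    have "sign N = sign ?c"
      by (simp add: conj sign_compose sign_inverse permutation_compose cperm \<pi>perm permutation_inverse)
    moreover have "sign N = sign \<sigma> * sign N0"
      by (simp add: N_def sign_compose \<sigma>perm N0perm)
    ultimately have sg: "sign \<sigma> = sign ?c * sign N0" by (metis mult.assoc mult.right_neutral sign_idempotent)
    have par: "even (\<pi> p) \<longleftrightarrow> even p" if "p \<le> m" for p
      using that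
    proof (induction p)
      case 0
      have "\<pi> 0 = N m" by (simp add: \<pi>_def)
      then show ?case using Neven'[OF \<sigma>, of m] by (simp add: N_def)
    next
      case (Suc p)
      have e: "\<pi> (Suc p) = N (\<pi> p)" using Suc.prems by (simp add: \<pi>_def)
      have lt: "\<pi> p < m" using permutes_in_image[OF \<pi>, of p] Suc.prems by simp
      show ?case
      proof (cases "even p")
        case True
        then show ?thesis using Suc Neven[OF \<sigma>, of "\<pi> p"] lt e by (simp add: N_def)
      next
        case False
        then show ?thesis using Suc Neven'[OF \<sigma>, of "\<pi> p"] lt e by (simp add: N_def)
      qed
    qed
    have suc: "\<pi> (p + 1) = \<pi> p + 1" if "even p" "p < m" for p
    proof -
      have "\<pi> (p + 1) = N (\<pi> p)" using that by (simp add: \<pi>_def)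
      moreover have "\<pi> p < m" using permutes_in_image[OF \<pi>, of p] that by simp
      ultimately show ?thesis using Neven[OF \<sigma>, of "\<pi> p"] par[of p] that by (simp add: N_def)
    qed
    define \<pi>e where "\<pi>e p = (if even p then \<pi> p else p)" for p
    have \<pi>lt: "\<pi> p < m \<longleftrightarrow> p < m" for p using permutes_in_image[OF \<pi>, of p] by simp
    have \<pi>e: "\<pi>e permutes {..<m}"
    proof (rule bij_imp_permutes)
      have "inj_on \<pi>e {..<m}"
      proof (rule inj_onI)
        fix a b assume ab: "a \<in> {..<m}" "b \<in> {..<m}" "\<pi>e a = \<pi>e b"
        have "even (\<pi>e a) = even a" "even (\<pi>e b) = even b"
          using ab(1,2) par[of a] par[of b] by (auto simp: \<pi>e_def)
        then have "even a = even b" using ab by metis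
        then show "a = b" using ab permutes_inj[OF \<pi>] by (auto simp: \<pi>e_def inj_eq split: if_splits)
      qed
      moreover have "\<pi>e ` {..<m} \<subseteq> {..<m}" using \<pi>lt by (auto simp: \<pi>e_def)
      ultimately show "bij_betw \<pi>e {..<m} {..<m}" by (simp add: bij_betw_def endo_inj_surj)
      show "x \<notin> {..<m} \<Longrightarrow> \<pi>e x = x" for x using permutes_not_in[OF \<pi>, of x] by (simp add: \<pi>e_def)
    qed
    have \<pi>eperm: "permutation \<pi>e" using \<pi>e by (rule permutes_imp_permutation[rotated]) auto
    \<comment> \<open>The pairs \<open>2 * k\<close>, \<open>2 * k + 1\<close> are moved as blocks:
      \<open>\<pi>e\<close> is the action on even positions, and its conjugate by \<open>N0\<close>
      is the same action on odd ones. Both have the same sign, so \<open>\<pi>\<close> is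
      even.\<close>
    have dec: "\<pi> = \<pi>e \<circ> (N0 \<circ> \<pi>e \<circ> N0)"
    proof
      fix p
      show "\<pi> p = (\<pi>e \<circ> (N0 \<circ> \<pi>e \<circ> N0)) p"
      proof (cases "p < m")
        case False
        then have "N0 p = p" "\<pi> p = p" "\<pi>e p = p"
          using permutes_not_in[OF N0] permutes_not_in[OF \<pi>] permutes_not_in[OF \<pi>e] by auto
        then show ?thesis by simp
      next
        case lt: True
        show ?thesis
        proof (cases "even p")
          case True
          then have "N0 p = p + 1" using lt by (simp add: N0_def m_def pair_swap_def)
          then have "\<pi>e (N0 p) = N0 p" using True by (simp add: \<pi>e_def)
          then show ?thesis using True by (simp add: N0N0) (simp add: \<pi>e_def)
        next
          case False
          then obtain k where k: "p = 2 * k + 1" by (elim oddE)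
          have "N0 p = 2 * k" using lt k by (simp add: N0_def m_def pair_swap_def)
          then have "\<pi>e (N0 p) = \<pi> (2 * k)" by (simp add: \<pi>e_def)
          moreover have "even (\<pi> (2 * k))" "\<pi> (2 * k) < m" using par[of "2 * k"] \<pi>lt lt k by simp_all
          ultimately have "N0 (\<pi>e (N0 p)) = \<pi> (2 * k) + 1" by (simp add: N0_def m_def pair_swap_def)
          moreover have "\<pi> p = \<pi> (2 * k) + 1" using suc[of "2 * k"] lt k by simp
          ultimately show ?thesis using par[of p] lt False by (simp add: \<pi>e_def)
        qed
      qed
    qed
    have "sign \<pi> = 1"
      by (subst dec, cases \<pi>e rule: sign_cases; cases N0 rule: sign_cases)
         (simp_all add: sign_compose permutation_compose \<pi>eperm N0perm)
    then have "?F N = ?F ?c"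
      using alt_cycle_sum_conj[OF \<pi> shift_cycle_permutes, of S A] conj by simp
    then show ?thesis using sg by (simp add: N_def)
  qed
  define G where "G = {\<sigma>. \<sigma> permutes H \<and> full (\<sigma> \<circ> N0)}"
  have fin: "finite {\<sigma>. \<sigma> permutes H}" using finite_permutations[OF fH] .
  have "0 = (\<Sum>\<sigma> | \<sigma> permutes H. sign \<sigma> * ?F (\<sigma> \<circ> N0))"
    using sum_sign_alt_cycle_sum_eq_0[OF S cH Hm N0'] by simp
  also have "\<dots> = (\<Sum>\<sigma>\<in>G. sign \<sigma> * ?F (\<sigma> \<circ> N0))"
    using fin not_full by (intro sum.mono_neutral_right) (auto simp: G_def)
  also have "\<dots> = (\<Sum>\<sigma>\<in>G. sign ?c * sign N0 * ?F ?c)"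
    using full_eq by (intro sum.cong) (auto simp: G_def)
  \<comment> \<open>All surviving terms are equal, so only their number stands in the way. It is
    positive, and among integers it can be cancelled.\<close>
  finally have z: "int (card G) * (sign ?c * sign N0 * ?F ?c) = 0" by simp
  have "?c \<circ> N0 \<in> G"
  proof -
    have "(?c \<circ> N0) p = p" if "p \<notin> H" for p
    proof (cases "p \<le> m")
      case True
      then have "odd p" using that by (simp add: H_def)
      then obtain k where "p = 2 * k + 1" by (rule oddE)
      moreover from this have "p < m" using True unfolding m_def by presburger
      ultimately show ?thesis by (simp add: N0_def pair_swap_def m_def shift_cycle_def)
    qed (simp add: N0_def pair_swap_def m_def shift_cycle_def)
    then have "?c \<circ> N0 permutes H"
      using permutes_compose[OF N0' shift_cycle_permutes] by (simp add: permutes_def)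
    moreover have "?c \<circ> N0 \<circ> N0 = ?c" by (simp add: fun_eq_iff N0N0)
    moreover have "(?c ^^ Suc r) m = r" if "r \<le> m" for r
      using that by (induction r) (auto simp: shift_cycle_def)
    then have "full ?c" unfolding full_def by blast
    ultimately show ?thesis by (simp add: G_def)
  qed
  moreover have "finite G" using fin by (auto simp: G_def)
  ultimately have "card G > 0" by (auto simp: card_gt_0_iff)
  then show ?thesis using z by (simp add: m_def)
qed

text \<open>Both sides are multilinear in the matrices \<open>A s\<close>, so it suffices to treat
  matrix units. Their entries are integers, which gives access to the result in which integer
  factors were cancelled.\<close>

theorem alt_cycle_sum_shift_cycle:
  fixes A :: "nat \<Rightarrow> 'i \<Rightarrow> 'i \<Rightarrow> 'a::comm_ring_1"
  assumes S: "finite S"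
  shows "alt_cycle_sum S (2 * card S) A (shift_cycle (2 * card S)) = 0"
proof -
  define m where "m = 2 * card S"
  let ?N = "shift_cycle m"
  define E :: "(nat \<Rightarrow> 'i \<times> 'i) \<Rightarrow> nat \<Rightarrow> 'i \<Rightarrow> 'i \<Rightarrow> int"
    where "E g s a b = of_bool (g s = (a, b))" for g s a b
  let ?G = "{..m} \<rightarrow>\<^sub>E (S \<times> S)"
  have "(\<Prod>p\<le>m. A (\<tau> p) (i p) (i (?N p))) =
      (\<Sum>g\<in>?G. (\<Prod>s\<le>m. case_prod (A s) (g s)) * of_int (\<Prod>p\<le>m. E g (\<tau> p) (i p) (i (?N p))))"
    if \<tau>: "\<tau> permutes {..<m}" and i: "i \<in> {..m} \<rightarrow>\<^sub>E S" for \<tau> i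
  proof -
    have \<tau>': "\<tau> permutes {..m}" using \<tau> by (rule permutes_subset) auto
    \<comment> \<open>\<open>h\<close> records which entry of each matrix occurs in the product for
      \<open>\<tau>\<close> and \<open>i\<close>; it is the only choice \<open>g\<close> of matrix
      units whose product of entries is not 0.\<close>
    define h where "h = (\<lambda>s\<in>{..m}. (i (inv_into UNIV \<tau> s), i (?N (inv_into UNIV \<tau> s))))"
    have hG: "h \<in> ?G"
      using i permutes_in_image[OF permutes_inv[OF \<tau>']] permutes_in_image[OF shift_cycle_permutes[of m]]
      by (auto simp: h_def PiE_iff)
    have h\<tau>: "h (\<tau> p) = (i p, i (?N p))" if "p \<le> m" for p
      using that permutes_in_image[OF \<tau>', of p] permutes_inverses[OF \<tau>'] by (simp add: h_def)
    have ind: "(\<Prod>p\<le>m. E g (\<tau> p) (i p) (i (?N p))) = of_bool (g = h)" if g: "g \<in> ?G" for g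
    proof -
      have "(\<Prod>p\<le>m. E g (\<tau> p) (i p) (i (?N p))) = (\<Prod>p\<le>m. (\<lambda>s. of_bool (g s = h s)) (\<tau> p))"
        by (intro prod.cong) (auto simp: E_def h\<tau>)
      also have "\<dots> = (\<Prod>s\<le>m. of_bool (g s = h s))"
        using prod.permute[OF \<tau>', of "\<lambda>s. of_bool (g s = h s) :: int"] by (simp add: o_def)
      also have "\<dots> = of_bool (\<forall>s\<in>{..m}. g s = h s)" by (induction m) (auto simp: atMost_Suc)
      also have "(\<forall>s\<in>{..m}. g s = h s) \<longleftrightarrow> g = h"
        using PiE_ext[OF g hG] by auto
      finally show ?thesis .
    qed
    have "(\<Sum>g\<in>?G. (\<Prod>s\<le>m. case_prod (A s) (g s)) * of_int (\<Prod>p\<le>m. E g (\<tau> p) (i p) (i (?N p))))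
       = (\<Sum>g\<in>?G. if g = h then (\<Prod>s\<le>m. case_prod (A s) (h s)) else 0)"
      by (intro sum.cong refl, subst ind) auto
    also have "\<dots> = (\<Prod>s\<le>m. case_prod (A s) (h s))"
      using S hG by (simp add: finite_PiE)
    also have "\<dots> = (\<Prod>p\<le>m. case_prod (A (\<tau> p)) (h (\<tau> p)))"
      using prod.permute[OF \<tau>', of "\<lambda>s. case_prod (A s) (h s)"] by (simp add: o_def)
    also have "\<dots> = (\<Prod>p\<le>m. A (\<tau> p) (i p) (i (?N p)))"
      by (intro prod.cong refl) (simp add: h\<tau>)
    finally show ?thesis ..
  qed
  then have "alt_cycle_sum S m A ?N = (\<Sum>\<tau> | \<tau> permutes {..<m}. \<Sum>i\<in>{..m} \<rightarrow>\<^sub>E S. \<Sum>g\<in>?G.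
      (\<Prod>s\<le>m. case_prod (A s) (g s)) *
      of_int (sign \<tau> * (\<Prod>p\<le>m. E g (\<tau> p) (i p) (i (?N p)))))"
    unfolding alt_cycle_sum_def by (intro sum.cong refl) (simp add: sum_distrib_left mult_ac)
  also have "\<dots> = (\<Sum>\<tau> | \<tau> permutes {..<m}. \<Sum>g\<in>?G. \<Sum>i\<in>{..m} \<rightarrow>\<^sub>E S. 
      (\<Prod>s\<le>m. case_prod (A s) (g s)) *
      of_int (sign \<tau> * (\<Prod>p\<le>m. E g (\<tau> p) (i p) (i (?N p)))))"
    by (intro sum.cong refl sum.swap)
  also have "\<dots> = (\<Sum>g\<in>?G. (\<Prod>s\<le>m. case_prod (A s) (g s)) * of_int (alt_cycle_sum S m (E g) ?N))"
    by (subst sum.swap) (simp add: alt_cycle_sum_def sum_distrib_left)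
  also have "\<dots> = 0"
    using alt_cycle_sum_shift_cycle_int[OF S refl] by (simp add: m_def)
  finally show ?thesis by (simp add: m_def)
qed

section \<open>Substitution homomorphisms of the free algebra\<close>

lemma prod_list_ncvar: "prod_list (map ncvar l) = Poly_Mapping.single (Word l) (1::'k::ring_1)"
  by (induction l) (simp_all add: ncvar_def mult_single plus_word_def single_one flip: zero_word_def)

lemma ncconst_1: "ncconst 1 = 1"
  by (simp add: ncconst_def single_one)

lemma poly_mapping_sum_single:
  "p = (\<Sum>w\<in>Poly_Mapping.keys p. Poly_Mapping.single w (Poly_Mapping.lookup p w))"
  by (rule poly_mapping_eqI) (simp add: lookup_sum lookup_single when_def in_keys_iff)

lemma ncconst_commute: "ncconst (c::'k::comm_ring_1) * p = p * ncconst c"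
proof -
  let ?S = "\<Sum>w\<in>Poly_Mapping.keys p. Poly_Mapping.single w (Poly_Mapping.lookup p w)"
  have "ncconst c * ?S = ?S * ncconst c"
    unfolding sum_distrib_left sum_distrib_right
    by (rule sum.cong[OF refl]) (simp add: ncconst_def mult_single mult.commute[of c])
  then show ?thesis by (simp flip: poly_mapping_sum_single)
qed

lemma ncpoly_sum_words:
  "p = (\<Sum>w\<in>Poly_Mapping.keys p. ncconst (Poly_Mapping.lookup p w) * prod_list (map ncvar (letters w)))"
  by (subst poly_mapping_sum_single) (simp add: prod_list_ncvar ncconst_def mult_single)

text \<open>Centrality of the scalars is what makes substitution multiplicative. Two instances
  occur: \<open>of_int\<close> for polynomial identities, whose coefficients are integers, and
  \<open>scal\<close> for representations over the field.\<close>

definition central_hom :: "('k::ring_1 \<Rightarrow> 'a::ring_1) \<Rightarrow> bool"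
  where "central_hom s \<longleftrightarrow> s 1 = 1 \<and> (\<forall>c d. s (c + d) = s c + s d) \<and>
    (\<forall>c d. s (c * d) = s c * s d) \<and> (\<forall>c x. s c * x = x * s c)"

definition nc_subst :: "('k::ring_1 \<Rightarrow> 'a::ring_1) \<Rightarrow> ('v \<Rightarrow> 'a) \<Rightarrow> ('v, 'k) ncpoly \<Rightarrow> 'a"
  where "nc_subst s u p =
    (\<Sum>w\<in>Poly_Mapping.keys p. s (Poly_Mapping.lookup p w) * prod_list (map u (letters w)))"

lemma central_homD:
  assumes "central_hom s"
  shows "s 1 = 1" "s (c + d) = s c + s d" "s (c * d) = s c * s d" "s c * x = x * s c" "s 0 = 0"
    "s (- c) = - s c"
proof -
  show 1: "s 1 = 1" "s (c + d) = s c + s d" "s (c * d) = s c * s d" "s c * x = x * s c" for c d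
    using assms unfolding central_hom_def by blast+
  show 0: "s 0 = 0" using 1(2)[of 0 0] by simp
  show "s (- c) = - s c" using 1(2)[of c "- c"] 0 by (intro minus_unique[symmetric]) simp
qed

lemma central_hom_of_int: "central_hom (of_int :: int \<Rightarrow> 'a::ring_1)"
  unfolding central_hom_def by (intro conjI allI mult_of_int_commute) simp_all

context
  fixes s :: "'k::ring_1 \<Rightarrow> 'a::ring_1"
  assumes s: "central_hom s"
begin

lemma nc_subst_superset:
  assumes "finite T" "Poly_Mapping.keys p \<subseteq> T"
  shows "nc_subst s u p = (\<Sum>w\<in>T. s (Poly_Mapping.lookup p w) * prod_list (map u (letters w)))"
  unfolding nc_subst_def
  by (rule sum.mono_neutral_left) (use assms in \<open>auto simp: in_keys_iff central_homD(5)[OF s]\<close>)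

lemma nc_subst_add: "nc_subst s u (p + r) = nc_subst s u p + nc_subst s u r"
proof -
  let ?T = "Poly_Mapping.keys p \<union> Poly_Mapping.keys r"
  have "Poly_Mapping.keys (p + r) \<subseteq> ?T" by (rule Poly_Mapping.keys_add)
  then show ?thesis
    by (simp add: nc_subst_superset[of ?T] lookup_add central_homD(2)[OF s] distrib_right sum.distrib)
qed

lemma nc_subst_0: "nc_subst s u 0 = 0"
  by (simp add: nc_subst_def)

lemma nc_subst_sum: "nc_subst s u (sum f T) = (\<Sum>t\<in>T. nc_subst s u (f t))"
  by (induction T rule: infinite_finite_induct) (simp_all add: nc_subst_add nc_subst_0)

lemma nc_subst_single:
  "nc_subst s u (Poly_Mapping.single w c) = s c * prod_list (map u (letters w))"
  by (subst nc_subst_superset[of "{w}"]) auto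

lemma nc_subst_mult: "nc_subst s u (p * r) = nc_subst s u p * nc_subst s u r"
proof -
  let ?l = Poly_Mapping.lookup
  have "p * r = (\<Sum>w\<in>Poly_Mapping.keys p. \<Sum>v\<in>Poly_Mapping.keys r.
      Poly_Mapping.single (w + v) (?l p w * ?l r v))"
    by (subst poly_mapping_sum_single[of p], subst poly_mapping_sum_single[of r])
       (simp add: sum_product mult_single)
  then have "nc_subst s u (p * r) = (\<Sum>w\<in>Poly_Mapping.keys p. \<Sum>v\<in>Poly_Mapping.keys r.
      s (?l p w) * (s (?l r v) * prod_list (map u (letters w))) * prod_list (map u (letters v)))"
    by (simp add: nc_subst_sum nc_subst_single central_homD(3)[OF s] plus_word_def mult.assoc)
  also have "\<dots> = (\<Sum>w\<in>Poly_Mapping.keys p. \<Sum>v\<in>Poly_Mapping.keys r.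
      s (?l p w) * prod_list (map u (letters w)) * (s (?l r v) * prod_list (map u (letters v))))"
    by (intro sum.cong refl) (simp only: central_homD(4)[OF s, of "?l r _" "prod_list (map u (letters _))"] mult.assoc)
  also have "\<dots> = nc_subst s u p * nc_subst s u r"
    by (simp only: nc_subst_def sum_product)
  finally show ?thesis .
qed

lemma nc_subst_ncconst: "nc_subst s u (ncconst c) = s c"
  by (simp add: ncconst_def nc_subst_single zero_word_def)

lemma nc_subst_1: "nc_subst s u 1 = 1"
  using nc_subst_ncconst[of u 1] by (simp add: ncconst_1 central_homD(1)[OF s])

lemma nc_subst_ncvar: "nc_subst s u (ncvar v) = u v"
  by (simp add: ncvar_def nc_subst_single central_homD(1)[OF s])

lemma nc_subst_minus: "nc_subst s u (- p) = - nc_subst s u p"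
  using nc_subst_add[of u p "- p"] by (intro minus_unique[symmetric]) (simp add: nc_subst_0)

lemma nc_subst_diff: "nc_subst s u (p - r) = nc_subst s u p - nc_subst s u r"
  using nc_subst_add[of u p "- r"] by (simp add: nc_subst_minus)

end

section \<open>Matrix representations and PI degree\<close>

text \<open>Entries outside \<open>I\<close> are left free, and scalars of the source ring are not
  mentioned: identities have integer coefficients, and compatibility with these follows from
  additivity.\<close>

definition matrix_rep :: "'i set \<Rightarrow> ('p::ring_1 \<Rightarrow> 'i \<Rightarrow> 'i \<Rightarrow> 'f::comm_ring_1) \<Rightarrow> bool"
  where "matrix_rep I \<rho> \<longleftrightarrow> (\<forall>x\<in>I. \<forall>y\<in>I. \<rho> 1 x y = of_bool (x = y) \<and>
    (\<forall>p r. \<rho> (p + r) x y = \<rho> p x y + \<rho> r x y \<and> \<rho> (p * r) x y = (\<Sum>z\<in>I. \<rho> p x z * \<rho> r z y)))"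

lemma matrix_repD:
  assumes "matrix_rep I \<rho>" "x \<in> I" "y \<in> I"
  shows "\<rho> 1 x y = of_bool (x = y)" "\<rho> (p + r) x y = \<rho> p x y + \<rho> r x y"
    "\<rho> (p * r) x y = (\<Sum>z\<in>I. \<rho> p x z * \<rho> r z y)" "\<rho> 0 x y = 0" "\<rho> (- p) x y = - \<rho> p x y"
    "\<rho> (sum f T) x y = (\<Sum>t\<in>T. \<rho> (f t) x y)" "\<rho> (of_int k * p) x y = of_int k * \<rho> p x y"
proof -
  show 1: "\<rho> 1 x y = of_bool (x = y)" "\<rho> (p + r) x y = \<rho> p x y + \<rho> r x y"
    "\<rho> (p * r) x y = (\<Sum>z\<in>I. \<rho> p x z * \<rho> r z y)" for p r
    using assms by (auto simp: matrix_rep_def)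
  show 0: "\<rho> 0 x y = 0" using 1(2)[of 0 0] by simp
  show m: "\<rho> (- p) x y = - \<rho> p x y" for p
    using 1(2)[of p "- p"] 0 by (intro minus_unique[symmetric]) simp
  show "\<rho> (sum f T) x y = (\<Sum>t\<in>T. \<rho> (f t) x y)"
    by (induction T rule: infinite_finite_induct) (simp_all add: 0 1)
  have n: "\<rho> (of_nat n * p) x y = of_nat n * \<rho> p x y" for n
    by (induction n) (simp_all add: 0 1 distrib_right)
  show "\<rho> (of_int k * p) x y = of_int k * \<rho> p x y"
    by (cases k rule: int_cases2) (simp_all add: n m)
qed

lemma sum_PiE_atMost_Suc:
  "(\<Sum>i\<in>{..Suc L} \<rightarrow>\<^sub>E I. f i) = (\<Sum>z\<in>I. \<Sum>i\<in>{..L} \<rightarrow>\<^sub>E I. f (i(Suc L := z)))"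
proof -
  have "{..Suc L} = insert (Suc L) {..L}" by auto
  then have "(\<Sum>i\<in>{..Suc L} \<rightarrow>\<^sub>E I. f i) = sum f ((\<lambda>(y, g). g(Suc L := y)) ` (I \<times> ({..L} \<rightarrow>\<^sub>E I)))"
    by (simp only: PiE_insert_eq)
  also have "\<dots> = (\<Sum>(z, i)\<in>I \<times> ({..L} \<rightarrow>\<^sub>E I). f (i(Suc L := z)))"
    using inj_combinator[of "Suc L" "{..L}" "\<lambda>_. I"]
    by (subst sum.reindex) (simp_all add: case_prod_unfold o_def)
  finally show ?thesis by (simp add: sum.cartesian_product)
qed

text \<open>Expansion of a matrix product over paths. The endpoints are imposed by an indicator
  rather than by the range of \<open>i\<close>, so that the sum has the shape of
  \<open>alt_cycle_sum\<close>.\<close>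

lemma matrix_rep_prod_list:
  fixes \<rho> :: "'p::ring_1 \<Rightarrow> 'i \<Rightarrow> 'i \<Rightarrow> 'f::comm_ring_1"
  assumes \<rho>: "matrix_rep I \<rho>" and "finite I" and "x \<in> I" "y \<in> I"
  shows "\<rho> (prod_list (map a l)) x y = (\<Sum>i\<in>{..length l} \<rightarrow>\<^sub>E I.
    of_bool (i 0 = x \<and> i (length l) = y) * (\<Prod>r<length l. \<rho> (a (l ! r)) (i r) (i (Suc r))))"
  using \<open>y \<in> I\<close>
proof (induction l arbitrary: y rule: rev_induct)
  case Nil
  have "(\<Sum>i\<in>{..0::nat} \<rightarrow>\<^sub>E I. of_bool (i 0 = x \<and> i 0 = y)) =
    (\<Sum>i\<in>{..0::nat} \<rightarrow>\<^sub>E I. if i = (\<lambda>p\<in>{..0}. x) then of_bool (x = y) else 0 :: 'f)"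
  proof (rule sum.cong[OF refl])
    fix i :: "nat \<Rightarrow> 'i" assume "i \<in> {..0} \<rightarrow>\<^sub>E I"
    then have "i 0 = x \<longleftrightarrow> i = (\<lambda>p\<in>{..0}. x)"
      by (auto simp: fun_eq_iff PiE_iff extensional_def)
    then show "of_bool (i 0 = x \<and> i 0 = y) = (if i = (\<lambda>p\<in>{..0}. x) then of_bool (x = y) else 0 :: 'f)"
      by auto
  qed
  also have "\<dots> = of_bool (x = y)"
    using assms by (subst sum.delta) (auto simp: finite_PiE)
  finally show ?case using matrix_repD(1)[OF \<rho> \<open>x \<in> I\<close> Nil]
    by (simp only: list.map prod_list.Nil list.size lessThan_0 prod.empty mult_1_right)
next
  case (snoc b l)
  let ?L = "length l"
  let ?P = "\<lambda>i. \<Prod>r<?L. \<rho> (a (l ! r)) (i r) (i (Suc r))"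
  let ?A = "{..?L} \<rightarrow>\<^sub>E I"
  have "\<rho> (prod_list (map a (l @ [b]))) x y = (\<Sum>z\<in>I. \<rho> (prod_list (map a l)) x z * \<rho> (a b) z y)"
    using assms(3) snoc.prems by (simp add: matrix_repD(3)[OF \<rho>])
  also have "\<dots> = (\<Sum>z\<in>I. \<Sum>i\<in>?A. if z = i ?L then of_bool (i 0 = x) * ?P i * \<rho> (a b) (i ?L) y else 0)"
    by (intro sum.cong refl) (auto simp: snoc.IH sum_distrib_right intro!: sum.cong)
  also have "\<dots> = (\<Sum>i\<in>?A. \<Sum>z\<in>I. if z = i ?L then of_bool (i 0 = x) * ?P i * \<rho> (a b) (i ?L) y else 0)"
    by (rule sum.swap)
  also have "\<dots> = (\<Sum>i\<in>?A. of_bool (i 0 = x) * ?P i * \<rho> (a b) (i ?L) y)"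
    using assms(2) by (intro sum.cong refl, subst sum.delta) (auto simp: PiE_iff)
  also have "\<dots> = (\<Sum>i\<in>?A. \<Sum>z\<in>I. if z = y then of_bool (i 0 = x) * ?P i * \<rho> (a b) (i ?L) y else 0)"
    using assms(2) snoc.prems by (intro sum.cong refl, subst sum.delta) auto
  also have "\<dots> = (\<Sum>z\<in>I. \<Sum>i\<in>?A. if z = y then of_bool (i 0 = x) * ?P i * \<rho> (a b) (i ?L) y else 0)"
    by (rule sum.swap)
  also have "\<dots> = (\<Sum>i\<in>{..length (l @ [b])} \<rightarrow>\<^sub>E I.
    of_bool (i 0 = x \<and> i (length (l @ [b])) = y) * (\<Prod>r<length (l @ [b]). \<rho> (a ((l @ [b]) ! r)) (i r) (i (Suc r))))"
    by (simp add: sum_PiE_atMost_Suc, intro sum.cong refl)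
       (auto simp: nth_append intro!: prod.cong arg_cong2[where f = "(*)"])
  finally show ?case .
qed

section \<open>The standard polynomial\<close>

definition std_poly :: "nat \<Rightarrow> (nat, int) ncpoly"
  where "std_poly e = (\<Sum>\<tau> | \<tau> permutes {..<e}. Poly_Mapping.single (Word (map \<tau> [0..<e])) (sign \<tau>))"

lemma permutes_eqI_map:
  assumes "\<sigma> permutes {..<e}" "\<tau> permutes {..<e}" "map \<sigma> [0..<e] = map \<tau> [0..<e]"
  shows "\<sigma> = \<tau>"
proof
  fix x show "\<sigma> x = \<tau> x"
    using assms permutes_not_in[OF assms(1), of x] permutes_not_in[OF assms(2), of x]
    by (cases "x < e") auto
qed

lemma nc_monic_std_poly: "nc_monic e (std_poly e)"
proof -
  have "length (letters w) \<le> e" if "w \<in> Poly_Mapping.keys (std_poly e)" for w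
  proof -
    have "w \<in> (\<Union>\<tau>\<in>{\<tau>. \<tau> permutes {..<e}}.
        Poly_Mapping.keys (Poly_Mapping.single (Word (map \<tau> [0..<e])) (sign \<tau>)))"
      by (rule subsetD[OF keys_sum that[unfolded std_poly_def]])
    then show ?thesis by auto
  qed
  moreover have "Poly_Mapping.lookup (std_poly e) (Word (map id [0..<e])) = 1"
  proof -
    have "Poly_Mapping.lookup (std_poly e) (Word (map id [0..<e])) =
      (\<Sum>\<tau> | \<tau> permutes {..<e}. if \<tau> = id then 1 else 0)"
      unfolding std_poly_def lookup_sum
      using permutes_eqI_map[OF _ permutes_id]
      by (intro sum.cong) (auto simp: lookup_single when_def)
    then show ?thesis by (simp add: finite_permutations permutes_id)
  qed
  moreover have "length (letters (Word (map id [0..<e]))) = e" by simp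
  ultimately show ?thesis unfolding nc_monic_def by blast
qed

lemma matrix_rep_std_poly:
  assumes \<rho>: "matrix_rep I \<rho>" and I: "finite I" "x \<in> I" "y \<in> I"
  shows "\<rho> (nc_subst of_int a (std_poly (2 * card I))) x y = 0"
proof -
  let ?e = "2 * card I"
  \<comment> \<open>The matrix placed at position \<open>?e\<close> is the matrix unit with entry 1
    at \<open>y\<close>, \<open>x\<close>. It closes a path from \<open>x\<close> to
    \<open>y\<close> into a cycle, so the trace returns exactly the desired entry of the standard
    polynomial.\<close>
  define A where "A s = (if s < ?e then \<rho> (a s) else (\<lambda>u v. of_bool (u = y \<and> v = x)))" for s
  have "\<rho> (nc_subst of_int a (std_poly ?e)) x y =
     (\<Sum>\<tau> | \<tau> permutes {..<?e}. \<Sum>i\<in>{..?e} \<rightarrow>\<^sub>E I. of_int (sign \<tau>) *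
       (of_bool (i 0 = x \<and> i ?e = y) * (\<Prod>r<?e. \<rho> (a (\<tau> r)) (i r) (i (Suc r)))))"
    using I by (simp add: std_poly_def nc_subst_sum[OF central_hom_of_int] o_def
        nc_subst_single[OF central_hom_of_int] matrix_repD(6,7)[OF \<rho>] sum_distrib_left
        matrix_rep_prod_list[OF \<rho>, of _ _ "\<lambda>r. a (_ r)"])
  also have "\<dots> = alt_cycle_sum I ?e A (shift_cycle ?e)"
    unfolding alt_cycle_sum_def
  proof (intro sum.cong refl arg_cong2[where f = "(*)"])
    fix \<tau> i assume "\<tau> \<in> {\<tau>. \<tau> permutes {..<?e}}"
    then have \<tau>: "\<tau> permutes {..<?e}" by simp
    have "(\<Prod>p\<le>?e. A (\<tau> p) (i p) (i (shift_cycle ?e p))) =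
        (\<Prod>p<?e. A (\<tau> p) (i p) (i (shift_cycle ?e p))) * A (\<tau> ?e) (i ?e) (i (shift_cycle ?e ?e))"
      by (simp flip: lessThan_Suc_atMost)
    also have "A (\<tau> ?e) (i ?e) (i (shift_cycle ?e ?e)) = of_bool (i 0 = x \<and> i ?e = y)"
      using permutes_not_in[OF \<tau>, of ?e] by (auto simp: A_def shift_cycle_def)
    also have "(\<Prod>p<?e. A (\<tau> p) (i p) (i (shift_cycle ?e p))) = (\<Prod>r<?e. \<rho> (a (\<tau> r)) (i r) (i (Suc r)))"
      using permutes_in_image[OF \<tau>] by (intro prod.cong) (auto simp: A_def shift_cycle_def)
    finally show "of_bool (i 0 = x \<and> i ?e = y) * (\<Prod>r<?e. \<rho> (a (\<tau> r)) (i r) (i (Suc r))) =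
       (\<Prod>p\<le>?e. A (\<tau> p) (i p) (i (shift_cycle ?e p)))" by (simp add: mult.commute)
  qed
  also have "\<dots> = 0" by (rule alt_cycle_sum_shift_cycle[OF I(1)])
  finally show ?thesis .
qed

section \<open>Evaluation of identities in the free algebra and its quotients\<close>

lemma free_algebra_sel:
  "x \<otimes>\<^bsub>free_algebra X\<^esub> y = x * y" "x \<oplus>\<^bsub>free_algebra X\<^esub> y = x + y"
  "\<one>\<^bsub>free_algebra X\<^esub> = 1" "\<zero>\<^bsub>free_algebra X\<^esub> = 0"
  by (simp_all add: free_algebra_def)

lemma free_algebra_minus_closed:
  "p \<in> carrier (free_algebra X) \<Longrightarrow> - p \<in> carrier (free_algebra X)"
  by (simp add: free_algebra_def)

lemma free_algebra_a_inv:
  assumes "p \<in> carrier (free_algebra X)"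
  shows "\<ominus>\<^bsub>free_algebra X\<^esub> p = - p"
proof -
  interpret ring "free_algebra X" by (rule ring_free_algebra)
  show ?thesis
    using minus_equality[of "- p" p] assms free_algebra_minus_closed[of p X]
    by (simp add: free_algebra_sel)
qed

lemma free_algebra_add_pow:
  assumes "p \<in> carrier (free_algebra X)"
  shows "[(k::int)] \<cdot>\<^bsub>free_algebra X\<^esub> p = of_int k * p"
proof -
  interpret ring "free_algebra X" by (rule ring_free_algebra)
  have nat: "[(n::nat)] \<cdot>\<^bsub>free_algebra X\<^esub> p = of_nat n * p" for n
    using assms by (induction n) (simp_all add: free_algebra_sel algebra_simps)
  have cl: "[(n::nat)] \<cdot>\<^bsub>free_algebra X\<^esub> p \<in> carrier (free_algebra X)" for n
    using assms by simp
  show ?thesis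
  proof (cases "k \<ge> 0")
    case True
    then show ?thesis using nat[of "nat k"] by (simp add: add_pow_int_ge)
  next
    case False
    then have "[k] \<cdot>\<^bsub>free_algebra X\<^esub> p = - (of_nat (nat (- k)) * p)"
      using cl[of "nat (- k)"] by (simp add: add_pow_int_lt nat free_algebra_a_inv)
    then show ?thesis using False by simp
  qed
qed

lemma free_algebra_finsum:
  "(\<And>t. t \<in> T \<Longrightarrow> f t \<in> carrier (free_algebra X)) \<Longrightarrow> finsum (free_algebra X) f T = sum f T"
proof (induction T rule: infinite_finite_induct)
  case (insert t T)
  interpret ring "free_algebra X" by (rule ring_free_algebra)
  show ?case using insert by (subst finsum_insert) (auto simp: free_algebra_sel)
next
  case empty
  interpret ring "free_algebra X" by (rule ring_free_algebra)
  show ?case by (simp add: free_algebra_sel)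
next
  case (infinite T)
  interpret ring "free_algebra X" by (rule ring_free_algebra)
  show ?case using infinite by (simp add: finsum_infinite free_algebra_sel)
qed

lemma word_eval_free_algebra: "word_eval (free_algebra X) a w = prod_list (map a (letters w))"
proof -
  have "foldr (\<lambda>i x. a i \<otimes>\<^bsub>free_algebra X\<^esub> x) l \<one>\<^bsub>free_algebra X\<^esub> = prod_list (map a l)" for l
    by (induction l) (simp_all add: free_algebra_sel)
  then show ?thesis by (simp add: word_eval_def)
qed

lemma prod_list_carrier:
  assumes "\<And>i. i \<in> set l \<Longrightarrow> a i \<in> carrier (free_algebra X)"
  shows "prod_list (map a l) \<in> carrier (free_algebra X)"
proof -
  interpret ring "free_algebra X" by (rule ring_free_algebra)
  show ?thesis using assms
    by (induction l) (use one_closed free_algebra_carrierI(3) in \<open>auto simp: free_algebra_sel\<close>)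
qed

lemma sum_carrier:
  assumes "\<And>t. t \<in> T \<Longrightarrow> f t \<in> carrier (free_algebra X)"
  shows "sum f T \<in> carrier (free_algebra X)"
proof -
  interpret ring "free_algebra X" by (rule ring_free_algebra)
  have "0 \<in> carrier (free_algebra X)" using zero_closed by (simp add: free_algebra_sel)
  then show ?thesis using assms
    by (induction T rule: infinite_finite_induct) (auto intro: free_algebra_carrierI(4))
qed

context
  fixes X :: "'v set" and a :: "nat \<Rightarrow> ('v, 'k::ring_1) ncpoly"
  assumes a: "\<And>i. a i \<in> carrier (free_algebra X)"
begin

lemma nc_term_carrier:
  "[(k::int)] \<cdot>\<^bsub>free_algebra X\<^esub> word_eval (free_algebra X) a w \<in> carrier (free_algebra X)"
proof -
  interpret ring "free_algebra X" by (rule ring_free_algebra)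
  have "word_eval (free_algebra X) a w \<in> carrier (free_algebra X)"
    unfolding word_eval_free_algebra by (rule prod_list_carrier[OF a])
  then show ?thesis by (rule add.int_pow_closed)
qed

lemma nc_eval_free_algebra: "nc_eval (free_algebra X) a f = nc_subst of_int a f"
proof -
  have "nc_eval (free_algebra X) a f = (\<Sum>w\<in>Poly_Mapping.keys f.
     [Poly_Mapping.lookup f w] \<cdot>\<^bsub>free_algebra X\<^esub> word_eval (free_algebra X) a w)"
    unfolding nc_eval_def by (rule free_algebra_finsum[OF nc_term_carrier])
  then show ?thesis
    using prod_list_carrier[of _ a X, OF a]
    by (simp add: nc_subst_def word_eval_free_algebra free_algebra_add_pow)
qed

lemma nc_subst_carrier: "nc_subst of_int a f \<in> carrier (free_algebra X)"
proof -
  interpret ring "free_algebra X" by (rule ring_free_algebra)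
  show ?thesis
    using finsum_closed[of "\<lambda>w. [Poly_Mapping.lookup f w] \<cdot>\<^bsub>free_algebra X\<^esub> word_eval (free_algebra X) a w"
      "Poly_Mapping.keys f"] nc_term_carrier
    by (simp add: nc_eval_def flip: nc_eval_free_algebra)
qed

lemma nc_eval_quotient:
  assumes "ideal J (free_algebra X)"
  shows "nc_eval (free_algebra X Quot J) (\<lambda>i. J +>\<^bsub>free_algebra X\<^esub> a i) f =
    J +>\<^bsub>free_algebra X\<^esub> nc_subst of_int a f"
proof -
  let ?F = "free_algebra X" and ?Q = "free_algebra X Quot J"
  interpret h: ring_hom_ring ?F ?Q "(+>\<^bsub>free_algebra X\<^esub>) J"
    by (rule ideal.rcos_ring_hom_ring[OF assms])
  let ?h = "(+>\<^bsub>free_algebra X\<^esub>) J"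
  have hw: "word_eval ?Q (\<lambda>i. ?h (a i)) w = ?h (word_eval ?F a w)" for w
  proof -
    have "foldr (\<lambda>i x. ?h (a i) \<otimes>\<^bsub>?Q\<^esub> x) l \<one>\<^bsub>?Q\<^esub> = ?h (foldr (\<lambda>i x. a i \<otimes>\<^bsub>?F\<^esub> x) l \<one>\<^bsub>?F\<^esub>) \<and>
      foldr (\<lambda>i x. a i \<otimes>\<^bsub>?F\<^esub> x) l \<one>\<^bsub>?F\<^esub> \<in> carrier ?F" for l
      by (induction l) (simp_all add: a)
    then show ?thesis by (simp add: word_eval_def)
  qed
  have hp: "?h ([(k::int)] \<cdot>\<^bsub>?F\<^esub> word_eval ?F a w) = [k] \<cdot>\<^bsub>?Q\<^esub> word_eval ?Q (\<lambda>i. ?h (a i)) w" for k w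
  proof -
    interpret g: group_hom "add_monoid ?F" "add_monoid ?Q" ?h
      using h.a_group_hom .
    have "word_eval ?F a w \<in> carrier ?F"
      unfolding word_eval_free_algebra by (rule prod_list_carrier[OF a])
    then show ?thesis using g.hom_int_pow[of "word_eval ?F a w" k] by (simp add: hw add_pow_def)
  qed
  have hs: "?h (finsum ?F g T) = finsum ?Q (\<lambda>t. ?h (g t)) T" if "\<And>t. g t \<in> carrier ?F"
    for g :: "nat word \<Rightarrow> ('v, 'k) ncpoly" and T
    using that by (induction T rule: infinite_finite_induct) (simp_all add: h.S.finsum_infinite Pi_def)
  show ?thesis
    unfolding nc_eval_free_algebra[symmetric] nc_eval_def
    by (simp add: hs[OF nc_term_carrier] hp)
qed

end

text \<open>Arguments in the quotient are lifted to representatives, and evaluation commutes with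
  the quotient map. Identities thereby become membership in the ideal, which representations can
  test.\<close>

lemma polynomial_identity_presented_algebra:
  assumes R: "R \<subseteq> carrier (free_algebra X)"
  shows "polynomial_identity (presented_algebra X R) f \<longleftrightarrow>
    (\<forall>a. (\<forall>i. a i \<in> carrier (free_algebra X)) \<longrightarrow>
      nc_subst of_int a f \<in> Idl\<^bsub>free_algebra X\<^esub> R)"
proof -
  let ?F = "free_algebra X" and ?J = "Idl\<^bsub>free_algebra X\<^esub> R"
  interpret F: ring ?F by (rule ring_free_algebra)
  have J: "ideal ?J ?F" by (rule F.genideal_ideal[OF R])
  have zero: "\<zero>\<^bsub>?F Quot ?J\<^esub> = ?J" by (simp add: FactRing_def)
  have carr: "carrier (?F Quot ?J) = (\<lambda>x. ?J +>\<^bsub>?F\<^esub> x) ` carrier ?F"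
    by (auto simp: FactRing_def A_RCOSETS_def')
  have iff: "nc_eval (?F Quot ?J) (\<lambda>i. ?J +>\<^bsub>?F\<^esub> a i) f = \<zero>\<^bsub>?F Quot ?J\<^esub> \<longleftrightarrow> nc_subst of_int a f \<in> ?J"
    if a: "\<forall>i. a i \<in> carrier ?F" for a
    unfolding nc_eval_quotient[OF a[rule_format] J] zero
    by (rule iffI, rule ideal.rcos_const_imp_mem[OF J nc_subst_carrier[OF a[rule_format]]], assumption)
       (rule F.a_rcos_zero[OF J])
  show ?thesis
    unfolding polynomial_identity_def presented_algebra_def
  proof (intro iffI allI impI)
    fix a :: "nat \<Rightarrow> ('a, 'b) ncpoly"
    assume "\<forall>a. (\<forall>i. a i \<in> carrier (?F Quot ?J)) \<longrightarrow> nc_eval (?F Quot ?J) a f = \<zero>\<^bsub>?F Quot ?J\<^esub>"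
      and a: "\<forall>i. a i \<in> carrier ?F"
    then have "nc_eval (?F Quot ?J) (\<lambda>i. ?J +>\<^bsub>?F\<^esub> a i) f = \<zero>\<^bsub>?F Quot ?J\<^esub>"
      by (simp add: carr)
    then show "nc_subst of_int a f \<in> ?J" using iff[OF a] by simp
  next
    fix b :: "nat \<Rightarrow> ('a, 'b) ncpoly set" assume all: "\<forall>a. (\<forall>i. a i \<in> carrier ?F) \<longrightarrow> nc_subst of_int a f \<in> ?J"
      and b: "\<forall>i. b i \<in> carrier (?F Quot ?J)"
    then have "\<forall>i. \<exists>x. x \<in> carrier ?F \<and> b i = ?J +>\<^bsub>?F\<^esub> x"
      unfolding carr by blast
    then obtain a where a: "\<forall>i. a i \<in> carrier ?F \<and> b i = ?J +>\<^bsub>?F\<^esub> a i" by metis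
    then have "b = (\<lambda>i. ?J +>\<^bsub>?F\<^esub> a i)" by auto
    then show "nc_eval (?F Quot ?J) b f = \<zero>\<^bsub>?F Quot ?J\<^esub>" using iff[of a] a all by auto
  qed
qed

section \<open>Lower bound for the degree of an identity\<close>

lemma sum_Pow_alternating:
  assumes "finite A" "T \<subseteq> A"
  shows "(\<Sum>S\<in>Pow A. (-1) ^ card S * of_bool (T \<subseteq> S) :: int) = of_bool (T = A) * (-1) ^ card A"
proof (cases "T = A")
  case True
  have "(\<Sum>S\<in>Pow A. (-1) ^ card S * of_bool (T \<subseteq> S) :: int) = (\<Sum>S\<in>Pow A. if S = A then (-1) ^ card A else 0)"
    using True by (intro sum.cong) auto
  then show ?thesis using assms True by simp
next
  case False
  then obtain q where q: "q \<in> A" "q \<notin> T" using assms by auto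
  let ?g = "\<lambda>S. if q \<in> S then S - {q} else insert q S"
  let ?f = "\<lambda>S. (-1) ^ card S * of_bool (T \<subseteq> S) :: int"
  have "sum ?f (Pow A) = sum (\<lambda>S. - ?f S) (Pow A)"
  proof (rule sum.reindex_bij_witness[where i = ?g and j = ?g])
    fix S assume S: "S \<in> Pow A"
    then have fS: "finite S" using assms finite_subset by auto
    show "?g (?g S) = S" by auto
    show "?g (?g S) = S" by auto
    show "?g S \<in> Pow A" using S q by auto
    show "?g S \<in> Pow A" using S q by auto
    have "T \<subseteq> ?g S \<longleftrightarrow> T \<subseteq> S" using q by auto
    moreover have "(-1) ^ card (?g S) = - ((-1) ^ card S :: int)"
    proof (cases "q \<in> S")
      case True
      then obtain k where "card S = Suc k" using card.remove[OF fS] by blast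
      then show ?thesis using True by simp
    qed (use fS in simp)
    ultimately show "- ?f (?g S) = ?f S" by simp
  qed
  then show ?thesis using False by (simp add: sum_negf)
qed

text \<open>The substitution sends the \<open>p\<close>-th letter of a word of length \<open>e\<close> to the \<open>p\<close>-th edge of the
  staircase \<open>e\<^sub>1\<^sub>1, e\<^sub>1\<^sub>2, e\<^sub>2\<^sub>2, e\<^sub>2\<^sub>3, \<dots>\<close>, whose edges compose in one order only. Inclusion-exclusion
  over the edges isolates the products that use every edge exactly once.\<close>

lemma no_small_identity:
  fixes \<rho> :: "('v, 'k::ring_1) ncpoly \<Rightarrow> 'i \<Rightarrow> 'i \<Rightarrow> 'f::comm_ring_1"
  assumes \<rho>: "matrix_rep I \<rho>" and I: "finite I"
    and onto: "\<And>Y. \<exists>p\<in>carrier (free_algebra X). \<forall>x\<in>I. \<forall>y\<in>I. \<rho> p x y = Y x y"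
    and f: "nc_monic e (f :: (nat, int) ncpoly)" and e: "e < 2 * card I"
  shows "\<exists>a x y. (\<forall>i. a i \<in> carrier (free_algebra X)) \<and> x \<in> I \<and> y \<in> I \<and>
    \<rho> (nc_subst of_int a f) x y \<noteq> 0"
proof (rule ccontr)
  assume neg: "\<not> ?thesis"
  let ?l = Poly_Mapping.lookup
  obtain w where w: "length (letters w) = e" "?l f w = 1"
    and le: "\<And>u. u \<in> Poly_Mapping.keys f \<Longrightarrow> length (letters u) \<le> e"
    using f by (auto simp: nc_monic_def)
  define l where "l = letters w"
  obtain c where c: "bij_betw c {..<card I} I"
    using ex_bij_betw_nat_finite[OF I] by (auto simp: atLeast0LessThan)
  \<comment> \<open>Edge \<open>p\<close> of the staircase runs from vertex \<open>p div 2\<close>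
    to vertex \<open>(p + 1) div 2\<close>. Since \<open>e < 2 * card I\<close>, the vertices of the
    first \<open>e\<close> edges have numbers below \<open>card I\<close>.\<close>
  define Y :: "nat \<Rightarrow> 'i \<Rightarrow> 'i \<Rightarrow> 'f"
    where "Y p x y = of_bool (x = c (p div 2) \<and> y = c ((p + 1) div 2))" for p x y
  have "\<exists>y. y \<in> carrier (free_algebra X) \<and> (\<forall>s\<in>I. \<forall>t\<in>I. \<rho> y s t = Y p s t)" for p
    using onto[of "Y p"] by blast
  then obtain y where y: "\<And>p. y p \<in> carrier (free_algebra X)"
    "\<And>p s t. s \<in> I \<Longrightarrow> t \<in> I \<Longrightarrow> \<rho> (y p) s t = Y p s t" by metis
  \<comment> \<open>A letter may occur repeatedly in the word \<open>l\<close>, so it receives the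
    edges of all its positions. The set \<open>S\<close> says which edges are switched on, and is
    later summed over with signs.\<close>
  define a where "a S i = (\<Sum>p | p \<in> S \<and> l ! p = i. y p)" for S i
  let ?s = "c 0" and ?t = "c (e div 2)"
  have ci: "c k \<in> I" if "k < card I" for k using c that by (auto simp: bij_betw_def)
  have st: "?s \<in> I" "?t \<in> I" using ci e by auto
  have z: "\<rho> (nc_subst of_int (a S) f) ?s ?t = 0" for S
  proof -
    have "a S i \<in> carrier (free_algebra X)" for i unfolding a_def by (rule sum_carrier) (rule y)
    then show ?thesis using neg st by blast
  qed
  have \<rho>a: "\<rho> (a S i) s t = (\<Sum>p\<in>S. of_bool (l ! p = i) * Y p s t)" if "finite S" "s \<in> I" "t \<in> I" for S i s t
    using that y by (simp add: a_def matrix_repD(6)[OF \<rho>] sum.inter_filter[symmetric])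
      (rule sum.cong, auto)
  define tm where "tm u i g = (of_bool (i 0 = ?s \<and> i (length u) = ?t) :: 'f) *
    (\<Prod>r<length u. of_bool (l ! (g r) = u ! r) * Y (g r) (i r) (i (Suc r)))"
    for u :: "nat list" and i and g :: "nat \<Rightarrow> nat"
  let ?P = "\<lambda>u. {..length (letters u)} \<rightarrow>\<^sub>E I" and ?G = "\<lambda>u. {..<length (letters u)} \<rightarrow>\<^sub>E {..<e}"
  let ?K = "Poly_Mapping.keys f"
  have expand: "\<rho> (nc_subst of_int (a S) f) ?s ?t =
     (\<Sum>u\<in>?K. \<Sum>i\<in>?P u. \<Sum>g\<in>?G u. of_int (?l f u) *
        (of_bool (g ` {..<length (letters u)} \<subseteq> S) * tm (letters u) i g))" if S: "S \<subseteq> {..<e}" for S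
  proof -
    have fS: "finite S" using S finite_subset by blast
    have "\<rho> (nc_subst of_int (a S) f) ?s ?t = (\<Sum>u\<in>?K. of_int (?l f u) * \<rho> (prod_list (map (a S) (letters u))) ?s ?t)"
      by (simp add: nc_subst_def matrix_repD(6,7)[OF \<rho> st])
    also have "\<dots> = (\<Sum>u\<in>?K. of_int (?l f u) * (\<Sum>i\<in>?P u. \<Sum>g\<in>?G u.
        of_bool (g ` {..<length (letters u)} \<subseteq> S) * tm (letters u) i g))"
    proof (intro sum.cong refl arg_cong2[where f = "(*)"])
      fix u :: "nat word"
      let ?L = "length (letters u)"
      have "\<rho> (prod_list (map (a S) (letters u))) ?s ?t = (\<Sum>i\<in>?P u. of_bool (i 0 = ?s \<and> i ?L = ?t) *
          (\<Prod>r<?L. \<Sum>p\<in>S. of_bool (l ! p = letters u ! r) * Y p (i r) (i (Suc r))))"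
        unfolding matrix_rep_prod_list[OF \<rho> I st]
        using fS by (intro sum.cong refl arg_cong2[where f = "(*)"] prod.cong \<rho>a) (auto simp: PiE_iff)
      also have "\<dots> = (\<Sum>i\<in>?P u. \<Sum>g\<in>{..<?L} \<rightarrow>\<^sub>E S. tm (letters u) i g)"
      proof (rule sum.cong[OF refl])
        fix i
        show "of_bool (i 0 = ?s \<and> i ?L = ?t) *
          (\<Prod>r<?L. \<Sum>p\<in>S. of_bool (l ! p = letters u ! r) * Y p (i r) (i (Suc r))) =
          (\<Sum>g\<in>{..<?L} \<rightarrow>\<^sub>E S. tm (letters u) i g)"
          unfolding tm_def sum_distrib_left[symmetric] by (subst prod_sum_PiE) (use fS in auto)
      qed
      also have "\<dots> = (\<Sum>i\<in>?P u. \<Sum>g\<in>?G u. of_bool (g ` {..<?L} \<subseteq> S) * tm (letters u) i g)"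
      proof (rule sum.cong[OF refl])
        fix i
        have "(\<Sum>g\<in>{..<?L} \<rightarrow>\<^sub>E S. tm (letters u) i g) =
            (\<Sum>g\<in>{..<?L} \<rightarrow>\<^sub>E S. of_bool (g ` {..<?L} \<subseteq> S) * tm (letters u) i g)"
          by (intro sum.cong refl) (auto simp: PiE_iff image_subset_iff)
        also have "\<dots> = (\<Sum>g\<in>?G u. of_bool (g ` {..<?L} \<subseteq> S) * tm (letters u) i g)"
          by (rule sum.mono_neutral_left) (use S in \<open>auto simp: PiE_iff finite_PiE\<close>)
        finally show "(\<Sum>g\<in>{..<?L} \<rightarrow>\<^sub>E S. tm (letters u) i g) =
          (\<Sum>g\<in>?G u. of_bool (g ` {..<?L} \<subseteq> S) * tm (letters u) i g)" .
      qed
      finally show "\<rho> (prod_list (map (a S) (letters u))) ?s ?t =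
        (\<Sum>i\<in>?P u. \<Sum>g\<in>?G u. of_bool (g ` {..<?L} \<subseteq> S) * tm (letters u) i g)" .
    qed
    finally show ?thesis by (simp add: sum_distrib_left)
  qed
  \<comment> \<open>Using all \<open>e\<close> edges forces a word of length at least
    \<open>e\<close>, hence exactly \<open>e\<close> by the degree bound, and each edge is used
    once. Composability then fixes their order, and with it the word and the path.\<close>
  have tm: "tm (letters u) i g = of_bool (u = w \<and> i = (\<lambda>r\<in>{..e}. c (r div 2)) \<and> g = (\<lambda>r\<in>{..<e}. r))"
    if u: "u \<in> ?K" and i: "i \<in> ?P u" and g: "g \<in> ?G u" and gs: "g ` {..<length (letters u)} = {..<e}" for u i g
  proof -
    let ?L = "length (letters u)"
    have "e \<le> ?L" using card_image_le[of "{..<?L}" g] gs by simp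
    then have L: "?L = e" using le[OF u] by simp
    have inj: "inj_on g {..<e}" using gs L by (intro eq_card_imp_inj_on) auto
    show ?thesis
    proof (cases "tm (letters u) i g = 0")
      case True
      have "\<not> (u = w \<and> i = (\<lambda>r\<in>{..e}. c (r div 2)) \<and> g = (\<lambda>r\<in>{..<e}. r))"
      proof
        assume *: "u = w \<and> i = (\<lambda>r\<in>{..e}. c (r div 2)) \<and> g = (\<lambda>r\<in>{..<e}. r)"
        then have "tm (letters u) i g = 1"
          using L by (simp add: tm_def Y_def l_def)
        then show False using True by simp
      qed
      then show ?thesis using True by simp
    next
      case False
      have "tm (letters u) i g = (if i 0 = ?s \<and> i e = ?t
          then \<Prod>r<e. of_bool (l ! (g r) = letters u ! r) * Y (g r) (i r) (i (Suc r)) else 0)"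
        by (auto simp: tm_def L)
      then have ends: "i 0 = ?s" "i e = ?t"
        and pz: "(\<Prod>r<e. of_bool (l ! (g r) = letters u ! r) * Y (g r) (i r) (i (Suc r))) \<noteq> 0"
        using False by (simp_all split: if_splits)
      have nz: "of_bool (l ! (g r) = letters u ! r) * Y (g r) (i r) (i (Suc r)) \<noteq> 0" if "r < e" for r
      proof
        assume "of_bool (l ! (g r) = letters u ! r) * Y (g r) (i r) (i (Suc r)) = 0"
        then have "\<exists>r\<in>{..<e}. of_bool (l ! (g r) = letters u ! r) * Y (g r) (i r) (i (Suc r)) = 0"
          using that by (intro bexI[of _ r]) auto
        with prod_zero[OF finite_lessThan this] pz show False by argo
      qed
      have step: "l ! (g r) = letters u ! r" "i r = c (g r div 2)" "i (Suc r) = c ((g r + 1) div 2)"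
        if "r < e" for r
      proof -
        have "of_bool (l ! (g r) = letters u ! r \<and> i r = c (g r div 2) \<and> i (Suc r) = c ((g r + 1) div 2)) \<noteq> (0 :: 'f)"
          using nz[OF that] by (simp only: Y_def of_bool_conj not_False_eq_True)
        then show "l ! (g r) = letters u ! r" "i r = c (g r div 2)" "i (Suc r) = c ((g r + 1) div 2)"
          by (simp_all only: of_bool_eq_0_iff not_not)
      qed
      have glt: "g r < e" if "r < e" for r using g that by (auto simp: PiE_iff L)
      have cinj: "c s = c t \<Longrightarrow> s < card I \<Longrightarrow> t < card I \<Longrightarrow> s = t" for s t
        using c by (auto simp: bij_betw_def inj_on_def)
      \<comment> \<open>Consecutive edges meet at a vertex, so
        \<open>(g r + 1) div 2 = g (Suc r) div 2\<close>, which excludes a step backwards;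
        injectivity excludes a repetition. A strictly increasing map of the first \<open>e\<close>
        numbers into themselves is the identity.\<close>
      have mono: "g r < g (Suc r)" if "Suc r < e" for r
      proof -
        have "c ((g r + 1) div 2) = c (g (Suc r) div 2)" using step(3)[of r] step(2)[of "Suc r"] that by simp
        then have "(g r + 1) div 2 = g (Suc r) div 2"
          using glt[of r] glt[of "Suc r"] that e by (intro cinj) auto
        then have "g r \<le> g (Suc r)" by linarith
        moreover have "g r \<noteq> g (Suc r)" using inj_onD[OF inj, of r "Suc r"] that by auto
        ultimately show ?thesis by simp
      qed
      have ge: "r \<le> g r" if "r < e" for r
        using that
      proof (induction r)
        case (Suc r)
        then show ?case using mono[of r] by simp
      qed simp
      have ub: "g (e - Suc r) \<le> e - Suc r" if "r < e" for r
        using that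
      proof (induction r)
        case 0 then show ?case using glt[of "e - 1"] by simp
      next
        case (Suc r)
        have "g (e - Suc (Suc r)) < g (Suc (e - Suc (Suc r)))" using Suc.prems by (intro mono) simp
        also have "Suc (e - Suc (Suc r)) = e - Suc r" using Suc.prems by simp
        finally show ?case using Suc by simp
      qed
      have gid: "g r = r" if "r < e" for r
        using ge[OF that] ub[of "e - Suc r"] that by simp
      have "g = (\<lambda>r\<in>{..<e}. r)"
        using g gid by (intro ext) (auto simp: PiE_iff extensional_def L)
      moreover have "letters u = l"
        by (rule nth_equalityI) (use L w step(1) gid in \<open>auto simp: l_def\<close>)
      then have "u = w" by (simp add: l_def word.expand)
      moreover have "i r = c (r div 2)" if "r \<le> e" for r
        using that step(2)[of r] gid[of r] ends by (cases "r = e") auto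
      then have "i = (\<lambda>r\<in>{..e}. c (r div 2))"
        using i by (intro ext) (auto simp: PiE_iff extensional_def L)
      ultimately have *: "u = w \<and> i = (\<lambda>r\<in>{..e}. c (r div 2)) \<and> g = (\<lambda>r\<in>{..<e}. r)" by simp
      then have "tm (letters u) i g = 1"
        using L by (simp add: tm_def Y_def l_def)
      then show ?thesis using * by simp
    qed
  qed
  let ?d = "\<lambda>S. of_int ((-1) ^ card S) :: 'f"
  have "0 = (\<Sum>S\<in>Pow {..<e}. ?d S * \<rho> (nc_subst of_int (a S) f) ?s ?t)"
    by (simp add: z)
  also have "\<dots> = (\<Sum>S\<in>Pow {..<e}. \<Sum>u\<in>?K. \<Sum>i\<in>?P u. \<Sum>g\<in>?G u. of_int (?l f u) * tm (letters u) i g *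
        of_int ((-1) ^ card S * of_bool (g ` {..<length (letters u)} \<subseteq> S)))"
    by (intro sum.cong refl) (simp add: expand sum_distrib_left mult_ac)
  also have "\<dots> = (\<Sum>u\<in>?K. \<Sum>S\<in>Pow {..<e}. \<Sum>i\<in>?P u. \<Sum>g\<in>?G u. of_int (?l f u) * tm (letters u) i g *
        of_int ((-1) ^ card S * of_bool (g ` {..<length (letters u)} \<subseteq> S)))"
    by (rule sum.swap)
  also have "\<dots> = (\<Sum>u\<in>?K. \<Sum>i\<in>?P u. \<Sum>S\<in>Pow {..<e}. \<Sum>g\<in>?G u. of_int (?l f u) * tm (letters u) i g *
        of_int ((-1) ^ card S * of_bool (g ` {..<length (letters u)} \<subseteq> S)))"
    by (rule sum.cong[OF refl sum.swap])
  also have "\<dots> = (\<Sum>u\<in>?K. \<Sum>i\<in>?P u. \<Sum>g\<in>?G u. \<Sum>S\<in>Pow {..<e}. of_int (?l f u) * tm (letters u) i g *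
        of_int ((-1) ^ card S * of_bool (g ` {..<length (letters u)} \<subseteq> S)))"
    by (rule sum.cong[OF refl sum.cong[OF refl sum.swap]])
  also have "\<dots> = (\<Sum>u\<in>?K. \<Sum>i\<in>?P u. \<Sum>g\<in>?G u. of_int (?l f u) * tm (letters u) i g *
        of_int (of_bool (g ` {..<length (letters u)} = {..<e}) * (-1) ^ e))"
  proof (intro sum.cong refl)
    fix u :: "nat word" and i :: "nat \<Rightarrow> 'i" and g :: "nat \<Rightarrow> nat" assume "g \<in> ?G u"
    then have "g ` {..<length (letters u)} \<subseteq> {..<e}" by (auto simp: PiE_iff)
    then show "(\<Sum>S\<in>Pow {..<e}. of_int (?l f u) * tm (letters u) i g *
        of_int ((-1) ^ card S * of_bool (g ` {..<length (letters u)} \<subseteq> S))) = of_int (?l f u) * tm (letters u) i g *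
        of_int (of_bool (g ` {..<length (letters u)} = {..<e}) * (-1) ^ e)"
      using sum_Pow_alternating[of "{..<e}" "g ` {..<length (letters u)}"]
      by (simp only: sum_distrib_left[symmetric] of_int_sum[symmetric] finite_lessThan card_lessThan)
  qed
  also have "\<dots> = (\<Sum>u\<in>?K. \<Sum>i\<in>?P u. \<Sum>g\<in>?G u.
     if u = w then if i = (\<lambda>r\<in>{..e}. c (r div 2)) then if g = (\<lambda>r\<in>{..<e}. r) then (-1) ^ e else 0 else 0 else 0)"
  proof (intro sum.cong refl)
    fix u :: "nat word" and i :: "nat \<Rightarrow> 'i" and g :: "nat \<Rightarrow> nat" assume u: "u \<in> ?K" and i: "i \<in> ?P u" and g: "g \<in> ?G u"
    have "g ` {..<length (letters u)} = {..<e}" if "u = w" "g = (\<lambda>r\<in>{..<e}. r)"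
      using that w by auto
    then show "of_int (?l f u) * tm (letters u) i g *
        of_int (of_bool (g ` {..<length (letters u)} = {..<e}) * (-1) ^ e) =
      (if u = w then if i = (\<lambda>r\<in>{..e}. c (r div 2)) then if g = (\<lambda>r\<in>{..<e}. r) then (-1) ^ e else 0 else 0 else 0)"
      using tm[OF u i g] w by (cases "g ` {..<length (letters u)} = {..<e}") auto
  qed
  also have "\<dots> = (-1) ^ e"
  proof -
    have wK: "w \<in> ?K" using w by (simp add: in_keys_iff)
    have "(\<lambda>r\<in>{..e}. c (r div 2)) \<in> ?P w" using w e by (auto intro!: ci)
    moreover have "(\<lambda>r\<in>{..<e}. r) \<in> ?G w" using w by auto
    ultimately have "(\<Sum>i\<in>?P w. \<Sum>g\<in>?G w.
       if i = (\<lambda>r\<in>{..e}. c (r div 2)) then if g = (\<lambda>r\<in>{..<e}. r) then (-1) ^ e else 0 else 0) = ((-1) ^ e :: 'f)"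
      using I by (subst sum.swap) (simp add: finite_PiE)
    moreover have "(\<Sum>i\<in>?P u. \<Sum>g\<in>?G u. if u = w then if i = (\<lambda>r\<in>{..e}. c (r div 2))
       then if g = (\<lambda>r\<in>{..<e}. r) then (-1) ^ e else 0 else 0 else 0 :: 'f) =
      (if u = w then (\<Sum>i\<in>?P w. \<Sum>g\<in>?G w. if i = (\<lambda>r\<in>{..e}. c (r div 2))
       then if g = (\<lambda>r\<in>{..<e}. r) then (-1) ^ e else 0 else 0) else 0)" for u
      by simp
    ultimately show ?thesis using wK by simp
  qed
  finally show False by (cases "even e") simp_all
qed

text \<open>Two kinds of representations of the same size are asked for. A jointly faithful family
  transfers the standard identity from matrices to the algebra; a single representation onto all
  matrices transfers the absence of smaller identities. Neither alone would give both
  bounds.\<close>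

theorem PI_min_degree_presented_algebra:
  fixes R :: "('v, 'k::ring_1) ncpoly set" and I :: "'i set"
    and \<rho>0 :: "('v, 'k) ncpoly \<Rightarrow> 'i \<Rightarrow> 'i \<Rightarrow> 'f::comm_ring_1"
    and \<rho> :: "'t \<Rightarrow> ('v, 'k) ncpoly \<Rightarrow> 'i \<Rightarrow> 'i \<Rightarrow> 'g::comm_ring_1"
  assumes R: "R \<subseteq> carrier (free_algebra X)" and I: "finite I"
    and \<rho>0: "matrix_rep I \<rho>0"
    and kill: "\<And>p x y. p \<in> Idl\<^bsub>free_algebra X\<^esub> R \<Longrightarrow> x \<in> I \<Longrightarrow> y \<in> I \<Longrightarrow> \<rho>0 p x y = 0"
    and onto: "\<And>Y. \<exists>p\<in>carrier (free_algebra X). \<forall>x\<in>I. \<forall>y\<in>I. \<rho>0 p x y = Y x y"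
    and \<rho>: "\<And>t. matrix_rep I (\<rho> t)"
    and faithful: "\<And>p. p \<in> carrier (free_algebra X) \<Longrightarrow> (\<And>t x y. x \<in> I \<Longrightarrow> y \<in> I \<Longrightarrow> \<rho> t p x y = 0)
      \<Longrightarrow> p \<in> Idl\<^bsub>free_algebra X\<^esub> R"
  shows "PI_min_degree (presented_algebra X R) = 2 * card I"
  unfolding PI_min_degree_def
proof (rule Least_equality)
  show "\<exists>f. nc_monic (2 * card I) f \<and> polynomial_identity (presented_algebra X R) f"
  proof (intro exI conjI)
    show "nc_monic (2 * card I) (std_poly (2 * card I))" by (rule nc_monic_std_poly)
    show "polynomial_identity (presented_algebra X R) (std_poly (2 * card I))"
      unfolding polynomial_identity_presented_algebra[OF R]
      using faithful nc_subst_carrier matrix_rep_std_poly[OF \<rho> I] by blast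
  qed
next
  fix e assume "\<exists>f. nc_monic e f \<and> polynomial_identity (presented_algebra X R) f"
  then obtain f where f: "nc_monic e f" "polynomial_identity (presented_algebra X R) f" by blast
  show "2 * card I \<le> e"
  proof (rule ccontr)
    assume "\<not> 2 * card I \<le> e"
    then obtain a x y where a: "\<forall>i. a i \<in> carrier (free_algebra X)" "x \<in> I" "y \<in> I"
      "\<rho>0 (nc_subst of_int a f) x y \<noteq> 0"
      using no_small_identity[OF \<rho>0 I onto f(1)] by auto
    moreover have "nc_subst of_int a f \<in> Idl\<^bsub>free_algebra X\<^esub> R"
      using f(2) a(1) unfolding polynomial_identity_presented_algebra[OF R] by blast
    ultimately show False using kill by blast
  qed
qed

section \<open>Linear operators and the quantum torus\<close>

text \<open>As a type of its own, linear operators become an instance of \<open>ring_1\<close>, so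
  that \<open>nc_subst\<close> applies and relations are checked by ordinary ring calculations. The
  functions live on the whole index type, and finite matrices are cut out only afterwards.\<close>

typedef (overloaded) ('i, 'k::field) lop =
  "{T :: ('i \<Rightarrow> 'k) \<Rightarrow> 'i \<Rightarrow> 'k. (\<forall>f g. T (\<lambda>x. f x + g x) = (\<lambda>x. T f x + T g x)) \<and>
     (\<forall>c f. T (\<lambda>x. c * f x) = (\<lambda>x. c * T f x))}"
  morphisms app Lop
  by (rule exI[of _ id]) auto

setup_lifting type_definition_lop

lemma app_add: "app T (\<lambda>x. f x + g x) = (\<lambda>x. app T f x + app T g x)"
  and app_scale: "app T (\<lambda>x. c * f x) = (\<lambda>x. c * app T f x)"
  using app[of T] by auto

lemma app_zero: "app T (\<lambda>x. 0) = (\<lambda>x. 0)"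
  using app_scale[of T 0 "\<lambda>_. 0"] by simp

lemma app_sum: "app T (\<lambda>x. \<Sum>j\<in>J. f j x) = (\<lambda>x. \<Sum>j\<in>J. app T (f j) x)"
  by (induction J rule: infinite_finite_induct) (simp_all add: app_zero app_add)

instantiation lop :: (type, field) ring_1
begin

lift_definition zero_lop :: "('a, 'b) lop" is "\<lambda>f x. 0" by simp
lift_definition one_lop :: "('a, 'b) lop" is "\<lambda>f. f" by simp
lift_definition plus_lop :: "('a, 'b) lop \<Rightarrow> ('a, 'b) lop \<Rightarrow> ('a, 'b) lop"
  is "\<lambda>S T f x. S f x + T f x" by (simp add: algebra_simps)
lift_definition uminus_lop :: "('a, 'b) lop \<Rightarrow> ('a, 'b) lop"
  is "\<lambda>S f x. - S f x" by simp
lift_definition minus_lop :: "('a, 'b) lop \<Rightarrow> ('a, 'b) lop \<Rightarrow> ('a, 'b) lop"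
  is "\<lambda>S T f x. S f x - T f x" by (simp add: algebra_simps)
lift_definition times_lop :: "('a, 'b) lop \<Rightarrow> ('a, 'b) lop \<Rightarrow> ('a, 'b) lop"
  is "\<lambda>S T f. S (T f)" by simp

instance
proof
  show "(0::('a, 'b) lop) \<noteq> 1"
  proof
    assume "(0::('a, 'b) lop) = 1"
    then have "app (0::('a, 'b) lop) (\<lambda>_. 1) undefined = app 1 (\<lambda>_. 1) undefined" by simp
    then show False by (simp add: zero_lop.rep_eq one_lop.rep_eq)
  qed
qed (transfer, simp add: fun_eq_iff algebra_simps)+

end

lemmas app_simps = zero_lop.rep_eq one_lop.rep_eq plus_lop.rep_eq uminus_lop.rep_eq
  minus_lop.rep_eq times_lop.rep_eq

lemma lop_eqI: "(\<And>f x. app S f x = app T f x) \<Longrightarrow> S = T"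
  by (metis app_inject ext)

lift_definition wop :: "('i \<Rightarrow> 'k::field) \<Rightarrow> ('i \<Rightarrow> 'i) \<Rightarrow> ('i, 'k) lop"
  is "\<lambda>h \<sigma> f x. h x * f (\<sigma> x)" by (simp add: algebra_simps)

definition scal :: "'k::field \<Rightarrow> ('i, 'k) lop"
  where "scal c = wop (\<lambda>_. c) (\<lambda>x. x)"

lemma app_wop: "app (wop h \<sigma>) f x = h x * f (\<sigma> x)"
  by (simp add: wop.rep_eq)

lemma app_scal: "app (scal c) f x = c * f x"
  by (simp add: scal_def app_wop)

lemma wop_mult: "wop h \<sigma> * wop h' \<sigma>' = wop (\<lambda>x. h x * h' (\<sigma> x)) (\<lambda>x. \<sigma>' (\<sigma> x))"
  by (rule lop_eqI) (simp add: app_simps app_wop mult.assoc)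

lemma central_hom_scal: "central_hom (scal :: 'k::field \<Rightarrow> ('i, 'k) lop)"
  unfolding central_hom_def
proof (intro conjI allI)
  fix c d :: 'k and T :: "('i, 'k) lop"
  show "scal 1 = (1 :: ('i, 'k) lop)" "scal (c + d) = (scal c + scal d :: ('i, 'k) lop)"
    "scal (c * d) = (scal c * scal d :: ('i, 'k) lop)"
    by (rule lop_eqI, simp add: app_simps app_scal algebra_simps)+
  show "scal c * T = T * scal c"
  proof (rule lop_eqI)
    fix f :: "'i \<Rightarrow> 'k" and x
    have "app (scal c) f = (\<lambda>x. c * f x)" by (simp add: fun_eq_iff app_scal)
    then show "app (scal c * T) f x = app (T * scal c) f x"
      by (simp add: app_simps app_scal app_scale)
  qed
qed

lemmas scal_hom = central_homD[OF central_hom_scal]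
lemmas scal_simps = scal_hom(1-3,5,6)

section \<open>Periodic functions and their finite matrices\<close>

definition periodic :: "('i \<Rightarrow> 'i) \<Rightarrow> ('i \<Rightarrow> 'k) \<Rightarrow> bool"
  where "periodic r f \<longleftrightarrow> (\<forall>x. f (r x) = f x)"

definition preserves :: "('i \<Rightarrow> 'i) \<Rightarrow> ('i, 'k::field) lop \<Rightarrow> bool"
  where "preserves r T \<longleftrightarrow> (\<forall>f. periodic r f \<longrightarrow> periodic r (app T f))"

lemma preserves_intros:
  "preserves r 0" "preserves r 1" "preserves r (scal c)"
  "preserves r S \<Longrightarrow> preserves r T \<Longrightarrow> preserves r (S + T)"
  "preserves r S \<Longrightarrow> preserves r T \<Longrightarrow> preserves r (S * T)"
  by (auto simp: preserves_def periodic_def app_simps app_scal)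

lemma preserves_sum: "(\<And>j. j \<in> J \<Longrightarrow> preserves r (f j)) \<Longrightarrow> preserves r (sum f J)"
  by (induction J rule: infinite_finite_induct) (auto intro: preserves_intros)

lemma preserves_prod_list: "(\<And>j. j \<in> set l \<Longrightarrow> preserves r (f j)) \<Longrightarrow> preserves r (prod_list (map f l))"
  by (induction l) (auto intro: preserves_intros)

lemma preserves_nc_subst:
  "(\<And>v. preserves r (u v)) \<Longrightarrow> preserves r (nc_subst scal u p)"
  unfolding nc_subst_def by (intro preserves_sum preserves_intros preserves_prod_list)

text \<open>For an idempotent \<open>r\<close> with finite range, the indicators of its fibres are a
  basis of the periodic functions. These are the matrix entries with respect to that basis.\<close>

definition block :: "('i \<Rightarrow> 'i) \<Rightarrow> ('i, 'k::field) lop \<Rightarrow> 'i \<Rightarrow> 'i \<Rightarrow> 'k"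
  where "block r T x y = app T (\<lambda>z. of_bool (r z = y)) x"

lemma matrix_rep_block:
  fixes u :: "'v \<Rightarrow> ('i, 'k::field) lop"
  assumes r: "\<And>x. r (r x) = r x" and fin: "finite (range r)" and u: "\<And>v. preserves r (u v)"
  shows "matrix_rep (range r) (\<lambda>p. block r (nc_subst scal u p))"
  unfolding matrix_rep_def
proof (intro ballI conjI allI)
  fix x y and p p' :: "('v, 'k) ncpoly"
  assume x: "x \<in> range r" and y: "y \<in> range r"
  let ?S = "nc_subst scal u p" and ?T = "nc_subst scal u p'"
  show "block r (nc_subst scal u 1) x y = of_bool (x = y)"
    using x by (auto simp: block_def nc_subst_1[OF central_hom_scal] app_simps r)
  show "block r (nc_subst scal u (p + p')) x y = block r ?S x y + block r ?T x y"
    by (simp add: block_def nc_subst_add[OF central_hom_scal] app_simps)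
  let ?d = "\<lambda>y z. of_bool (r z = y) :: 'k"
  have "periodic r (app ?T (?d y))"
    using preserves_nc_subst[of r u p'] u by (simp add: preserves_def periodic_def r)
  then have per: "app ?T (?d y) (r z) = app ?T (?d y) z" for z by (simp add: periodic_def)
  \<comment> \<open>The image of a fibre indicator is again periodic, so it expands in the fibre
    indicators with its values on \<open>range r\<close> as coefficients; linearity then gives the
    matrix product.\<close>
  have "app ?T (?d y) = (\<lambda>z. \<Sum>s\<in>range r. app ?T (?d y) s * ?d s z)"
  proof
    fix z
    have "(\<Sum>s\<in>range r. app ?T (?d y) s * ?d s z) = (\<Sum>s\<in>range r. if s = r z then app ?T (?d y) s else 0)"
      by (intro sum.cong) auto
    then show "app ?T (?d y) z = (\<Sum>s\<in>range r. app ?T (?d y) s * ?d s z)"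
      using fin by (simp add: per)
  qed
  then have "app ?S (app ?T (?d y)) x = app ?S (\<lambda>z. \<Sum>s\<in>range r. app ?T (?d y) s * ?d s z) x"
    by (rule arg_cong)
  also have "\<dots> = (\<Sum>s\<in>range r. app ?T (?d y) s * app ?S (?d s) x)"
    by (simp add: app_sum app_scale)
  finally have "app ?S (app ?T (?d y)) x = (\<Sum>s\<in>range r. app ?T (?d y) s * app ?S (?d s) x)" .
  then show "block r (nc_subst scal u (p * p')) x y = (\<Sum>z\<in>range r. block r ?S x z * block r ?T z y)"
    by (simp add: block_def nc_subst_mult[OF central_hom_scal] app_simps mult.commute)
qed

text \<open>Agreement is required only on periodic functions. This admits operators such as inverse
  torus operators, which there agree with polynomials in the generators.\<close>

definition image_ops :: "('i \<Rightarrow> 'i) \<Rightarrow> 'v set \<Rightarrow> ('v \<Rightarrow> ('i, 'k::field) lop) \<Rightarrow> ('i, 'k) lop set"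
  where "image_ops r X u = {T. \<exists>p\<in>carrier (free_algebra X). \<forall>f. periodic r f \<longrightarrow>
    app (nc_subst scal u p) f = app T f}"

lemma image_opsI:
  "p \<in> carrier (free_algebra X) \<Longrightarrow> (\<And>f. periodic r f \<Longrightarrow> app (nc_subst scal u p) f = app T f) \<Longrightarrow>
    T \<in> image_ops r X u"
  unfolding image_ops_def by blast

context
  fixes r :: "'i \<Rightarrow> 'i" and X :: "'v set" and u :: "'v \<Rightarrow> ('i, 'k::field) lop"
  assumes u: "\<And>v. preserves r (u v)"
begin

lemma image_ops_var: "v \<in> X \<Longrightarrow> u v \<in> image_ops r X u"
  by (rule image_opsI[OF free_algebra_carrierI(1)]) (simp_all add: nc_subst_ncvar[OF central_hom_scal])

lemma image_ops_scal: "scal c \<in> image_ops r X u"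
  by (rule image_opsI[OF free_algebra_carrierI(2)]) (simp add: nc_subst_ncconst[OF central_hom_scal])

lemma image_ops_add:
  assumes "S \<in> image_ops r X u" "T \<in> image_ops r X u"
  shows "S + T \<in> image_ops r X u"
proof -
  obtain p p' where p: "p \<in> carrier (free_algebra X)" "p' \<in> carrier (free_algebra X)"
    "\<forall>f. periodic r f \<longrightarrow> app (nc_subst scal u p) f = app S f"
    "\<forall>f. periodic r f \<longrightarrow> app (nc_subst scal u p') f = app T f"
    using assms unfolding image_ops_def by blast
  show ?thesis
    by (rule image_opsI[OF free_algebra_carrierI(4)[OF p(1,2)]])
       (simp add: p(3,4) nc_subst_add[OF central_hom_scal] app_simps)
qed

lemma image_ops_mult:
  assumes "S \<in> image_ops r X u" "T \<in> image_ops r X u"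
  shows "S * T \<in> image_ops r X u"
proof -
  obtain p p' where p: "p \<in> carrier (free_algebra X)" "p' \<in> carrier (free_algebra X)"
    "\<forall>f. periodic r f \<longrightarrow> app (nc_subst scal u p) f = app S f"
    "\<forall>f. periodic r f \<longrightarrow> app (nc_subst scal u p') f = app T f"
    using assms unfolding image_ops_def by blast
  show ?thesis
  proof (rule image_opsI[OF free_algebra_carrierI(3)[OF p(1,2)]])
    fix f :: "'i \<Rightarrow> 'k" assume f: "periodic r f"
    then have "periodic r (app T f)"
      using p(4) preserves_nc_subst[of r u p', OF u] by (auto simp: preserves_def)
    then show "app (nc_subst scal u (p * p')) f = app (S * T) f"
      using p(3,4) f by (simp add: nc_subst_mult[OF central_hom_scal] app_simps)
  qed
qed

lemma image_ops_cong:
  assumes "S \<in> image_ops r X u" "\<And>f. periodic r f \<Longrightarrow> app S f = app T f"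
  shows "T \<in> image_ops r X u"
  using assms unfolding image_ops_def by auto

lemma image_ops_sum: "(\<And>j. j \<in> J \<Longrightarrow> f j \<in> image_ops r X u) \<Longrightarrow> sum f J \<in> image_ops r X u"
proof (induction J rule: infinite_finite_induct)
  case empty
  show ?case using image_ops_scal[of 0] by (simp add: scal_simps)
next
  case (infinite J)
  show ?case using image_ops_scal[of 0] infinite by (simp add: scal_simps)
qed (simp add: image_ops_add)

lemma image_ops_minus:
  assumes "S \<in> image_ops r X u" "T \<in> image_ops r X u"
  shows "S - T \<in> image_ops r X u"
  using image_ops_add[OF assms(1) image_ops_mult[OF image_ops_scal[of "-1"] assms(2)]]
  by (simp add: scal_simps)

end

lemma power_int_cong:
  fixes q :: "'k::field"
  assumes "q ^ m = 1" "a mod int m = b mod int m" "q \<noteq> 0"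
  shows "q powi a = q powi b"
proof -
  obtain k where "a = b + int m * k"
    using assms(2) by (metis mod_eqE)
  then show ?thesis using assms(1,3) by (simp add: power_int_add power_int_mult)
qed

lemma primitive_root_power_int_inj:
  fixes q :: "'k::field"
  assumes q: "primitive_root_of_unity m q" and ab: "a \<in> {0..<int m}" "b \<in> {0..<int m}" "q powi a = q powi b"
  shows "a = b"
proof -
  have q0: "q \<noteq> 0" using q by (auto simp: primitive_root_of_unity_def power_0_left split: if_splits)
  have *: False if "0 \<le> s" "s < t" "t < int m" "q powi s = q powi t" for s t
  proof -
    have "q powi (t - s) = 1" using that q0 by (simp add: power_int_diff)
    then have "q ^ nat (t - s) = 1" using that by (simp add: power_int_def)
    moreover have "0 < nat (t - s)" "nat (t - s) < m" using that by auto
    ultimately show False using q by (auto simp: primitive_root_of_unity_def)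
  qed
  show ?thesis
  proof (rule linorder_cases)
    assume "a < b" then show ?thesis using *[of a b] ab by auto
  next
    assume "b < a" then show ?thesis using *[of b a] ab by auto
  qed
qed

section \<open>Clock and shift operators indexed by a symplectic lattice\<close>

type_synonym 'w lat = "('w \<Rightarrow> int) \<times> ('w \<Rightarrow> int)"

definition dot :: "'w set \<Rightarrow> ('w \<Rightarrow> int) \<Rightarrow> ('w \<Rightarrow> int) \<Rightarrow> int"
  where "dot W \<alpha> x = (\<Sum>w\<in>W. \<alpha> w * x w)"

definition symplectic :: "'w set \<Rightarrow> 'w lat \<Rightarrow> 'w lat \<Rightarrow> int"
  where "symplectic W v v' = dot W (fst v) (snd v') - dot W (snd v) (fst v')"

text \<open>A Weyl operator: the first component of \<open>v\<close> gives the powers of the clocks,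
  the second the translation. Two of them commute up to \<open>q\<close> raised to the symplectic
  form.\<close>

definition torus :: "'k::field \<Rightarrow> 'w set \<Rightarrow> 'w lat \<Rightarrow> ('w \<Rightarrow> int, 'k) lop"
  where "torus q W v = wop (\<lambda>x. q powi dot W (fst v) x) (\<lambda>x. x - snd v)"

text \<open>Coordinates outside \<open>W\<close> are sent to 0, so the range is finite although the
  functions are defined on all cells; a periodic function ignores those coordinates.\<close>

definition red :: "nat \<Rightarrow> 'w set \<Rightarrow> ('w \<Rightarrow> int) \<Rightarrow> 'w \<Rightarrow> int"
  where "red m W x = (\<lambda>w. if w \<in> W then x w mod int m else 0)"

lemma dot_simps:
  "dot W (\<alpha> + \<beta>) x = dot W \<alpha> x + dot W \<beta> x" "dot W \<alpha> (x + y) = dot W \<alpha> x + dot W \<alpha> y"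
  "dot W (\<alpha> - \<beta>) x = dot W \<alpha> x - dot W \<beta> x" "dot W \<alpha> (x - y) = dot W \<alpha> x - dot W \<alpha> y"
  "dot W 0 x = 0" "dot W \<alpha> 0 = 0" "dot W (- \<alpha>) x = - dot W \<alpha> x" "dot W \<alpha> (- x) = - dot W \<alpha> x"
  "dot W (sum f J) x = (\<Sum>j\<in>J. dot W (f j) x)" "dot W \<alpha> (sum g J) = (\<Sum>j\<in>J. dot W \<alpha> (g j))"
proof -
  show 1: "dot W (\<alpha> + \<beta>) x = dot W \<alpha> x + dot W \<beta> x" "dot W \<alpha> (x + y) = dot W \<alpha> x + dot W \<alpha> y"
    "dot W (\<alpha> - \<beta>) x = dot W \<alpha> x - dot W \<beta> x" "dot W \<alpha> (x - y) = dot W \<alpha> x - dot W \<alpha> y"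
    "dot W 0 x = 0" "dot W \<alpha> 0 = 0" "dot W (- \<alpha>) x = - dot W \<alpha> x" "dot W \<alpha> (- x) = - dot W \<alpha> x"
    for \<alpha> \<beta> x y
    by (simp_all add: dot_def algebra_simps sum.distrib sum_subtractf sum_negf)
  show "dot W (sum f J) x = (\<Sum>j\<in>J. dot W (f j) x)" "dot W \<alpha> (sum g J) = (\<Sum>j\<in>J. dot W \<alpha> (g j))"
    by (induction J rule: infinite_finite_induct) (simp_all add: 1)
qed

lemma dot_commute: "dot W \<alpha> x = dot W x \<alpha>"
  by (simp add: dot_def mult.commute)

context
  fixes q :: "'k::field" and W :: "'w set"
  assumes q0: "q \<noteq> 0"
begin

lemma torus_mult: "torus q W v * torus q W v' = scal (q powi (- dot W (fst v') (snd v))) * torus q W (v + v')"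
proof -
  have "(\<lambda>x. q powi dot W (fst v) x * q powi dot W (fst v') (x - snd v)) =
      (\<lambda>x. q powi (- dot W (fst v') (snd v)) * q powi dot W (fst (v + v')) x)"
    using q0 by (simp add: dot_simps fun_eq_iff algebra_simps flip: power_int_add)
  then show ?thesis
    by (simp add: torus_def scal_def wop_mult algebra_simps)
qed

lemma torus_commute:
  "torus q W v * torus q W v' = scal (q powi symplectic W v v') * (torus q W v' * torus q W v)"
proof -
  have "scal (q powi symplectic W v v') * (torus q W v' * torus q W v) =
    scal (q powi symplectic W v v' * q powi (- dot W (fst v) (snd v'))) * torus q W (v' + v)"
    by (simp add: torus_mult scal_simps mult.assoc)
  also have "q powi symplectic W v v' * q powi (- dot W (fst v) (snd v')) = q powi (- dot W (fst v') (snd v))"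
    using q0 by (simp add: symplectic_def dot_commute[of W "snd v" "fst v'"] flip: power_int_add)
  finally show ?thesis by (simp add: torus_mult add.commute)
qed

lemma torus_0: "torus q W 0 = 1"
  by (rule lop_eqI) (simp add: torus_def app_wop app_simps dot_simps)

end

context
  fixes q :: "'k::field" and W :: "'w set" and m :: nat
  assumes q: "primitive_root_of_unity m q" and W: "finite W"
begin

lemma red_red: "red m W (red m W x) = red m W x"
  by (simp add: red_def fun_eq_iff)

lemma q_nonzero: "q \<noteq> 0" and m_pos: "m > 0" and q_power_m: "q ^ m = 1"
  using q by (auto simp: primitive_root_of_unity_def power_0_left split: if_splits)

lemma range_red: "range (red m W) = {x. (\<forall>w\<in>W. x w \<in> {0..<int m}) \<and> (\<forall>w. w \<notin> W \<longrightarrow> x w = 0)}"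
proof (intro equalityI subsetI)
  fix x assume "x \<in> {x. (\<forall>w\<in>W. x w \<in> {0..<int m}) \<and> (\<forall>w. w \<notin> W \<longrightarrow> x w = 0)}"
  then have "x = red m W x" by (auto simp: red_def fun_eq_iff)
  then show "x \<in> range (red m W)" by blast
qed (use m_pos in \<open>auto simp: red_def\<close>)

lemma bij_range_red: "bij_betw (\<lambda>x. restrict x W) (range (red m W)) (W \<rightarrow>\<^sub>E {0..<int m})"
  unfolding range_red
  by (rule bij_betwI[where g = "\<lambda>x w. if w \<in> W then x w else 0"])
     (auto simp: fun_eq_iff PiE_iff extensional_def)

lemma finite_range_red: "finite (range (red m W))"
  using bij_betw_finite[OF bij_range_red] W by (simp add: finite_PiE)

lemma card_range_red: "card (range (red m W)) = m ^ card W"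
  using bij_betw_same_card[OF bij_range_red] W by (simp add: card_PiE)

lemma red_diff: "red m W (red m W x - y) = red m W (x - y)"
  by (simp add: red_def fun_eq_iff mod_diff_left_eq)

lemma power_int_dot_red: "q powi dot W \<alpha> (red m W x) = q powi dot W \<alpha> x"
proof (rule power_int_cong[OF q_power_m _ q_nonzero])
  have "dot W \<alpha> (red m W x) mod int m = (\<Sum>w\<in>W. (\<alpha> w * x w) mod int m) mod int m"
    unfolding dot_def by (subst mod_sum_eq[symmetric]) (simp add: red_def mod_mult_right_eq)
  then show "dot W \<alpha> (red m W x) mod int m = dot W \<alpha> x mod int m"
    by (simp add: dot_def mod_sum_eq)
qed

lemma preserves_torus: "preserves (red m W) (torus q W v)"
  unfolding preserves_def periodic_def
proof (intro allI impI)
  fix f :: "('w \<Rightarrow> int) \<Rightarrow> 'k" and x assume f: "\<forall>x. f (red m W x) = f x"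
  have "f (red m W x - snd v) = f (x - snd v)" by (metis f red_diff)
  then show "app (torus q W v) f (red m W x) = app (torus q W v) f x"
    by (simp add: torus_def app_wop power_int_dot_red)
qed

text \<open>Up to a scalar, powers multiply the exponents. The exponents \<open>m - 1\<close> and
  \<open>-1\<close> agree modulo \<open>m\<close>, where the clocks see them because
  \<open>q\<close> has order \<open>m\<close> and the shifts see them because the functions are
  periodic.\<close>

lemma torus_power_periodic:
  "\<exists>c. c \<noteq> 0 \<and> (\<forall>f. periodic (red m W) f \<longrightarrow> app (torus q W v ^ (m - 1)) f = app (scal c * torus q W (- v)) f)"
proof -
  note q0 = q_nonzero
  have pow: "\<exists>c. c \<noteq> 0 \<and> torus q W v ^ k = scal c * torus q W (\<lambda>w. fst v w * int k, \<lambda>w. snd v w * int k)" for k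
  proof (induction k)
    case 0
    have "(\<lambda>w. fst v w * int 0, \<lambda>w. snd v w * int 0) = 0"
      by (simp add: zero_prod_def zero_fun_def)
    then have "torus q W (\<lambda>w. fst v w * int 0, \<lambda>w. snd v w * int 0) = 1"
      by (simp only: torus_0[OF q0])
    then show ?case by (intro exI[of _ 1]) (simp add: scal_simps)
  next
    case (Suc k)
    then obtain c where c: "c \<noteq> 0" "torus q W v ^ k = scal c * torus q W (\<lambda>w. fst v w * int k, \<lambda>w. snd v w * int k)"
      by blast
    have e: "v + (\<lambda>w. fst v w * int k, \<lambda>w. snd v w * int k) = (\<lambda>w. fst v w * int (Suc k), \<lambda>w. snd v w * int (Suc k))"
      by (rule prod_eqI) (simp_all add: plus_fun_def algebra_simps)
    have "torus q W v ^ Suc k = scal c * (torus q W v * torus q W (\<lambda>w. fst v w * int k, \<lambda>w. snd v w * int k))"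
      by (simp add: c(2) flip: mult.assoc) (simp add: scal_hom(4))
    then show ?case
      using c(1) q0 unfolding torus_mult[OF q0] e
      by (intro exI[of _ "c * q powi (- dot W (fst (\<lambda>w. fst v w * int k, \<lambda>w. snd v w * int k)) (snd v))"])
         (simp add: scal_simps mult.assoc)
  qed
  obtain c where c: "c \<noteq> 0" "torus q W v ^ (m - 1) =
      scal c * torus q W (\<lambda>w. fst v w * int (m - 1), \<lambda>w. snd v w * int (m - 1))" using pow by blast
  have m1: "int (m - 1) = int m - 1" using m_pos by simp
  have "app (torus q W (\<lambda>w. fst v w * int (m - 1), \<lambda>w. snd v w * int (m - 1))) f x = app (torus q W (- v)) f x"
    if f: "periodic (red m W) f" for f x
  proof -
    have "dot W ((\<lambda>w. fst v w * int (m - 1))) x = int m * dot W (fst v) x + dot W (- fst v) x"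
      unfolding dot_def sum_distrib_left sum.distrib[symmetric]
      by (rule sum.cong[OF refl]) (simp only: m1 uminus_apply, simp add: algebra_simps)
    then have "q powi dot W ((\<lambda>w. fst v w * int (m - 1))) x = q powi dot W (- fst v) x"
      by (intro power_int_cong[OF q_power_m _ q0]) simp
    moreover have "red m W (x - (\<lambda>w. snd v w * int (m - 1))) = red m W (x - (- snd v))"
    proof
      fix w
      have "x w - snd v w * int (m - 1) = x w - - snd v w + int m * (- snd v w)"
        by (simp only: m1) (simp add: algebra_simps)
      then show "red m W (x - (\<lambda>w. snd v w * int (m - 1))) w = red m W (x - (- snd v)) w"
        unfolding red_def by (simp only: minus_apply uminus_apply mod_mult_self2)
    qed
    then have "f (x - (\<lambda>w. snd v w * int (m - 1))) = f (x - (- snd v))"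
      using f unfolding periodic_def by metis
    ultimately show ?thesis by (simp add: torus_def app_wop)
  qed
  then show ?thesis using c by (intro exI[of _ c]) (simp add: app_simps fun_eq_iff app_scal)
qed

text \<open>The clock operators generate the projections onto the points of the index set, by Lagrange
  interpolation in each coordinate.\<close>

lemma image_ops_onto:
  fixes u :: "'v \<Rightarrow> ('w \<Rightarrow> int, 'k) lop"
  assumes u: "\<And>v. preserves (red m W) (u v)"
    and clock: "\<And>w. w \<in> W \<Longrightarrow> torus q W (\<lambda>x. of_bool (x = w), 0) \<in> image_ops (red m W) X u"
    and shift: "\<And>\<kappa>. (\<And>w. w \<notin> W \<Longrightarrow> \<kappa> w = 0) \<Longrightarrow> torus q W (0, \<kappa>) \<in> image_ops (red m W) X u"
  shows "\<exists>p\<in>carrier (free_algebra X). \<forall>x\<in>range (red m W). \<forall>y\<in>range (red m W).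
    block (red m W) (nc_subst scal u p) x y = Y x y"
proof -
  let ?r = "red m W" and ?M = "image_ops (red m W) X u" and ?I = "range (red m W)"
  note closed = image_ops_scal[OF u] image_ops_mult[OF u] image_ops_minus[OF u] image_ops_sum[OF u]
  let ?mul = "\<lambda>h. wop h (\<lambda>x. x)"
  have mul: "?mul (\<lambda>x. h x * h' x) \<in> ?M" if "?mul h \<in> ?M" "?mul h' \<in> ?M" for h h'
    using closed(2)[OF that] by (simp add: wop_mult)
  have mprod: "?mul (\<lambda>x. \<Prod>j\<in>J. h j x) \<in> ?M" if "finite J" "\<And>j. j \<in> J \<Longrightarrow> ?mul (h j) \<in> ?M"
    for J :: "'j set" and h
    using that
  proof (induction J)
    case empty
    show ?case using closed(1)[of 1] by (simp add: scal_def)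
  qed (simp add: mul)
  have fac: "?mul (\<lambda>x. (q powi (x w) - c) * d) \<in> ?M" if "w \<in> W" for w c d
  proof -
    have "dot W (\<lambda>x. of_bool (x = w)) x = x w" for x
      using W that by (simp add: dot_def of_bool_def if_distrib[of "\<lambda>t. t * _"] cong: if_cong)
    then have "torus q W (\<lambda>x. of_bool (x = w), 0) = ?mul (\<lambda>x. q powi (x w))"
      by (simp add: torus_def)
    then have "?mul (\<lambda>x. q powi (x w)) \<in> ?M" using clock[OF that] by (simp only:)
    then have "scal d * (?mul (\<lambda>x. q powi (x w)) - scal c) \<in> ?M"
      by (rule closed(2)[OF closed(1) closed(3)[OF _ closed(1)]])
    also have "scal d * (?mul (\<lambda>x. q powi (x w)) - scal c) = ?mul (\<lambda>x. (q powi (x w) - c) * d)"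
      by (rule lop_eqI) (simp add: app_simps app_scal app_wop algebra_simps)
    finally show ?thesis .
  qed
  \<comment> \<open>The Lagrange polynomial in the values \<open>q powi (x w)\<close>. The
    denominators are nonzero because a primitive root has distinct powers on the residues
    \<open>0..<int m\<close>.\<close>
  define P where "P y x = (\<Prod>w\<in>W. \<Prod>c\<in>{0..<int m} - {y w}. (q powi (x w) - q powi c) * (1 / (q powi (y w) - q powi c)))"
    for y x :: "'w \<Rightarrow> int"
  have PM: "?mul (P y) \<in> ?M" for y
    unfolding P_def by (intro mprod W fac) auto
  have P: "P y x = of_bool (?r x = y)" if y: "y \<in> ?I" for y x
  proof -
    have yw: "y w \<in> {0..<int m}" if "w \<in> W" for w using y that unfolding range_red by blast
    have qx: "q powi (x w) = q powi (x w mod int m)" for w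
      by (rule power_int_cong[OF q_power_m _ q_nonzero]) simp
    have xm: "x w mod int m \<in> {0..<int m}" for w using m_pos by simp
    have "P y x = (\<Prod>w\<in>W. of_bool (x w mod int m = y w))"
      unfolding P_def
    proof (rule prod.cong[OF refl])
      fix w assume w: "w \<in> W"
      show "(\<Prod>c\<in>{0..<int m} - {y w}. (q powi (x w) - q powi c) * (1 / (q powi (y w) - q powi c))) =
        of_bool (x w mod int m = y w)"
      proof (cases "x w mod int m = y w")
        case True
        have "(q powi (x w) - q powi c) * (1 / (q powi (y w) - q powi c)) = 1" if "c \<in> {0..<int m} - {y w}" for c
        proof -
          have "q powi (y w) \<noteq> q powi c"
            using primitive_root_power_int_inj[OF q yw[OF w], of c] that by auto
          then show ?thesis using qx[of w] True by simp
        qed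
        then show ?thesis using True by simp
      next
        case False
        then have "x w mod int m \<in> {0..<int m} - {y w}" using xm by auto
        moreover have "(q powi (x w) - q powi (x w mod int m)) * (1 / (q powi (y w) - q powi (x w mod int m))) = 0"
          using qx[of w] by simp
        ultimately have "(\<Prod>c\<in>{0..<int m} - {y w}. (q powi (x w) - q powi c) * (1 / (q powi (y w) - q powi c))) = 0"
          by (intro prod_zero) auto
        then show ?thesis using False by simp
      qed
    qed
    also have "\<dots> = of_bool (\<forall>w\<in>W. x w mod int m = y w)"
      using W by (induction W) auto
    also have "(\<forall>w\<in>W. x w mod int m = y w) \<longleftrightarrow> ?r x = y"
      using y unfolding range_red by (auto simp: red_def fun_eq_iff)
    finally show ?thesis .
  qed
  \<comment> \<open>The projection onto \<open>x\<close> followed by translation through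
    \<open>x - y\<close> is the matrix unit at \<open>x\<close>, \<open>y\<close>: the value at
    \<open>x\<close> is read off at \<open>x - (x - y) = y\<close>.\<close>
  define T where "T = (\<Sum>x\<in>?I. \<Sum>y\<in>?I. scal (Y x y) * (?mul (P x) * torus q W (0, x - y)))"
  have "T \<in> ?M"
    unfolding T_def
  proof (intro closed(4) closed(2)[OF closed(1)] closed(2)[OF PM] shift)
    fix x y w assume "x \<in> ?I" "y \<in> ?I" "w \<notin> W"
    then show "(x - y) w = 0" unfolding range_red by simp
  qed
  then obtain p where p: "p \<in> carrier (free_algebra X)"
    "\<And>f. periodic ?r f \<Longrightarrow> app (nc_subst scal u p) f = app T f" unfolding image_ops_def by blast
  have "block ?r (nc_subst scal u p) x' y' = Y x' y'" if xy: "x' \<in> ?I" "y' \<in> ?I" for x' y'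
  proof -
    have rx: "?r x = x" if "x \<in> ?I" for x using that red_red by auto
    have as: "app (sum g J) f x = (\<Sum>j\<in>J. app (g j) f x)"
      for g :: "('w \<Rightarrow> int) \<Rightarrow> ('w \<Rightarrow> int, 'k) lop" and J f x
      by (induction J rule: infinite_finite_induct) (simp_all add: app_simps)
    have "block ?r (nc_subst scal u p) x' y' = app T (\<lambda>z. of_bool (?r z = y')) x'"
      unfolding block_def by (subst p(2)) (simp_all add: periodic_def red_red)
    also have "\<dots> = (\<Sum>x\<in>?I. \<Sum>y\<in>?I. Y x y * (P x x' * of_bool (?r (x' - (x - y)) = y')))"
      by (simp add: T_def as app_simps app_scal app_wop torus_def dot_simps)
    also have "\<dots> = (\<Sum>x\<in>?I. \<Sum>y\<in>?I. if x = x' then if y = y' then Y x y else 0 else 0)"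
    proof (intro sum.cong refl)
      fix x y assume "x \<in> ?I" "y \<in> ?I"
      then show "Y x y * (P x x' * of_bool (?r (x' - (x - y)) = y')) = (if x = x' then if y = y' then Y x y else 0 else 0)"
        using rx[of x'] rx[of y] xy by (auto simp: P)
    qed
    also have "\<dots> = (\<Sum>x\<in>?I. if x = x' then \<Sum>y\<in>?I. if y = y' then Y x y else 0 else 0)"
      by (intro sum.cong refl) auto
    also have "\<dots> = Y x' y'"
      using xy finite_range_red by simp
    finally show ?thesis .
  qed
  then show ?thesis using p(1) by blast
qed

end

section \<open>Symplectic form of the quantum affine space\<close>

definition odd_cells :: "nat \<Rightarrow> (nat \<times> nat) set"
  where "odd_cells n = {p \<in> grid n. odd (fst p + snd p)}"

lemma card_odd_cells: "card (odd_cells n) = n\<^sup>2 div 2"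
proof -
  define Ev where "Ev = {i \<in> {1..n}. even i}"
  define Od where "Od = {i \<in> {1..n}. odd i}"
  have "Ev = (\<lambda>k. 2 * k) ` {1..n div 2}" by (auto simp: Ev_def elim!: evenE)
  then have cE: "card Ev = n div 2" by (simp add: card_image inj_on_def)
  have "Od \<union> Ev = {1..n}" by (auto simp: Ev_def Od_def)
  moreover have "card (Od \<union> Ev) = card Od + card Ev"
    by (rule card_Un_disjoint) (auto simp: Ev_def Od_def)
  ultimately have cO: "card Od = n - n div 2" using cE by simp
  have "odd_cells n = Od \<times> Ev \<union> Ev \<times> Od"
    by (auto simp: odd_cells_def grid_def Ev_def Od_def)
  moreover have "card (Od \<times> Ev \<union> Ev \<times> Od) = card (Od \<times> Ev) + card (Ev \<times> Od)"
    by (rule card_Un_disjoint) (auto simp: Ev_def Od_def)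
  ultimately have c: "card (odd_cells n) = 2 * ((n - n div 2) * (n div 2))"
    by (simp add: card_cartesian_product cE cO mult.commute)
  show ?thesis
  proof (cases "even n")
    case True
    then obtain k where "n = 2 * k" by (elim evenE)
    then show ?thesis unfolding c by (simp add: power2_eq_square)
  next
    case False
    then obtain k where "n = 2 * k + 1" by (elim oddE)
    then show ?thesis unfolding c by (simp add: power2_eq_square algebra_simps)
  qed
qed

lemma finite_odd_cells: "finite (odd_cells n)"
  by (simp add: odd_cells_def grid_def)

text \<open>The grid graph without the horizontal edges of its first row.\<close>

definition adj :: "nat \<times> nat \<Rightarrow> nat \<times> nat \<Rightarrow> bool"
  where "adj = (\<lambda>(s, t) (a, b). t = b \<and> (s = a + 1 \<or> a = s + 1) \<or>
    s = a \<and> 2 \<le> s \<and> (t = b + 1 \<or> b = t + 1))"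

definition delta :: "nat \<Rightarrow> nat \<times> nat \<Rightarrow> nat \<times> nat \<Rightarrow> int"
  where "delta n p w = of_bool (w = p \<and> w \<in> odd_cells n)"

definition nbr :: "nat \<Rightarrow> nat \<times> nat \<Rightarrow> nat \<times> nat \<Rightarrow> int"
  where "nbr n p w = of_bool (adj p w \<and> w \<in> odd_cells n)"

text \<open>With these vectors the symplectic form becomes \<open>\<lambda> \<otimes> \<beta> - (\<lambda> \<otimes> \<beta>)\<^sup>T\<close>, where \<open>\<beta>\<close> is the Euler form of the
  quiver of type \<open>A\<^sub>n\<close> with alternating orientation and \<open>-\<lambda>\<close> is the same form with the first diagonal
  entry removed.\<close>

definition rvec :: "nat \<Rightarrow> nat \<Rightarrow> nat \<Rightarrow> (nat \<times> nat) lat"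
  where "rvec n s t = (if odd (s + t) then (delta n (s, t), 0)
    else if odd s then (0, nbr n (s, t))
    else (- delta n (s, t - 1) - delta n (s, t + 1), - nbr n (s, t)))"

text \<open>Summation over initial rectangles is a unimodular change of basis, undone by second
  differences. It turns the two Euler-type forms into indicators of orders.\<close>

definition evec :: "nat \<Rightarrow> nat \<Rightarrow> nat \<Rightarrow> (nat \<times> nat) lat"
  where "evec n a b = (\<Sum>s\<in>{1..a}. \<Sum>t\<in>{1..b}. rvec n s t)"

definition euler :: "nat \<Rightarrow> nat \<Rightarrow> int"
  where "euler t t' = (if t = t' then 1 else if even t \<and> (t' = t + 1 \<or> t = t' + 1) then -1 else 0)"

definition euler' :: "nat \<Rightarrow> nat \<Rightarrow> int"
  where "euler' s s' = of_bool (s = 1 \<and> s' = 1) - euler s s'"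

lemma dot_delta_nbr:
  "dot (odd_cells n) (delta n p) (nbr n p') = of_bool (adj p' p \<and> p \<in> odd_cells n)"
proof -
  have "dot (odd_cells n) (delta n p) (nbr n p') =
      (\<Sum>w\<in>odd_cells n. if w = p then of_bool (adj p' p \<and> p \<in> odd_cells n) else 0)"
    unfolding dot_def by (intro sum.cong) (auto simp: delta_def nbr_def)
  then show ?thesis using finite_odd_cells[of n] by simp
qed

lemma symp_rvec:
  assumes "(s, t) \<in> grid n" "(s', t') \<in> grid n"
  shows "symplectic (odd_cells n) (rvec n s t) (rvec n s' t') = euler' s s' * euler t t' - euler' s' s * euler t' t"
proof -
  have dn: "dot (odd_cells n) (nbr n p') (delta n p) = of_bool (adj p' p \<and> p \<in> odd_cells n)" for p p'
    by (subst dot_commute) (rule dot_delta_nbr)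
  note simps = symplectic_def rvec_def dot_simps dot_delta_nbr dn
  \<comment> \<open>Writing the coordinates as successors removes the truncated subtraction in
    \<open>rvec\<close>. Their parities then select its branches, and every case is a comparison of
    adjacency indicators.\<close>
  obtain \<sigma> \<tau> \<sigma>' \<tau>' where st: "s = Suc \<sigma>" "t = Suc \<tau>" "s' = Suc \<sigma>'" "t' = Suc \<tau>'"
    and le: "\<sigma> < n" "\<tau> < n" "\<sigma>' < n" "\<tau>' < n"
    using assms by (cases s; cases t; cases s'; cases t') (auto simp: grid_def)
  note defs = adj_def odd_cells_def grid_def euler_def euler'_def
  show ?thesis
    unfolding st using le
    by (cases "even \<sigma>"; cases "even \<tau>"; cases "even \<sigma>'"; cases "even \<tau>'")
       (simp_all add: simps, (simp_all add: defs of_bool_def)?, safe, simp_all)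
qed

section \<open>Rectangle sums and the order of the generators\<close>

lemma symp_simps:
  "symplectic W (v + v') u = symplectic W v u + symplectic W v' u" "symplectic W u (v + v') = symplectic W u v + symplectic W u v'"
  "symplectic W 0 u = 0" "symplectic W u 0 = 0"
  by (simp_all add: symplectic_def dot_simps)

lemma symp_sum:
  "symplectic W (sum f J) u = (\<Sum>j\<in>J. symplectic W (f j) u)" "symplectic W u (sum f J) = (\<Sum>j\<in>J. symplectic W u (f j))"
  by (induction J rule: infinite_finite_induct) (simp_all add: symp_simps)

text \<open>The indicator of a reflexive total order: the odd numbers upwards, then the even numbers
  downwards, as in 1, 3, 5, 6, 4, 2. Alternating orientation of the quiver is what produces this
  order from its Euler form.\<close>

definition prec :: "nat \<Rightarrow> nat \<Rightarrow> int"
  where "prec a b = (if odd a then of_bool (odd b \<longrightarrow> a \<le> b) else of_bool (even b \<and> b \<le> a))"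

lemma sum_euler_row: "(\<Sum>t'\<in>{1..b}. euler t t') =
    (if t = 0 then of_bool (1 \<le> b) * - 1 else of_bool (t \<le> b) - of_bool (even t) * (of_bool (t \<le> b + 1) + of_bool (t + 1 \<le> b)))"
  by (induction b) (auto simp: euler_def)

lemma sum_euler: "1 \<le> a \<Longrightarrow> 1 \<le> b \<Longrightarrow> (\<Sum>t\<in>{1..a}. \<Sum>t'\<in>{1..b}. euler t t') = prec a b"
proof (induction a rule: nat_induct_at_least)
  case base
  then show ?case by (simp add: sum_euler_row[unfolded One_nat_def] prec_def)
next
  case (Suc a)
  then have "(\<Sum>t\<in>{1..Suc a}. \<Sum>t'\<in>{1..b}. euler t t') = prec a b + (\<Sum>t'\<in>{1..b}. euler (Suc a) t')"
    by simp
  also have "\<dots> = prec (Suc a) b"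
    unfolding sum_euler_row using Suc by (simp add: prec_def of_bool_def) presburger
  finally show ?case .
qed

text \<open>The removed corner entry belongs to every nonempty initial rectangle. It adds 1 to each
  sum and so turns the negative of the order into its complement, the strict reversed order.\<close>

lemma sum_euler':
  assumes "1 \<le> a" "1 \<le> b"
  shows "(\<Sum>s\<in>{1..a}. \<Sum>s'\<in>{1..b}. euler' s s') = 1 - prec a b"
proof -
  have "(\<Sum>s\<in>{1..a}. \<Sum>s'\<in>{1..b}. of_bool (s = 1 \<and> s' = 1) :: int) =
      (\<Sum>s\<in>{1..a}. \<Sum>s'\<in>{1..b}. if s' = 1 then if s = 1 then 1 else 0 else 0)"
    by (intro sum.cong) auto
  also have "\<dots> = 1" using assms by simp
  finally show ?thesis using sum_euler[OF assms] by (simp add: euler'_def sum_subtractf)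
qed

lemma symp_evec:
  assumes "(a, b) \<in> grid n" "(a', b') \<in> grid n"
  shows "symplectic (odd_cells n) (evec n a b) (evec n a' b') =
    (1 - prec a a') * prec b b' - (1 - prec a' a) * prec b' b"
proof -
  have g: "1 \<le> a" "a \<le> n" "1 \<le> b" "b \<le> n" "1 \<le> a'" "a' \<le> n" "1 \<le> b'" "b' \<le> n"
    using assms by (auto simp: grid_def)
  have sw: "(\<Sum>s\<in>{1..a}. \<Sum>t\<in>{1..b}. \<Sum>s'\<in>{1..a'}. \<Sum>t'\<in>{1..b'}. f s s' * h t t' :: int) =
     (\<Sum>s\<in>{1..a}. \<Sum>s'\<in>{1..a'}. f s s') * (\<Sum>t\<in>{1..b}. \<Sum>t'\<in>{1..b'}. h t t')"
    for f h :: "nat \<Rightarrow> nat \<Rightarrow> int"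
  proof -
    have "(\<Sum>s\<in>{1..a}. \<Sum>t\<in>{1..b}. \<Sum>s'\<in>{1..a'}. \<Sum>t'\<in>{1..b'}. f s s' * h t t') =
       (\<Sum>s\<in>{1..a}. \<Sum>s'\<in>{1..a'}. \<Sum>t\<in>{1..b}. \<Sum>t'\<in>{1..b'}. f s s' * h t t')"
      by (intro sum.cong refl sum.swap)
    then show ?thesis
      by (simp add: sum_distrib_right) (simp add: sum_distrib_left)
  qed
  have "symplectic (odd_cells n) (evec n a b) (evec n a' b') =
    (\<Sum>s\<in>{1..a}. \<Sum>t\<in>{1..b}. \<Sum>s'\<in>{1..a'}. \<Sum>t'\<in>{1..b'}. symplectic (odd_cells n) (rvec n s t) (rvec n s' t'))"
    unfolding evec_def symp_sum(1) by (simp only: symp_sum(2))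
  also have "\<dots> = (\<Sum>s\<in>{1..a}. \<Sum>t\<in>{1..b}. \<Sum>s'\<in>{1..a'}. \<Sum>t'\<in>{1..b'}.
     euler' s s' * euler t t' - euler' s' s * euler t' t)"
    using g by (intro sum.cong refl symp_rvec) (auto simp: grid_def)
  also have "\<dots> = (1 - prec a a') * prec b b' - (1 - prec a' a) * prec b' b"
  proof -
    have "(\<Sum>s\<in>{1..a}. \<Sum>s'\<in>{1..a'}. euler' s' s) = 1 - prec a' a"
      by (subst sum.swap) (rule sum_euler'[OF g(5,1)])
    moreover have "(\<Sum>t\<in>{1..b}. \<Sum>t'\<in>{1..b'}. euler t' t) = prec b' b"
      by (subst sum.swap) (rule sum_euler[OF g(7,3)])
    ultimately show ?thesis using g by (simp only: sum_subtractf sw sum_euler sum_euler')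
  qed
  finally show ?thesis .
qed

text \<open>The enumeration of \<open>1..n\<close> in the order \<open>prec\<close>.\<close>

definition zigzag :: "nat \<Rightarrow> nat \<Rightarrow> nat"
  where "zigzag n i = (if 2 * i - 1 \<le> n then 2 * i - 1 else 2 * (n + 1 - i))"

lemma zigzag_bounds: "1 \<le> i \<Longrightarrow> i \<le> n \<Longrightarrow> 1 \<le> zigzag n i \<and> zigzag n i \<le> n"
  by (auto simp: zigzag_def)

lemma prec_zigzag:
  assumes "1 \<le> i" "i \<le> n" "1 \<le> j" "j \<le> n"
  shows "prec (zigzag n i) (zigzag n j) = of_bool (i \<le> j)"
proof -
  have "odd (2 * i - 1)" "odd (2 * j - 1)" using assms by auto
  then show ?thesis using assms by (auto simp: zigzag_def prec_def)
qed

lemma zigzag_surj: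
  assumes "1 \<le> a" "a \<le> n"
  shows "\<exists>i. 1 \<le> i \<and> i \<le> n \<and> zigzag n i = a"
proof (cases "even a")
  case True
  then obtain k where "a = 2 * k" by (elim evenE)
  then show ?thesis using assms by (intro exI[of _ "n + 1 - k"]) (auto simp: zigzag_def)
next
  case False
  then obtain k where "a = 2 * k + 1" by (elim oddE)
  then show ?thesis using assms by (intro exI[of _ "k + 1"]) (auto simp: zigzag_def)
qed

text \<open>Renumbering by \<open>zigzag\<close> makes both orders the usual one, and the products
  of indicators become literally the exponents of \<open>q\<close> in the relations of the affine
  space.\<close>

lemma symp_evec_zigzag:
  assumes "(i, j) \<in> grid n" "(s, t) \<in> grid n"
  shows "symplectic (odd_cells n) (evec n (zigzag n i) (zigzag n j)) (evec n (zigzag n s) (zigzag n t)) =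
    of_bool (s < i \<and> j \<le> t) - of_bool (i < s \<and> t \<le> j)"
proof -
  have g: "1 \<le> i" "i \<le> n" "1 \<le> j" "j \<le> n" "1 \<le> s" "s \<le> n" "1 \<le> t" "t \<le> n"
    using assms by (auto simp: grid_def)
  have "(zigzag n i, zigzag n j) \<in> grid n" "(zigzag n s, zigzag n t) \<in> grid n"
    using g zigzag_bounds by (auto simp: grid_def)
  then show ?thesis
    using g by (auto simp: symp_evec prec_zigzag)
qed

subsection \<open>The discrete wave equation\<close>

text \<open>A function on the grid whose neighbour sums vanish satisfies a discrete wave equation below the
  second row, with zero boundary values. Its d'Alembert solution is given by the odd \<open>2 (n + 1)\<close>-periodic
  extension \<open>g\<close> of the third row; vanishing at the other end makes \<open>g\<close> also \<open>2 (n - 1)\<close>-periodic,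
  hence \<open>4\<close>-periodic, and this forces \<open>g = 0\<close>.\<close>

lemma wave_equation_trivial:
  fixes S :: "'a::ring_1 set" and F :: "nat \<Rightarrow> nat \<Rightarrow> 'a"
  assumes S: "0 \<in> S" "\<And>x y. x \<in> S \<Longrightarrow> y \<in> S \<Longrightarrow> x + y \<in> S" "\<And>x. x \<in> S \<Longrightarrow> - x \<in> S"
    and self_neg: "\<And>x :: 'a. x = - x \<Longrightarrow> x = 0"
    and n: "n = N + 1" "N \<ge> 1"
    and F0: "\<And>j. odd j \<Longrightarrow> j \<le> n + 1 \<Longrightarrow> F 0 j \<in> S"
    and Fl: "\<And>a. F a 0 = 0" and Fr: "\<And>a. F a (n + 1) = 0" and FN: "\<And>j. F N j = 0"
    and wave: "\<And>a j. 1 \<le> a \<Longrightarrow> a < N \<Longrightarrow> 1 \<le> j \<Longrightarrow> j \<le> n \<Longrightarrow> even (a + j) \<Longrightarrow>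
      F (a + 1) j + F (a - 1) j - F a (j + 1) - F a (j - 1) \<in> S"
    and a: "a \<le> N" "j \<le> n + 1" "odd (a + j)"
  shows "F a j \<in> S"
proof -
  define P where "P = 2 * int (n + 1)"
  have P: "P > 0" by (simp add: P_def)
  define g where "g x = (let y = x mod P in if y \<le> int (n + 1) then F 1 (nat y) else - F 1 (nat (P - y)))" for x
  have gper: "g (x + P * k) = g x" for x k by (simp add: g_def)
  have gper1: "g (x + P) = g x" for x using gper[of x 1] by simp
  have godd: "g (- x) = - g x" for x
  proof (cases "x mod P = 0")
    case True
    then have "(- x) mod P = 0" by (simp add: mod_minus_eq zmod_zminus1_eq_if)
    then show ?thesis using True by (simp add: g_def Fl)
  next
    case False
    then have m: "(- x) mod P = P - x mod P" by (simp add: zmod_zminus1_eq_if)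
    have b: "0 < x mod P" "x mod P < P" 
      using P False pos_mod_sign[OF P, of x] pos_mod_bound[OF P, of x] by linarith+
    consider "x mod P < int (n + 1)" | "x mod P = int (n + 1)" | "x mod P > int (n + 1)" by linarith
    then show ?thesis
    proof cases
      case 2
      then have "(- x) mod P = int (n + 1)" using m by (simp add: P_def)
      moreover have "F 1 (nat (int (n + 1))) = 0" using Fr by (metis nat_int)
      ultimately show ?thesis using 2 by (simp add: g_def)
    qed (use m b in \<open>auto simp: g_def P_def Let_def\<close>)
  qed
  have g1: "g (int j) = F 1 j" if "j \<le> n + 1" for j
  proof -
    have "int j mod P = int j" using that by (simp add: P_def)
    then show ?thesis using that by (simp add: g_def)
  qed
  have g0: "g 0 = 0" using g1[of 0] Fl by simp
  \<comment> \<open>The d'Alembert sum over every second point from \<open>x - a + 1\<close> to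
    \<open>x + a - 1\<close>. It starts with \<open>G 0 = 0\<close> and \<open>G 1 = g\<close>, and
    inherits oddness and the period from \<open>g\<close>.\<close>
  define G where "G a x = (\<Sum>r<a. g (x - int a + 1 + 2 * int r))" for a :: nat and x
  have Godd: "G a (- x) = - G a x" for a x
  proof -
    have "G a (- x) = (\<Sum>r<a. - g (x - int a + 1 + 2 * int (a - Suc r)))"
      unfolding G_def
    proof (rule sum.cong[OF refl])
      fix r assume "r \<in> {..<a}"
      then have "- x - int a + 1 + 2 * int r = - (x - int a + 1 + 2 * int (a - Suc r))"
        by (auto simp: of_nat_diff algebra_simps)
      then show "g (- x - int a + 1 + 2 * int r) = - g (x - int a + 1 + 2 * int (a - Suc r))"
        using godd by metis
    qed
    also have "\<dots> = (\<Sum>r<a. - g (x - int a + 1 + 2 * int r))"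
      by (rule sum.nat_diff_reindex)
    finally show ?thesis by (simp add: G_def sum_negf)
  qed
  have Gper: "G a (x + P) = G a x" for a x
  proof -
    have "x + P - int a + 1 + 2 * int r = x - int a + 1 + 2 * int r + P" for r by simp
    then show ?thesis unfolding G_def by (simp only: gper1)
  qed
  \<comment> \<open>The boundary values vanish exactly and not just modulo \<open>S\<close>:
    cancelling 2 is possible in the ring, while the quotient by \<open>S\<close> may have
    2-torsion.\<close>
  have G0: "G a 0 = 0" for a using Godd[of a 0] by (intro self_neg) simp
  have Gn: "G a (int (n + 1)) = 0" for a
  proof (rule self_neg)
    have "G a (int (n + 1)) = G a (- int (n + 1) + P)" by (simp add: P_def)
    also have "\<dots> = - G a (int (n + 1))" by (simp only: Gper Godd)
    finally show "G a (int (n + 1)) = - G a (int (n + 1))" .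
  qed
  have Gstep: "G (Suc a) (x + 1) = G a x + g (x + int a + 1)" for a x
  proof -
    have "x + 1 - int (Suc a) + 1 + 2 * int r = x - int a + 1 + 2 * int r" for r by simp
    moreover have "x - int a + 1 + 2 * int a = x + int a + 1" by simp
    ultimately show ?thesis unfolding G_def by (subst sum.lessThan_Suc) (simp only:)
  qed
  have Gwave: "G (Suc (Suc a)) x + G a x = G (Suc a) (x + 1) + G (Suc a) (x - 1)" for a x
  proof -
    have 1: "G (Suc (Suc a)) x = G (Suc a) (x - 1) + g (x + int a + 1)"
    proof -
      have "x - int (Suc (Suc a)) + 1 + 2 * int r = x - 1 - int (Suc a) + 1 + 2 * int r" for r by simp
      moreover have "x - 1 - int (Suc a) + 1 + 2 * int (Suc a) = x + int a + 1" by simp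
      ultimately show ?thesis unfolding G_def by (subst sum.lessThan_Suc) (simp only:)
    qed
    show ?thesis by (simp only: 1 Gstep) (simp add: algebra_simps)
  qed
  have Sm: "x - y \<in> S" if "x \<in> S" "y \<in> S" for x y using S(2)[OF that(1) S(3)[OF that(2)]] by simp
  \<comment> \<open>The wave equation at a point with \<open>a + j\<close> even involves only points
    where the sum is odd, so one colour of the chessboard propagates on its own.\<close>
  have FG: "(\<forall>j\<le>n + 1. odd (a + j) \<longrightarrow> F a j - G a (int j) \<in> S)" if "a \<le> N" for a
    using that
  proof (induction a rule: less_induct)
    case (less a)
    consider "a = 0" | "a = 1" | b where "a = Suc (Suc b)" by (metis One_nat_def not0_implies_Suc)
    then show ?case
    proof cases
      case 1
      then show ?thesis using F0 by (simp add: G_def)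
    next
      case 2
      then show ?thesis using g1 S(1) by (simp add: G_def zero_fun_def)
    next
      case (3 b)
      show ?thesis
      proof (intro allI impI)
        fix j assume j: "j \<le> n + 1" "odd (a + j)"
        consider "j = 0" | "j = n + 1" | "1 \<le> j" "j \<le> n" using j by linarith
        then show "F a j - G a (int j) \<in> S"
        proof cases
          case 1
          then show ?thesis using Fl G0 S(1) by simp
        next
          case 2
          then show ?thesis using Fr Gn S(1) by (simp del: of_nat_add of_nat_Suc)
        next
          case j': 3
          have w: "F a j + F b j - F (Suc b) (j + 1) - F (Suc b) (j - 1) \<in> S"
            using wave[of "Suc b" j] j j' 3 less.prems by simp
          have 1: "F b j - G b (int j) \<in> S" 
            by (rule less.IH[rule_format]) (use 3 j less.prems in auto)
          have 2: "F (Suc b) (j + 1) - G (Suc b) (int j + 1) \<in> S"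
          proof -
            have "F (Suc b) (j + 1) - G (Suc b) (int (j + 1)) \<in> S"
              by (rule less.IH[rule_format]) (use 3 j j' less.prems in auto)
            then show ?thesis by (simp only: of_nat_add of_nat_1)
          qed
          have 4: "F (Suc b) (j - 1) - G (Suc b) (int j - 1) \<in> S"
          proof -
            have "F (Suc b) (j - 1) - G (Suc b) (int (j - 1)) \<in> S"
              by (rule less.IH[rule_format]) (use 3 j j' less.prems in auto)
            then show ?thesis using j' by (simp only: of_nat_diff of_nat_1)
          qed
          have "F a j - G a (int j) = (F a j + F b j - F (Suc b) (j + 1) - F (Suc b) (j - 1)) - (F b j - G b (int j))
              + (F (Suc b) (j + 1) - G (Suc b) (int j + 1)) + (F (Suc b) (j - 1) - G (Suc b) (int j - 1))"
            using Gwave[of b "int j"] by (simp add: 3 algebra_simps)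
          also have "\<dots> \<in> S" by (intro S(2) Sm w 1 2 4)
          finally show ?thesis .
        qed
      qed
    qed
  qed
  have evP: "even P" by (simp add: P_def)
  have GN0: "G N x \<in> S" if x: "odd (x + int N)" "0 \<le> x" "x \<le> int (n + 1)" for x
  proof -
    have "odd (N + nat x)" using x by (auto simp: even_nat_iff)
    then have "F N (nat x) - G N (int (nat x)) \<in> S"
      by (intro FG[rule_format]) (use x in auto)
    then have "- (F N (nat x) - G N (int (nat x))) \<in> S" by (rule S(3))
    then show ?thesis using x by (simp only: FN diff_0 minus_minus int_nat_eq if_True)
  qed
  have GN: "G N x \<in> S" if x: "odd (x + int N)" for x
  proof -
    define y where "y = x mod P"
    have Gk: "G N (x + P * k) = G N x" for x k
    proof -
      have "x + P * k - int N + 1 + 2 * int r = x - int N + 1 + 2 * int r + P * k" for r by simp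
      then show ?thesis unfolding G_def by (simp only: gper)
    qed
    have xy: "x = y + P * (x div P)" by (simp add: y_def)
    then have Gxy: "G N x = G N y" using Gk by metis
    have py: "odd (y + int N)" using x xy evP by (metis even_add even_mult_iff)
    have y: "0 \<le> y" "y < P" using P by (simp_all add: y_def)
    show ?thesis
    proof (cases "y \<le> int (n + 1)")
      case True
      then show ?thesis using GN0[OF py] y Gxy by simp
    next
      case False
      have "G N y = - G N (P - y)" using Godd[of N "y - P"] Gper[of N "y - P"] by simp
      moreover have "G N (P - y) \<in> S"
        using False y py evP by (intro GN0) (auto simp: P_def)
      ultimately show ?thesis using Gxy S(3) by simp
    qed
  qed
  \<comment> \<open>Two values of \<open>G N\<close> at distance 2 share all but their outermost
    terms, and both lie in \<open>S\<close> because \<open>F N\<close> vanishes.\<close>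
  have g2N: "g (y + 2 * int N) - g y \<in> S" if "even y" for y
  proof -
    have up: "G (Suc N) (x + 1) = g (x + 1 - int N) + G N (x + 2)" for x
    proof -
      have "x + 1 - int (Suc N) + 1 + 2 * int (Suc r) = x + 2 - int N + 1 + 2 * int r" for r by simp
      moreover have "x + 1 - int (Suc N) + 1 + 2 * int 0 = x + 1 - int N" by simp
      ultimately show ?thesis unfolding G_def by (subst sum.lessThan_Suc_shift) (simp only:)
    qed
    let ?x = "y + int N - 1"
    have "?x + int N + 1 = y + 2 * int N" "?x + 1 - int N = y" by simp_all
    then have "g (y + 2 * int N) - g y = G N (?x + 2) - G N ?x"
      using up[of ?x] Gstep[of N ?x] by (simp only:) (simp add: algebra_simps)
    also have "\<dots> \<in> S" using that by (intro Sm GN) auto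
    finally show ?thesis .
  qed
  \<comment> \<open>The two periods differ by 4, since
    \<open>2 * N + 4 = 2 * (n + 1)\<close>.\<close>
  have g4: "g (y + 4) - g y \<in> S" if "even y" for y
  proof -
    have "y + 4 + 2 * int N = y + P" using n by (simp add: P_def)
    then have "g (y + 4 + 2 * int N) = g y" using gper1 by metis
    then have "g y - g (y + 4) \<in> S" using g2N[of "y + 4"] that by simp
    then show ?thesis using S(3) by fastforce
  qed
  have g4k: "g (y + 4 * int k) - g y \<in> S" if "even y" for y k
  proof (induction k)
    case 0 then show ?case using S(1) by (simp add: zero_fun_def)
  next
    case (Suc k)
    have "g (y + 4 * int (Suc k)) - g y = (g (y + 4 * int k + 4) - g (y + 4 * int k)) + (g (y + 4 * int k) - g y)"
      by (simp add: algebra_simps)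
    also have "\<dots> \<in> S" using that by (intro S(2) g4 Suc.IH) simp
    finally show ?case .
  qed
  have mult: "of_nat k * x \<in> S" if "x \<in> S" for k x
    using that S by (induction k) (auto simp: distrib_right)
  have sums: "(\<Sum>r<k. g (y + 2 * int r)) - (of_nat ((k + 1) div 2) * g y + of_nat (k div 2) * g (y + 2)) \<in> S"
    if "even y" for y k
  proof (induction k)
    case 0 then show ?case using S(1) by (simp add: zero_fun_def)
  next
    case (Suc k)
    let ?u = "if even k then y else y + 2"
    have "g (y + 2 * int k) - g ?u \<in> S"
    proof (cases "even k")
      case True
      then obtain l where "k = 2 * l" by (elim evenE)
      then show ?thesis using g4k[of y l] that by simp
    next
      case False
      then obtain l where "k = 2 * l + 1" by (elim oddE)
      then show ?thesis using g4k[of "y + 2" l] that by (simp add: algebra_simps)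
    qed
    from S(2)[OF Suc.IH this]
    show ?case by (cases "even k") (auto elim!: evenE oddE simp: algebra_simps)
  qed
  \<comment> \<open>Period 4 takes \<open>-2\<close> to \<open>2\<close>, while oddness changes the
    sign.\<close>
  have gg2: "g 2 + g 2 \<in> S" using g4[of "-2"] godd[of 2] by simp
  have A: "of_nat (N div 2) * g 2 \<in> S"
  proof -
    have "G N (int N - 1) = (\<Sum>r<N. g (0 + 2 * int r))" by (simp add: G_def)
    moreover have "G N (int N - 1) \<in> S" by (rule GN) simp
    ultimately have "(\<Sum>r<N. g (0 + 2 * int r)) - ((\<Sum>r<N. g (0 + 2 * int r)) -
        (of_nat ((N + 1) div 2) * g 0 + of_nat (N div 2) * g (0 + 2))) \<in> S"
      by (intro Sm sums) simp_all
    then show ?thesis using g0 by simp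
  qed
  have B: "of_nat ((N + 1) div 2) * g 2 \<in> S"
  proof -
    have "G N (int N + 1) = (\<Sum>r<N. g (2 + 2 * int r))" by (simp add: G_def)
    moreover have "G N (int N + 1) \<in> S" by (rule GN) simp
    ultimately have "(\<Sum>r<N. g (2 + 2 * int r)) - ((\<Sum>r<N. g (2 + 2 * int r)) -
        (of_nat ((N + 1) div 2) * g 2 + of_nat (N div 2) * g (2 + 2))) \<in> S"
      by (intro Sm sums) simp_all
    then have "of_nat ((N + 1) div 2) * g 2 + of_nat (N div 2) * g 4 \<in> S" by (simp add: add.commute)
    moreover have "of_nat (N div 2) * g 4 \<in> S" using g4[of 0] g0 by (intro mult) simp
    ultimately have "of_nat ((N + 1) div 2) * g 2 + of_nat (N div 2) * g 4 - of_nat (N div 2) * g 4 \<in> S"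
      by (rule Sm)
    then show ?thesis by simp
  qed
  \<comment> \<open>For odd \<open>N\<close> the coefficients in \<open>A\<close> and
    \<open>B\<close> are consecutive. For \<open>N = 2 * k\<close> with \<open>k\<close> odd, the
    coefficient \<open>k\<close> is combined with \<open>gg2\<close>. If 4 divides \<open>N\<close>,
    then \<open>n + 1\<close> is congruent to 2 modulo 4, and the boundary value
    \<open>g (n + 1) = 0\<close> decides.\<close>
  have g2: "g 2 \<in> S"
  proof (cases "odd N")
    case True
    then obtain k where "N = 2 * k + 1" by (elim oddE)
    then have "of_nat (k + 1) * g 2 - of_nat k * g 2 \<in> S" using Sm[OF B A] by simp
    then show ?thesis by (simp add: algebra_simps)
  next
    case False
    then obtain k where k: "N = 2 * k" by (metis evenE)
    show ?thesis
    proof (cases "odd k")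
      case True
      then obtain l where "k = 2 * l + 1" by (elim oddE)
      then have "k = l + l + 1" by simp
      then have "of_nat k * g 2 = of_nat l * (g 2 + g 2) + g 2"
        by (simp add: distrib_left distrib_right add_ac)
      moreover have "of_nat k * g 2 - of_nat l * (g 2 + g 2) \<in> S"
        using Sm[OF A mult[OF gg2, of l]] k by simp
      ultimately show ?thesis by (simp only: add_diff_cancel_left')
    next
      case False
      then obtain l where l: "k = 2 * l" by (metis evenE)
      have "int (n + 1) = 2 + 4 * int l" using k l n by simp
      moreover have "g (int (n + 1)) = 0" using g1[of "n + 1"] Fr by simp
      ultimately have "g (2 + 4 * int l) = 0" by simp
      then show ?thesis using g4k[of 2 l] S(3)[of "- g 2"] by simp
    qed
  qed
  have geven: "g (2 * x) \<in> S" for x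
  proof -
    have nat: "g (2 * int k) \<in> S" for k
    proof (cases "even k")
      case True
      then obtain l where "k = 2 * l" by (elim evenE)
      then show ?thesis using g4k[of 0 l] g0 by simp
    next
      case False
      then obtain l where l: "k = 2 * l + 1" by (elim oddE)
      then have "2 * int k = 2 + 4 * int l" by simp
      then show ?thesis using S(2)[OF g4k[of 2 l] g2] by simp
    qed
    show ?thesis
    proof (cases "x \<ge> 0")
      case True
      then show ?thesis using nat[of "nat x"] by simp
    next
      case False
      then show ?thesis using S(3)[OF nat[of "nat (- x)"]] godd[of "2 * x"] by simp
    qed
  qed
  have Ssum: "sum f J \<in> S" if "\<And>r. r \<in> J \<Longrightarrow> f r \<in> S" for f :: "nat \<Rightarrow> 'a" and J
    using that by (induction J rule: infinite_finite_induct) (auto intro: S)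
  have "G a (int j) \<in> S"
    unfolding G_def
  proof (rule Ssum)
    fix r
    have "even (int j - int a + 1 + 2 * int r)" using a(3) by auto
    then obtain x where "int j - int a + 1 + 2 * int r = 2 * x" by (elim evenE)
    then show "g (int j - int a + 1 + 2 * int r) \<in> S" using geven by metis
  qed
  then show ?thesis using S(2)[OF FG[rule_format, OF a]] by fastforce
qed

section \<open>The lattice spanned by the exponent vectors\<close>

lemma delta_outside: "p \<notin> odd_cells n \<Longrightarrow> delta n p = 0"
  by (auto simp: delta_def fun_eq_iff)

lemma nbr_eq:
  assumes "1 \<le> s" "1 \<le> t"
  shows "nbr n (s, t) = delta n (s - 1, t) + delta n (s + 1, t) +
    (if 2 \<le> s then delta n (s, t - 1) + delta n (s, t + 1) else 0)"
proof
  fix w :: "nat \<times> nat"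
  obtain x y where w: "w = (x, y)" by (cases w)
  show "nbr n (s, t) w = (delta n (s - 1, t) + delta n (s + 1, t) +
    (if 2 \<le> s then delta n (s, t - 1) + delta n (s, t + 1) else 0)) w"
  proof (cases "w \<in> odd_cells n")
    case True
    then have "1 \<le> x" "1 \<le> y" by (auto simp: w odd_cells_def grid_def)
    then show ?thesis using True assms
      by (cases "x = s"; cases "y = t") (auto simp: nbr_def delta_def adj_def w)
  qed (simp add: nbr_def delta_def)
qed

text \<open>Spanning over the integers, stated for an arbitrary subgroup \<open>L\<close> so that it
  can be applied to the exponents realized in the image of a representation. Odd cells yield the
  clocks at once; the shifts need the neighbour sums to generate, which is the wave equation modulo
  \<open>S\<close>.\<close>

lemma lattice_span:
  fixes L :: "(nat \<times> nat) lat set"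
  assumes L: "0 \<in> L" "\<And>v v'. v \<in> L \<Longrightarrow> v' \<in> L \<Longrightarrow> v + v' \<in> L" "\<And>v. v \<in> L \<Longrightarrow> - v \<in> L"
    and ev: "\<And>a b. (a, b) \<in> grid n \<Longrightarrow> evec n a b \<in> L"
  shows "(delta n w, 0) \<in> L" "(\<And>w. w \<notin> odd_cells n \<Longrightarrow> \<kappa> w = 0) \<Longrightarrow> (0, \<kappa>) \<in> L"
proof -
  have Lm: "v - v' \<in> L" if "v \<in> L" "v' \<in> L" for v v' using L(2)[OF that(1) L(3)[OF that(2)]] by simp
  \<comment> \<open>Empty rectangles contribute 0, so second differences recover \<open>rvec\<close>
    in the first row and column too.\<close>
  have ev': "evec n a b \<in> L" if "a \<le> n" "b \<le> n" for a b
  proof (cases "a = 0 \<or> b = 0")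
    case True
    then have "evec n a b = 0" by (auto simp: evec_def)
    then show ?thesis using L(1) by simp
  qed (use that in \<open>auto intro: ev simp: grid_def\<close>)
  have rv: "rvec n s t \<in> L" if st: "(s, t) \<in> grid n" for s t
  proof -
    obtain s' t' where s: "s = Suc s'" "t = Suc t'" "s' < n" "t' < n"
      using st by (cases s; cases t) (auto simp: grid_def)
    have "evec n (Suc s') (Suc t') - evec n s' (Suc t') - (evec n (Suc s') t' - evec n s' t') = rvec n s t"
      by (simp add: evec_def s)
    moreover have "evec n (Suc s') (Suc t') - evec n s' (Suc t') - (evec n (Suc s') t' - evec n s' t') \<in> L"
      using s by (intro Lm ev') auto
    ultimately show ?thesis by simp
  qed
  have dl: "(delta n w, 0) \<in> L" for w
  proof (cases "w \<in> odd_cells n")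
    case True
    obtain s t where w: "w = (s, t)" by (cases w)
    then have "rvec n s t \<in> L" using True by (intro rv) (simp add: odd_cells_def)
    then show ?thesis using True by (simp add: w rvec_def odd_cells_def)
  next
    case False
    then show ?thesis using L(1) by (simp add: delta_outside zero_prod_def)
  qed
  show "(delta n w, 0) \<in> L" by (rule dl)
  define S where "S = {\<kappa>. (0, \<kappa>) \<in> L}"
  have S0: "0 \<in> S" using L(1) by (simp add: S_def zero_prod_def)
  have Sp: "x + y \<in> S" if "x \<in> S" "y \<in> S" for x y
  proof -
    have "(0 :: nat \<times> nat \<Rightarrow> int, x + y) = (0, x) + (0, y)" by simp
    then show ?thesis using L(2) that unfolding S_def mem_Collect_eq by metis
  qed
  have Sn: "- x \<in> S" if "x \<in> S" for x
  proof -
    have "(0 :: nat \<times> nat \<Rightarrow> int, - x) = - (0, x)" by simp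
    then show ?thesis using L(3) that unfolding S_def mem_Collect_eq by metis
  qed
  have Sd: "x - y \<in> S" if "x \<in> S" "y \<in> S" for x y using Sp[OF that(1) Sn[OF that(2)]] by simp
  \<comment> \<open>In odd rows the vector is the neighbour sum itself. In even rows it carries
    clocks as well, and these are already known to lie in \<open>L\<close>.\<close>
  have nb: "nbr n (s, t) \<in> S" if st: "(s, t) \<in> grid n" "even (s + t)" for s t
  proof (cases "odd s")
    case True
    then show ?thesis using rv[OF st(1)] st(2) by (simp add: rvec_def S_def)
  next
    case False
    have "(0, - nbr n (s, t)) = rvec n s t + (delta n (s, t - 1), 0) + (delta n (s, t + 1), 0)"
      using False st(2) by (simp add: rvec_def)
    also have "\<dots> \<in> L" by (intro L(2) rv st dl)
    finally have "- nbr n (s, t) \<in> S" by (simp add: S_def)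
    then show ?thesis using Sn by fastforce
  qed
  have dS: "delta n (s, t) \<in> S" if st: "(s, t) \<in> odd_cells n" for s t
  proof -
    have g: "1 \<le> s" "s \<le> n" "1 \<le> t" "t \<le> n" "odd (s + t)" using st by (auto simp: odd_cells_def grid_def)
    then have "n \<noteq> 1" by auto
    then obtain N where N: "n = N + 1" "N \<ge> 1" using g by (cases n) auto
    \<comment> \<open>The sign alternating with the row turns neighbour sums into wave operators.
      The index starts at the second row: the first row has no horizontal edges, so its neighbour
      sums are single cells of the second row and give the initial condition.\<close>
    define F where "F a j = (if even a then delta n (a + 2, j) else - delta n (a + 2, j))" for a j
    have FS: "F a j \<in> S" if "a \<le> N" "j \<le> n + 1" "odd (a + j)" for a j
    proof (rule wave_equation_trivial[where S = S and n = n and N = N and F = F])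
      show "0 \<in> S" by (rule S0)
      show "\<And>x y. x \<in> S \<Longrightarrow> y \<in> S \<Longrightarrow> x + y \<in> S" by (rule Sp)
      show "\<And>x. x \<in> S \<Longrightarrow> - x \<in> S" by (rule Sn)
      fix x :: "nat \<times> nat \<Rightarrow> int" assume x: "x = - x"
      show "x = 0"
      proof
        fix c have "x c = - x c" by (subst x) simp
        then show "x c = 0 c" by simp
      qed
    next
      fix j assume j: "odd j" "j \<le> n + 1"
      show "F 0 j \<in> S"
      proof (cases "j \<le> n")
        case True
        have "1 \<le> j" using j by (cases j) auto
        then have "nbr n (1, j) = delta n (2, j)"
          using j by (subst nbr_eq) (auto simp: delta_outside odd_cells_def grid_def numeral_2_eq_2 elim: oddE)
        moreover have "nbr n (1, j) \<in> S" using j True \<open>1 \<le> j\<close> by (intro nb) (auto simp: grid_def)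
        ultimately show ?thesis by (simp add: F_def numeral_2_eq_2)
      next
        case False
        then show ?thesis using S0 by (simp add: F_def delta_outside odd_cells_def grid_def)
      qed
    next
      fix a j assume a: "1 \<le> a" "a < N" "1 \<le> j" "j \<le> n" "even (a + j)"
      have "nbr n (a + 2, j) \<in> S" using a N by (intro nb) (auto simp: grid_def)
      moreover have "F (a + 1) j + F (a - 1) j - F a (j + 1) - F a (j - 1) =
        (if even a then - nbr n (a + 2, j) else nbr n (a + 2, j))"
        using a by (cases a) (simp_all add: F_def nbr_eq algebra_simps)
      ultimately show "F (a + 1) j + F (a - 1) j - F a (j + 1) - F a (j - 1) \<in> S" using Sn by simp
    qed (use N that in \<open>auto simp: F_def delta_outside odd_cells_def grid_def\<close>)
    have rows: "delta n (s, t) \<in> S" if s2: "2 \<le> s" and "s \<le> n + 1" "t \<le> n + 1" "odd (s + t)" for s t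
    proof -
      obtain r where r: "s = r + 2" using s2 le_Suc_ex[of 2 s] by auto
      have "F r t \<in> S" using that N r by (intro FS) auto
      moreover have "F r t = delta n (s, t) \<or> - F r t = delta n (s, t)"
        by (simp add: F_def r)
      ultimately show ?thesis using Sn by metis
    qed
    show ?thesis
    proof (cases "2 \<le> s")
      case True
      then show ?thesis using g by (intro rows) auto
    next
      case False
      then have s: "s = 1" using g by simp
      then have t: "even t" using g by simp
      \<comment> \<open>The wave equation does not reach the first row, but each of its odd cells is
        the only one of that row in the neighbour sum at the cell below it.\<close>
      have "delta n (1, t) = nbr n (2, t) - delta n (3, t) - delta n (2, t - 1) - delta n (2, t + 1)"
        using g by (simp add: nbr_eq numeral_3_eq_3 numeral_2_eq_2 algebra_simps)
      moreover have "nbr n (2, t) \<in> S" using t g N by (intro nb) (auto simp: grid_def)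
      moreover have "delta n (3, t) \<in> S" using t g N by (intro rows) auto
      moreover have "delta n (2, t - 1) \<in> S" using t g N by (intro rows) auto
      moreover have "delta n (2, t + 1) \<in> S" using t g N by (intro rows) auto
      ultimately show ?thesis using s by (metis Sd)
    qed
  qed
  assume \<kappa>: "\<And>w. w \<notin> odd_cells n \<Longrightarrow> \<kappa> w = 0"
  have nat: "(\<lambda>x. int k * d x) \<in> S" if "d \<in> S" for k d
  proof (induction k)
    case 0 then show ?case using S0 by (simp add: zero_fun_def)
  next
    case (Suc k)
    have "(\<lambda>x. int (Suc k) * d x) = (\<lambda>x. int k * d x) + d" by (simp add: fun_eq_iff algebra_simps)
    then show ?case using Sp[OF Suc that] by simp
  qed
  have intm: "(\<lambda>x. k * d x) \<in> S" if "d \<in> S" for k d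
  proof (cases "k \<ge> 0")
    case True then show ?thesis using nat[OF that, of "nat k"] by simp
  next
    case False
    have "(\<lambda>x. k * d x) = - (\<lambda>x. int (nat (- k)) * d x)" using False by (simp add: fun_eq_iff)
    then show ?thesis using Sn[OF nat[OF that, of "nat (- k)"]] by simp
  qed
  have Ssum: "sum f J \<in> S" if "\<And>j. j \<in> J \<Longrightarrow> f j \<in> S" for f :: "nat \<times> nat \<Rightarrow> nat \<times> nat \<Rightarrow> int" and J
    using that by (induction J rule: infinite_finite_induct) (auto intro: S0 Sp)
  have "\<kappa> = (\<Sum>w\<in>odd_cells n. (\<lambda>x. \<kappa> w * delta n w x))"
  proof
    fix x
    have app: "sum f J x = (\<Sum>j\<in>J. f j x)" for f :: "nat \<times> nat \<Rightarrow> nat \<times> nat \<Rightarrow> int" and J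
      by (induction J rule: infinite_finite_induct) auto
    have "(\<Sum>w\<in>odd_cells n. \<kappa> w * delta n w x) = (\<Sum>w\<in>odd_cells n. if w = x then \<kappa> x else 0)"
      by (intro sum.cong) (auto simp: delta_def)
    then show "\<kappa> x = (\<Sum>w\<in>odd_cells n. (\<lambda>x. \<kappa> w * delta n w x)) x"
      using \<kappa>[of x] finite_odd_cells[of n] by (simp add: app)
  qed
  also have "\<dots> \<in> S" using dS by (intro Ssum intm) auto
  finally show "(0, \<kappa>) \<in> L" by (simp add: S_def)
qed

section \<open>Operators satisfying the relations of the quantum matrix algebra\<close>

definition smul :: "'k::field \<Rightarrow> ('i, 'k) lop \<Rightarrow> ('i, 'k) lop"  (infixr \<open>*\<^sub>c\<close> 75)
  where "c *\<^sub>c T = scal c * T"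

lemma smul_mult: "(c *\<^sub>c S) * T = c *\<^sub>c (S * T)" "S * (c *\<^sub>c T) = c *\<^sub>c (S * T)"
proof -
  show "(c *\<^sub>c S) * T = c *\<^sub>c (S * T)" by (simp add: smul_def mult.assoc)
  have "S * (scal c * T) = scal c * S * T" by (simp only: scal_hom(4)[of c S] mult.assoc)
  then show "S * (c *\<^sub>c T) = c *\<^sub>c (S * T)" by (simp add: smul_def mult.assoc)
qed

lemma smul_simps:
  "c *\<^sub>c (S + T) = c *\<^sub>c S + c *\<^sub>c T" "c *\<^sub>c (S - T) = c *\<^sub>c S - c *\<^sub>c T"
  "c *\<^sub>c d *\<^sub>c T = (c * d) *\<^sub>c T" "1 *\<^sub>c T = T" "c *\<^sub>c 0 = 0" "0 *\<^sub>c T = 0"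
  "c *\<^sub>c sum f J = (\<Sum>j\<in>J. c *\<^sub>c f j)" "c *\<^sub>c (- T) = - (c *\<^sub>c T)"
  by (simp_all add: smul_def algebra_simps scal_simps sum_distrib_left)

lemma smul_left: "(c + d) *\<^sub>c T = c *\<^sub>c T + d *\<^sub>c T" "(c - d) *\<^sub>c T = c *\<^sub>c T - d *\<^sub>c T"
proof -
  show 1: "(c + d) *\<^sub>c T = c *\<^sub>c T + d *\<^sub>c T" for c d
    by (simp add: smul_def scal_simps distrib_right)
  show "(c - d) *\<^sub>c T = c *\<^sub>c T - d *\<^sub>c T" using 1[of "c - d" d] by simp
qed

lemma smul_cancel: "c \<noteq> 0 \<Longrightarrow> c *\<^sub>c S = c *\<^sub>c T \<Longrightarrow> S = T"
  by (metis left_inverse smul_simps(3,4))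

text \<open>A new first row \<open>a\<close> is added to rows \<open>b c\<close> that already satisfy the relations.\<close>

locale add_row =
  fixes q :: "'k::field" and n :: nat and a ai :: "nat \<Rightarrow> ('i, 'k) lop"
    and b :: "nat \<Rightarrow> nat \<Rightarrow> ('i, 'k) lop" and C :: "nat set"
  assumes q0: "q \<noteq> 0"
    and aa: "\<And>j l. j \<in> {1..n} \<Longrightarrow> l \<in> {1..n} \<Longrightarrow> a j * a l = a l * a j"
    and ai: "\<And>j. j \<in> {1..n} \<Longrightarrow> ai j * a j = 1" "\<And>j. j \<in> {1..n} \<Longrightarrow> a j * ai j = 1"
    and ba: "\<And>c k l. c \<in> C \<Longrightarrow> k \<in> {1..n} \<Longrightarrow> l \<in> {1..n} \<Longrightarrow> b c k * a l = (if k \<le> l then q else 1) *\<^sub>c (a l * b c k)"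
    and bb: "\<And>c k l. c \<in> C \<Longrightarrow> k \<in> {1..n} \<Longrightarrow> l \<in> {1..n} \<Longrightarrow> b c k * b c l = b c l * b c k"
    and bb_le: "\<And>c d k l. c \<in> C \<Longrightarrow> d \<in> C \<Longrightarrow> d < c \<Longrightarrow> k \<in> {1..n} \<Longrightarrow> l \<in> {1..n} \<Longrightarrow> k \<le> l \<Longrightarrow>
      b c k * b d l = q *\<^sub>c (b d l * b c k)"
    and bb_gt: "\<And>c d k l. c \<in> C \<Longrightarrow> d \<in> C \<Longrightarrow> d < c \<Longrightarrow> k \<in> {1..n} \<Longrightarrow> l \<in> {1..n} \<Longrightarrow> l < k \<Longrightarrow>
      b c k * b d l = b d l * b c k + (q - 1) *\<^sub>c (b d k * b c l)"
begin

lemma ai_a: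
  assumes jl: "j \<in> {1..n}" "l \<in> {1..n}"
  shows "ai j * a l = a l * ai j"
proof -
  have "ai j * a l = ai j * (a l * a j) * ai j" using jl by (simp add: mult.assoc ai)
  also have "\<dots> = ai j * a j * a l * ai j" using jl by (simp add: aa[of l j] mult.assoc)
  finally show ?thesis using jl by (simp add: ai)
qed

lemma ai_ai:
  assumes jl: "j \<in> {1..n}" "l \<in> {1..n}"
  shows "ai j * ai l = ai l * ai j"
proof -
  have "ai j * ai l = ai l * a l * ai j * ai l" using jl by (simp add: ai)
  also have "\<dots> = ai l * ai j * (a l * ai l)" using jl by (simp add: ai_a[of j l, symmetric] mult.assoc)
  finally show ?thesis using jl by (simp add: ai)
qed

text \<open>Inverting \<open>a l\<close> moves the factor to the other side of the equation, which
  avoids negative powers of \<open>q\<close> in what follows.\<close>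

lemma b_ai:
  assumes C: "c \<in> C" and jl: "k \<in> {1..n}" "l \<in> {1..n}"
  shows "(if k \<le> l then q else 1) *\<^sub>c (b c k * ai l) = ai l * b c k"
proof -
  have "ai l * b c k = ai l * (b c k * a l) * ai l" using jl by (simp add: mult.assoc ai)
  also have "\<dots> = (if k \<le> l then q else 1) *\<^sub>c ((ai l * a l) * b c k * ai l)"
    by (simp only: ba[OF assms] smul_mult mult.assoc)
  finally show ?thesis using jl by (simp add: ai)
qed

definition y :: "nat \<Rightarrow> nat \<Rightarrow> ('i, 'k) lop"
  where "y c k = ai k * b c k"

lemma yy: "c \<in> C \<Longrightarrow> k \<in> {1..n} \<Longrightarrow> l \<in> {1..n} \<Longrightarrow> (if k \<le> l then q else 1) *\<^sub>c (y c k * y d l) = ai k * ai l * (b c k * b d l)"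
proof -
  assume c: "c \<in> C" "k \<in> {1..n}" "l \<in> {1..n}"
  have "(if k \<le> l then q else 1) *\<^sub>c (y c k * y d l) =
      ai k * ((if k \<le> l then q else 1) *\<^sub>c (b c k * ai l)) * b d l"
    by (simp only: y_def smul_mult mult.assoc)
  then show ?thesis by (simp only: b_ai[OF c] mult.assoc)
qed

lemma y_a: "c \<in> C \<Longrightarrow> k \<in> {1..n} \<Longrightarrow> l \<in> {1..n} \<Longrightarrow> y c k * a l = (if k \<le> l then q else 1) *\<^sub>c (a l * y c k)"
proof -
  assume c: "c \<in> C" "k \<in> {1..n}" "l \<in> {1..n}"
  have "y c k * a l = (if k \<le> l then q else 1) *\<^sub>c (ai k * a l * b c k)"
    by (simp only: y_def mult.assoc ba[OF c] smul_mult)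
  then show ?thesis by (simp only: ai_a[OF c(2,3)] y_def mult.assoc)
qed

lemma yy_same: "c \<in> C \<Longrightarrow> k \<in> {1..n} \<Longrightarrow> l \<in> {1..n} \<Longrightarrow> k < l \<Longrightarrow> y c l * y c k = q *\<^sub>c (y c k * y c l)"
  using yy[of c l k c] yy[of c k l c] bb[of c l k] ai_ai[of l k] by (simp add: smul_simps)

lemma yy_less: "c \<in> C \<Longrightarrow> d \<in> C \<Longrightarrow> d < c \<Longrightarrow> k \<in> {1..n} \<Longrightarrow> l \<in> {1..n} \<Longrightarrow> k < l \<Longrightarrow> y c k * y d l = y d l * y c k"
  using yy[of c k l d] yy[of d l k c] bb_le[of c d k l] ai_ai[of l k] smul_cancel[OF q0]
  by (simp add: smul_simps smul_mult)

lemma yy_eq: "c \<in> C \<Longrightarrow> d \<in> C \<Longrightarrow> d < c \<Longrightarrow> k \<in> {1..n} \<Longrightarrow> y c k * y d k = q *\<^sub>c (y d k * y c k)"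
  using yy[of c k k d] yy[of d k k c] bb_le[of c d k k] smul_cancel[OF q0]
  by (simp add: smul_simps smul_mult)

lemma yy_greater: "c \<in> C \<Longrightarrow> d \<in> C \<Longrightarrow> d < c \<Longrightarrow> k \<in> {1..n} \<Longrightarrow> l \<in> {1..n} \<Longrightarrow> l < k \<Longrightarrow>
    y c k * y d l = q *\<^sub>c (y d l * y c k) + (q - 1) *\<^sub>c (y d k * y c l)"
  using yy[of c k l d] yy[of d l k c] yy[of d k l c] bb_gt[of c d k l] ai_ai[of l k]
  by (simp add: smul_simps smul_mult distrib_left)

definition Y :: "nat \<Rightarrow> nat \<Rightarrow> ('i, 'k) lop"
  where "Y c j = (\<Sum>k\<in>{1..j}. y c k)"

text \<open>The splitting at \<open>t\<close> separates columns that acquire a factor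
  \<open>q\<close> on passing \<open>a t\<close> from those that commute with it.\<close>

definition W :: "nat \<Rightarrow> nat \<Rightarrow> nat \<Rightarrow> ('i, 'k) lop"
  where "W c t j = (\<Sum>k\<in>{t<..j}. y c k)"

text \<open>The summand with \<open>k = j\<close> is \<open>b c j\<close> itself; the others,
  \<open>a j * ai k * b c k\<close> with \<open>k < j\<close>, restore the derivation terms that the
  affine relations lack.\<close>

definition Z :: "nat \<Rightarrow> nat \<Rightarrow> ('i, 'k) lop"
  where "Z c j = a j * Y c j"

lemma Y_split: "t \<le> j \<Longrightarrow> Y c j = Y c t + W c t j"
proof -
  assume "t \<le> j"
  then have "{1..j} = {1..t} \<union> {t<..j}" by auto
  then show ?thesis unfolding Y_def W_def by (simp add: sum.union_disjoint[symmetric] ivl_disj_int)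
qed

lemma Y_a: "c \<in> C \<Longrightarrow> t \<in> {1..n} \<Longrightarrow> j \<le> t \<Longrightarrow> Y c j * a t = q *\<^sub>c (a t * Y c j)"
  by (simp add: Y_def sum_distrib_left sum_distrib_right y_a smul_simps)

lemma W_a: "c \<in> C \<Longrightarrow> t \<in> {1..n} \<Longrightarrow> j \<le> n \<Longrightarrow> W c t j * a t = a t * W c t j"
  by (simp add: W_def sum_distrib_left sum_distrib_right y_a smul_simps)

lemma W_Y_same: "c \<in> C \<Longrightarrow> t \<le> n \<Longrightarrow> j \<le> n \<Longrightarrow> W c t j * Y c t = q *\<^sub>c (Y c t * W c t j)"
proof -
  assume c: "c \<in> C" and tj: "t \<le> n" "j \<le> n"
  have "W c t j * Y c t = (\<Sum>k\<in>{t<..j}. \<Sum>l\<in>{1..t}. q *\<^sub>c (y c l * y c k))"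
    unfolding W_def Y_def sum_product by (intro sum.cong refl yy_same c) (use tj in auto)
  also have "\<dots> = q *\<^sub>c (Y c t * W c t j)"
    unfolding W_def Y_def sum_product smul_simps by (rule sum.swap)
  finally show ?thesis .
qed

lemma Y_W: "c \<in> C \<Longrightarrow> d \<in> C \<Longrightarrow> d < c \<Longrightarrow> t \<le> n \<Longrightarrow> j \<le> n \<Longrightarrow> Y c t * W d t j = W d t j * Y c t"
proof -
  assume c: "c \<in> C" "d \<in> C" "d < c" and tj: "t \<le> n" "j \<le> n"
  have "Y c t * W d t j = (\<Sum>k\<in>{1..t}. \<Sum>l\<in>{t<..j}. y d l * y c k)"
    unfolding W_def Y_def sum_product by (intro sum.cong refl yy_less c) (use tj in auto)
  also have "\<dots> = W d t j * Y c t"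
    unfolding W_def Y_def sum_product by (rule sum.swap)
  finally show ?thesis .
qed

lemma W_Y: "c \<in> C \<Longrightarrow> d \<in> C \<Longrightarrow> d < c \<Longrightarrow> t \<le> n \<Longrightarrow> j \<le> n \<Longrightarrow>
    W c t j * Y d t = q *\<^sub>c (Y d t * W c t j) + (q - 1) *\<^sub>c (W d t j * Y c t)"
proof -
  assume c: "c \<in> C" "d \<in> C" "d < c" and tj: "t \<le> n" "j \<le> n"
  have "W c t j * Y d t = (\<Sum>k\<in>{t<..j}. \<Sum>l\<in>{1..t}. q *\<^sub>c (y d l * y c k) + (q - 1) *\<^sub>c (y d k * y c l))"
    unfolding W_def Y_def sum_product by (intro sum.cong refl yy_greater c) (use tj in auto)
  also have "\<dots> = (\<Sum>l\<in>{1..t}. \<Sum>k\<in>{t<..j}. q *\<^sub>c (y d l * y c k)) +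
      (\<Sum>k\<in>{t<..j}. \<Sum>l\<in>{1..t}. (q - 1) *\<^sub>c (y d k * y c l))"
    by (simp only: sum.distrib) (subst sum.swap, rule refl)
  finally show ?thesis unfolding W_def Y_def sum_product smul_simps .
qed

text \<open>When the sums are extended by one column, one mixed product contributes with factor 1 by
  \<open>Y_W\<close>, and \<open>W_Y\<close> supplies the same product once more with factor
  \<open>q - 1\<close>. Together they make up the missing \<open>q\<close>.\<close>

lemma Y_Y: "c \<in> C \<Longrightarrow> d \<in> C \<Longrightarrow> d < c \<Longrightarrow> j \<le> n \<Longrightarrow> Y c j * Y d j = q *\<^sub>c (Y d j * Y c j)"
proof (induction j)
  case 0
  then show ?case by (simp add: Y_def smul_simps)
next
  case (Suc j)
  have W1: "W e j (Suc j) = y e (Suc j)" for e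
  proof -
    have "{j<..Suc j} = {Suc j}" by auto
    then show ?thesis by (simp add: W_def)
  qed
  have Y1: "Y e (Suc j) = Y e j + y e (Suc j)" for e using Y_split[of j "Suc j" e] W1 by simp
  show ?case
    using Suc Y_W[of c d j "Suc j"] W_Y[of c d j "Suc j"] yy_eq[of c d "Suc j"]
    by (simp add: Y1 W1 distrib_left distrib_right smul_simps smul_left)
qed

lemma Z_a_le: "c \<in> C \<Longrightarrow> j \<in> {1..n} \<Longrightarrow> t \<in> {1..n} \<Longrightarrow> j \<le> t \<Longrightarrow> Z c j * a t = q *\<^sub>c (a t * Z c j)"
  by (simp add: Z_def mult.assoc Y_a smul_mult) (simp add: aa[of j t] flip: mult.assoc)

lemma Y_a_gt: "c \<in> C \<Longrightarrow> j \<in> {1..n} \<Longrightarrow> t \<in> {1..n} \<Longrightarrow> t \<le> j \<Longrightarrow> Y c j * a t = a t * (Y c j + (q - 1) *\<^sub>c Y c t)"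
  by (simp add: Y_split[of t j] distrib_left distrib_right right_diff_distrib Y_a W_a
      smul_mult smul_left smul_simps)

lemma Z_a_gt: "c \<in> C \<Longrightarrow> j \<in> {1..n} \<Longrightarrow> t \<in> {1..n} \<Longrightarrow> t < j \<Longrightarrow> Z c j * a t = a t * Z c j + (q - 1) *\<^sub>c (a j * Z c t)"
proof -
  assume c: "c \<in> C" "j \<in> {1..n}" "t \<in> {1..n}" "t < j"
  have "Z c j * a t = a j * a t * Y c j + (q - 1) *\<^sub>c (a j * a t * Y c t)"
    using c by (simp add: Z_def mult.assoc Y_a_gt distrib_left smul_mult)
  then show ?thesis using c by (simp add: Z_def aa[of j t] mult.assoc) (simp add: mult.assoc[symmetric] aa[of t j])
qed

text \<open>Moving both entries of the new row to the left leaves a relation between the partial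
  sums. Splitting the longer sum creates a term with factor \<open>q - 1\<close>, which is the very
  term that \<open>Y_a_gt\<close> absorbs when an entry is moved back. The same pattern serves for
  two different rows.\<close>

lemma Z_Z_same: "c \<in> C \<Longrightarrow> j \<in> {1..n} \<Longrightarrow> l \<in> {1..n} \<Longrightarrow> Z c j * Z c l = Z c l * Z c j"
proof -
  have "Z c j * Z c l = Z c l * Z c j" if c: "c \<in> C" "j \<in> {1..n}" "l \<in> {1..n}" "j < l" for j l
  proof -
    have "Z c j * Z c l = a j * (Y c j * a l) * Y c l" by (simp add: Z_def mult.assoc)
    also have "\<dots> = a j * a l * (q *\<^sub>c (Y c j * Y c l))"
      using c by (simp add: Y_a smul_mult mult.assoc)
    also have "q *\<^sub>c (Y c j * Y c l) = (Y c l + (q - 1) *\<^sub>c Y c j) * Y c j"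
      using c by (simp add: Y_split[of j l] distrib_left distrib_right W_Y_same smul_mult smul_simps smul_left)
    also have "a j * a l * ((Y c l + (q - 1) *\<^sub>c Y c j) * Y c j) = a l * (Y c l * a j) * Y c j"
      using c by (simp add: Y_a_gt aa[of j l] mult.assoc)
    finally show ?thesis by (simp add: Z_def mult.assoc)
  qed
  then show "c \<in> C \<Longrightarrow> j \<in> {1..n} \<Longrightarrow> l \<in> {1..n} \<Longrightarrow> Z c j * Z c l = Z c l * Z c j" by (metis linorder_neqE_nat)
qed

lemma Z_Z_le:
  assumes c: "c \<in> C" "d \<in> C" "d < c" and jt: "j \<in> {1..n}" "t \<in> {1..n}" "j \<le> t"
  shows "Z c j * Z d t = q *\<^sub>c (Z d t * Z c j)"
proof -
  have "Z c j * Z d t = a j * (Y c j * a t) * Y d t" by (simp add: Z_def mult.assoc)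
  also have "\<dots> = q *\<^sub>c (a j * a t * (Y c j * Y d t))"
    using c jt by (simp add: Y_a smul_mult mult.assoc)
  also have "Y c j * Y d t = (Y d t + (q - 1) *\<^sub>c Y d j) * Y c j"
    using c jt by (simp add: Y_split[of j t] distrib_left distrib_right left_diff_distrib Y_W Y_Y
        smul_mult smul_left smul_simps)
  also have "a j * a t * ((Y d t + (q - 1) *\<^sub>c Y d j) * Y c j) = a t * (Y d t * a j) * Y c j"
    using c jt by (simp add: Y_a_gt aa[of j t] mult.assoc)
  finally show ?thesis by (simp add: Z_def mult.assoc)
qed

lemma Z_Z_gt:
  assumes c: "c \<in> C" "d \<in> C" "d < c" and tj: "j \<in> {1..n}" "t \<in> {1..n}" "t < j"
  shows "Z c j * Z d t = Z d t * Z c j + (q - 1) *\<^sub>c (Z d j * Z c t)"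
proof -
  have "Z c j * Z d t = a j * (Y c j * a t) * Y d t" by (simp add: Z_def mult.assoc)
  also have "\<dots> = a j * a t * ((Y c j + (q - 1) *\<^sub>c Y c t) * Y d t)"
    using c tj by (simp add: Y_a_gt mult.assoc)
  also have "(Y c j + (q - 1) *\<^sub>c Y c t) * Y d t =
      q *\<^sub>c (Y d t * Y c j) + (q - 1) *\<^sub>c ((Y d j + (q - 1) *\<^sub>c Y d t) * Y c t)"
    using c tj by (simp add: Y_split[of t j] distrib_left distrib_right W_Y Y_Y smul_mult smul_left smul_simps algebra_simps)
  also have "a j * a t * (q *\<^sub>c (Y d t * Y c j) + (q - 1) *\<^sub>c ((Y d j + (q - 1) *\<^sub>c Y d t) * Y c t)) =
     a t * (q *\<^sub>c (a j * Y d t)) * Y c j + (q - 1) *\<^sub>c (a j * (a t * (Y d j + (q - 1) *\<^sub>c Y d t)) * Y c t)"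
  proof -
    have "a j * (a t * x) = a t * (a j * x)" for x using tj by (simp add: aa[of j t] flip: mult.assoc)
    then show ?thesis by (simp only: distrib_left distrib_right smul_mult mult.assoc)
  qed
  also have "q *\<^sub>c (a j * Y d t) = Y d t * a j" using c tj by (simp add: Y_a)
  also have "a t * (Y d j + (q - 1) *\<^sub>c Y d t) = Y d j * a t" using c tj by (simp add: Y_a_gt)
  finally show ?thesis by (simp add: Z_def mult.assoc)
qed

end

text \<open>Adding the rows one by one, from the last to the first, expresses generators of the quantum matrix
  algebra through an invertible array \<open>X\<close> satisfying the relations of the quantum affine space.\<close>

fun matrix_op :: "(nat \<Rightarrow> nat \<Rightarrow> ('i, 'k::field) lop) \<Rightarrow> (nat \<Rightarrow> nat \<Rightarrow> ('i, 'k) lop) \<Rightarrow>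
    nat \<Rightarrow> nat \<Rightarrow> nat \<Rightarrow> ('i, 'k) lop"
  where "matrix_op X Xi 0 i j = X i j"
  | "matrix_op X Xi (Suc d) i j =
      X (i - Suc d) j * (\<Sum>k\<in>{1..j}. Xi (i - Suc d) k * matrix_op X Xi d i k)"

locale affine_array =
  fixes q :: "'k::field" and n :: nat and X Xi :: "nat \<Rightarrow> nat \<Rightarrow> ('i, 'k) lop"
  assumes q0: "q \<noteq> 0"
    and X_row: "\<And>r j l. r \<in> {1..n} \<Longrightarrow> j \<in> {1..n} \<Longrightarrow> l \<in> {1..n} \<Longrightarrow> X r j * X r l = X r l * X r j"
    and X_inv: "\<And>r j. r \<in> {1..n} \<Longrightarrow> j \<in> {1..n} \<Longrightarrow> Xi r j * X r j = 1"
      "\<And>r j. r \<in> {1..n} \<Longrightarrow> j \<in> {1..n} \<Longrightarrow> X r j * Xi r j = 1"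
    and X_less: "\<And>r s j l. r \<in> {1..n} \<Longrightarrow> s \<in> {1..n} \<Longrightarrow> s < r \<Longrightarrow> j \<in> {1..n} \<Longrightarrow> l \<in> {1..n} \<Longrightarrow>
      X r j * X s l = (if j \<le> l then q else 1) *\<^sub>c (X s l * X r j)"
begin

abbreviation M :: "nat \<Rightarrow> nat \<Rightarrow> nat \<Rightarrow> ('i, 'k) lop"
  where "M \<equiv> matrix_op X Xi"

lemma Xi_less:
  assumes "r \<in> {1..n}" "s \<in> {1..n}" "s < r" "j \<in> {1..n}" "l \<in> {1..n}"
  shows "(if j \<le> l then q else 1) *\<^sub>c (Xi r j * X s l) = X s l * Xi r j"
proof -
  have "X s l * Xi r j = Xi r j * (X r j * X s l) * Xi r j"
    using assms by (simp add: X_inv flip: mult.assoc)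
  also have "\<dots> = (if j \<le> l then q else 1) *\<^sub>c (Xi r j * X s l * (X r j * Xi r j))"
    by (simp only: X_less[OF assms] smul_mult mult.assoc)
  finally show ?thesis using assms by (simp add: X_inv)
qed

text \<open>Adding row \<open>?r\<close> does not disturb the commutation with a row
  \<open>s\<close> above it: each product \<open>Xi ?r h * M d i h\<close> commutes with
  \<open>X s l\<close>, the two factors cancelling, and the prefactor \<open>X ?r k\<close> restores
  the rule that held before.\<close>

lemma M_X:
  assumes "s \<in> {1..n}" "i \<in> {1..n}" "s < i - d" "l \<in> {1..n}" "k \<in> {1..n}"
  shows "M d i k * X s l = (if k \<le> l then q else 1) *\<^sub>c (X s l * M d i k)"
  using assms
proof (induction d arbitrary: k)
  case 0
  then show ?case by (simp add: X_less)
next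
  case (Suc d)
  let ?r = "i - Suc d"
  have r: "?r \<in> {1..n}" "s < ?r" "s < i - d" using Suc.prems by auto
  have t: "Xi ?r h * M d i h * X s l = X s l * (Xi ?r h * M d i h)" if h: "h \<in> {1..k}" for h
  proof -
    have h': "h \<in> {1..n}" using h Suc.prems by auto
    have "Xi ?r h * M d i h * X s l = ((if h \<le> l then q else 1) *\<^sub>c (Xi ?r h * X s l)) * M d i h"
      using Suc.IH[OF Suc.prems(1,2) r(3) Suc.prems(4) h'] by (simp add: mult.assoc smul_mult)
    then show ?thesis
      using Xi_less[OF r(1) Suc.prems(1) r(2) h' Suc.prems(4)] by (simp add: mult.assoc)
  qed
  have "M (Suc d) i k * X s l = X ?r k * (\<Sum>h\<in>{1..k}. Xi ?r h * M d i h * X s l)"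
    by (simp add: mult.assoc sum_distrib_right)
  also have "\<dots> = X ?r k * X s l * (\<Sum>h\<in>{1..k}. Xi ?r h * M d i h)"
    using t by (simp add: mult.assoc flip: sum_distrib_left)
  also have "X ?r k * X s l = (if k \<le> l then q else 1) *\<^sub>c (X s l * X ?r k)"
    by (rule X_less[OF r(1) Suc.prems(1) r(2) Suc.prems(5,4)])
  finally show ?case by (simp add: smul_mult mult.assoc)
qed

text \<open>The state after rows \<open>Suc r\<close> to \<open>n\<close> have been processed: to
  row \<open>c\<close> the rows from \<open>c - 1\<close> up to \<open>Suc r\<close> have been
  added, which are \<open>c - Suc r\<close> in number. These rows alone form a quantum
  matrix.\<close>

definition relations_from :: "nat \<Rightarrow> bool"
  where "relations_from r \<longleftrightarrow> (\<forall>c\<in>{r<..n}. \<forall>k\<in>{1..n}. \<forall>l\<in>{1..n}.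
      M (c - Suc r) c k * M (c - Suc r) c l = M (c - Suc r) c l * M (c - Suc r) c k \<and>
      (\<forall>d\<in>{r<..<c}. (k \<le> l \<longrightarrow>
        M (c - Suc r) c k * M (d - Suc r) d l = q *\<^sub>c (M (d - Suc r) d l * M (c - Suc r) c k)) \<and>
       (l < k \<longrightarrow> M (c - Suc r) c k * M (d - Suc r) d l = M (d - Suc r) d l * M (c - Suc r) c k +
        (q - 1) *\<^sub>c (M (d - Suc r) d k * M (c - Suc r) c l))))"

lemma relations_from_step:
  assumes er: "Suc r \<le> n" and IH: "relations_from (Suc r)"
  shows "relations_from r"
proof -
  let ?r = "Suc r"
  interpret A: add_row q n "X ?r" "Xi ?r" "\<lambda>c. M (c - Suc ?r) c" "{?r<..n}"
  proof
    show "M (c - Suc ?r) c k * X ?r l = (if k \<le> l then q else 1) *\<^sub>c (X ?r l * M (c - Suc ?r) c k)"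
      if "c \<in> {?r<..n}" "k \<in> {1..n}" "l \<in> {1..n}" for c k l
      by (rule M_X) (use that in auto)
    show "M (c - Suc ?r) c k * M (c - Suc ?r) c l = M (c - Suc ?r) c l * M (c - Suc ?r) c k"
      if "c \<in> {?r<..n}" "k \<in> {1..n}" "l \<in> {1..n}" for c k l
      using IH that unfolding relations_from_def by blast
    show "M (c - Suc ?r) c k * M (d - Suc ?r) d l = q *\<^sub>c (M (d - Suc ?r) d l * M (c - Suc ?r) c k)"
      if "c \<in> {?r<..n}" "d \<in> {?r<..n}" "d < c" "k \<in> {1..n}" "l \<in> {1..n}" "k \<le> l" for c d k l
    proof -
      have "d \<in> {?r<..<c}" using that by auto
      then show ?thesis using IH that unfolding relations_from_def by blast
    qed
    show "M (c - Suc ?r) c k * M (d - Suc ?r) d l = M (d - Suc ?r) d l * M (c - Suc ?r) c k +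
        (q - 1) *\<^sub>c (M (d - Suc ?r) d k * M (c - Suc ?r) c l)"
      if "c \<in> {?r<..n}" "d \<in> {?r<..n}" "d < c" "k \<in> {1..n}" "l \<in> {1..n}" "l < k" for c d k l
    proof -
      have "d \<in> {?r<..<c}" using that by auto
      then show ?thesis using IH that unfolding relations_from_def by blast
    qed
  qed (use q0 X_row X_inv er in auto)
  have MZ: "M (c - ?r) c k = A.Z c k" if "c \<in> {?r<..n}" for c k
  proof -
    have "c - ?r = Suc (c - Suc ?r)" "c - Suc (c - Suc ?r) = ?r" using that by auto
    then show ?thesis by (simp only: matrix_op.simps A.Z_def A.Y_def A.y_def)
  qed
  have Mr: "M (?r - ?r) ?r k = X ?r k" for k by simp
  show ?thesis
    unfolding relations_from_def
  proof (intro ballI conjI impI)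
    fix c k l assume c: "c \<in> {r<..n}" and kl: "k \<in> {1..n}" "l \<in> {1..n}"
    show "M (c - ?r) c k * M (c - ?r) c l = M (c - ?r) c l * M (c - ?r) c k"
    proof (cases "c = ?r")
      case True
      then show ?thesis using X_row[of ?r k l] er kl by simp
    next
      case False
      then have "c \<in> {?r<..n}" using c by auto
      then show ?thesis using kl by (simp only: MZ A.Z_Z_same)
    qed
    fix d assume d: "d \<in> {r<..<c}"
    then have c': "c \<in> {?r<..n}" using c by auto
    show "M (c - ?r) c k * M (d - ?r) d l = q *\<^sub>c (M (d - ?r) d l * M (c - ?r) c k)" if "k \<le> l"
    proof (cases "d = ?r")
      case True
      show ?thesis unfolding True Mr MZ[OF c'] by (rule A.Z_a_le) (use c' kl that in auto)
    next
      case False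
      then have d': "d \<in> {?r<..n}" using d c by auto
      show ?thesis unfolding MZ[OF c'] MZ[OF d'] by (rule A.Z_Z_le) (use c' d d' kl that in auto)
    qed
    show "M (c - ?r) c k * M (d - ?r) d l = M (d - ?r) d l * M (c - ?r) c k +
        (q - 1) *\<^sub>c (M (d - ?r) d k * M (c - ?r) c l)" if "l < k"
    proof (cases "d = ?r")
      case True
      show ?thesis unfolding True Mr MZ[OF c'] by (rule A.Z_a_gt) (use c' kl that in auto)
    next
      case False
      then have d': "d \<in> {?r<..n}" using d c by auto
      show ?thesis unfolding MZ[OF c'] MZ[OF d'] by (rule A.Z_Z_gt) (use c' d d' kl that in auto)
    qed
  qed
qed

lemma relations_from_0: "relations_from 0"
proof -
  have "relations_from (n - e)" for e
  proof (induction e)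
    case 0
    show ?case by (simp add: relations_from_def)
  next
    case (Suc e)
    show ?case
    proof (cases "e < n")
      case True
      then have "n - e = Suc (n - Suc e)" by simp
      then show ?thesis using Suc relations_from_step[of "n - Suc e"] True by simp
    qed (use Suc in simp)
  qed
  from this[of n] show ?thesis by simp
qed

lemma matrix_op_relations:
  assumes "i \<in> {1..n}" "j \<in> {1..n}" "t \<in> {1..n}"
  shows "M (i - 1) i j * M (i - 1) i t = M (i - 1) i t * M (i - 1) i j"
    and "s \<in> {1..<i} \<Longrightarrow> j \<le> t \<Longrightarrow> M (i - 1) i j * M (s - 1) s t = q *\<^sub>c (M (s - 1) s t * M (i - 1) i j)"
    and "s \<in> {1..<i} \<Longrightarrow> t < j \<Longrightarrow> M (i - 1) i j * M (s - 1) s t = M (s - 1) s t * M (i - 1) i j +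
      (q - 1) *\<^sub>c (M (s - 1) s j * M (i - 1) i t)"
proof -
  note rel = relations_from_0[unfolded relations_from_def One_nat_def[symmetric], rule_format, of i j t]
  have i: "i \<in> {0<..n}" using assms by auto
  show "M (i - 1) i j * M (i - 1) i t = M (i - 1) i t * M (i - 1) i j"
    using rel[OF i assms(2,3)] by blast
  have s: "s \<in> {1..<i} \<Longrightarrow> s \<in> {0<..<i}" by auto
  show "s \<in> {1..<i} \<Longrightarrow> j \<le> t \<Longrightarrow> M (i - 1) i j * M (s - 1) s t = q *\<^sub>c (M (s - 1) s t * M (i - 1) i j)"
    using rel[OF i assms(2,3)] s by blast
  show "s \<in> {1..<i} \<Longrightarrow> t < j \<Longrightarrow> M (i - 1) i j * M (s - 1) s t = M (s - 1) s t * M (i - 1) i j +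
      (q - 1) *\<^sub>c (M (s - 1) s j * M (i - 1) i t)"
    using rel[OF i assms(2,3)] s by blast
qed

end

section \<open>Straightening\<close>

lemma genideal_free_algebra:
  assumes R: "R \<subseteq> carrier (free_algebra X)"
  shows "Idl\<^bsub>free_algebra X\<^esub> R \<subseteq> carrier (free_algebra X)"
    "p \<in> R \<Longrightarrow> p \<in> Idl\<^bsub>free_algebra X\<^esub> R"
    "0 \<in> Idl\<^bsub>free_algebra X\<^esub> R"
    "p \<in> Idl\<^bsub>free_algebra X\<^esub> R \<Longrightarrow> r \<in> Idl\<^bsub>free_algebra X\<^esub> R \<Longrightarrow> p + r \<in> Idl\<^bsub>free_algebra X\<^esub> R"
    "p \<in> Idl\<^bsub>free_algebra X\<^esub> R \<Longrightarrow> x \<in> carrier (free_algebra X) \<Longrightarrow> x * p \<in> Idl\<^bsub>free_algebra X\<^esub> R"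
    "p \<in> Idl\<^bsub>free_algebra X\<^esub> R \<Longrightarrow> x \<in> carrier (free_algebra X) \<Longrightarrow> p * x \<in> Idl\<^bsub>free_algebra X\<^esub> R"
proof -
  interpret F: ring "free_algebra X" by (rule ring_free_algebra)
  interpret J: ideal "Idl\<^bsub>free_algebra X\<^esub> R" "free_algebra X" by (rule F.genideal_ideal[OF R])
  show "Idl\<^bsub>free_algebra X\<^esub> R \<subseteq> carrier (free_algebra X)" by (rule J.a_subset)
  show "p \<in> R \<Longrightarrow> p \<in> Idl\<^bsub>free_algebra X\<^esub> R" using F.genideal_self[OF R] by blast
  show "0 \<in> Idl\<^bsub>free_algebra X\<^esub> R" using J.zero_closed by (simp add: free_algebra_sel)
  show "p \<in> Idl\<^bsub>free_algebra X\<^esub> R \<Longrightarrow> r \<in> Idl\<^bsub>free_algebra X\<^esub> R \<Longrightarrow> p + r \<in> Idl\<^bsub>free_algebra X\<^esub> R"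
    using J.a_closed[of p r] by (simp add: free_algebra_sel)
  show "p \<in> Idl\<^bsub>free_algebra X\<^esub> R \<Longrightarrow> x \<in> carrier (free_algebra X) \<Longrightarrow> x * p \<in> Idl\<^bsub>free_algebra X\<^esub> R"
    using J.I_l_closed[of p x] by (simp add: free_algebra_sel)
  show "p \<in> Idl\<^bsub>free_algebra X\<^esub> R \<Longrightarrow> x \<in> carrier (free_algebra X) \<Longrightarrow> p * x \<in> Idl\<^bsub>free_algebra X\<^esub> R"
    using J.I_r_closed[of p x] by (simp add: free_algebra_sel)
qed

lemma nc_subst_genideal:
  assumes s: "central_hom s" and R: "R \<subseteq> carrier (free_algebra X)"
    and kill: "\<And>r. r \<in> R \<Longrightarrow> nc_subst s u r = 0" and p: "p \<in> Idl\<^bsub>free_algebra X\<^esub> R"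
  shows "nc_subst s u p = 0"
proof -
  let ?F = "free_algebra X" and ?K = "{p \<in> carrier (free_algebra X). nc_subst s u p = 0}"
  interpret F: ring ?F by (rule ring_free_algebra)
  have "ideal ?K ?F"
  proof (rule idealI[OF ring_free_algebra])
    show "subgroup ?K (add_monoid ?F)"
    proof (rule F.add.subgroupI)
      show "?K \<noteq> {}" using F.zero_closed nc_subst_0[OF s, of u] by (auto simp: free_algebra_sel)
    next
      fix a assume "a \<in> ?K"
      then show "\<ominus>\<^bsub>?F\<^esub> a \<in> ?K"
        by (simp add: free_algebra_a_inv free_algebra_minus_closed nc_subst_minus[OF s])
    qed (auto simp: free_algebra_sel nc_subst_add[OF s] intro: free_algebra_carrierI(4))
  qed (auto simp: free_algebra_sel nc_subst_mult[OF s] intro: free_algebra_carrierI(3))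
  then have "Idl\<^bsub>?F\<^esub> R \<subseteq> ?K" by (rule F.genideal_minimal) (use R kill in auto)
  then show ?thesis using p by blast
qed

text \<open>A measure of disorder: each letter counts once for every letter behind it, so moving a
  large letter to the right lowers the total.\<close>

fun position_weight :: "('v \<Rightarrow> nat) \<Rightarrow> 'v list \<Rightarrow> nat"
  where "position_weight f [] = 0"
  | "position_weight f (a # l) = f a * length l + position_weight f l"

lemma position_weight_append:
  "position_weight f (u @ l) = position_weight f u + sum_list (map f u) * length l + position_weight f l"
  by (induction u) (simp_all add: algebra_simps)

lemma position_weight_swap:
  assumes "f a' = f b" "f b' = f a"
  shows "f b < f a \<Longrightarrow> position_weight f (u @ a' # b' # v) < position_weight f (u @ a # b # v)"
    "f b = f a \<Longrightarrow> position_weight f (u @ a' # b' # v) = position_weight f (u @ a # b # v)"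
  using assms by (simp_all add: position_weight_append algebra_simps)

lemma not_sorted_descent:
  "\<not> sorted (map f l) \<Longrightarrow> \<exists>u a b v. l = u @ a # b # v \<and> f b < (f a :: nat)"
proof (induction l)
  case (Cons x l)
  show ?case
  proof (cases "sorted (map f l)")
    case False
    then obtain u a b v where "l = u @ a # b # v" "f b < f a" using Cons.IH by blast
    then have "x # l = (x # u) @ a # b # v \<and> f b < f a" by simp
    then show ?thesis by blast
  next
    case True
    then obtain y l' where l: "l = y # l'" using Cons.prems by (cases l) auto
    have "\<not> f x \<le> f y"
      using Cons.prems True unfolding l list.map sorted2 by blast
    then have "x # l = [] @ x # y # l' \<and> f y < f x" by (simp add: l)
    then show ?thesis by blast
  qed
qed simp

definition cell_code :: "nat \<Rightarrow> nat \<times> nat \<Rightarrow> nat"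
  where "cell_code n p = fst p * (n + 1) + snd p"

lemma cell_code_less:
  assumes "p \<in> grid n" "r \<in> grid n"
  shows "cell_code n p < cell_code n r \<longleftrightarrow> fst p < fst r \<or> fst p = fst r \<and> snd p < snd r"
proof -
  have b: "snd p < n + 1" "snd r < n + 1" using assms by (auto simp: grid_def)
  have lt: "a * (n + 1) + c < b * (n + 1) + d" if "a < b" "c < n + 1" for a b c d :: nat
  proof -
    have "a * (n + 1) + c < (a + 1) * (n + 1)" using that by simp
    also have "\<dots> \<le> b * (n + 1)" using that by (intro mult_right_mono) auto
    finally show ?thesis by simp
  qed
  show ?thesis
    unfolding cell_code_def
    using lt[of "fst p" "fst r" "snd p" "snd r"] lt[of "fst r" "fst p" "snd r" "snd p"] b
    by (cases "fst p" "fst r" rule: linorder_cases) auto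
qed

lemma inj_on_cell_code: "inj_on (cell_code n) (grid n)"
proof (rule inj_onI)
  fix p r assume pr: "p \<in> grid n" "r \<in> grid n" "cell_code n p = cell_code n r"
  then show "p = r"
    using cell_code_less[OF pr(1,2)] cell_code_less[OF pr(2,1)]
    by (cases "fst p" "fst r" rule: linorder_cases; cases "snd p" "snd r" rule: linorder_cases)
       (auto simp: prod_eq_iff)
qed

lemma cell_code_bound: "p \<in> grid n \<Longrightarrow> cell_code n p < (n + 1) * (n + 1)"
proof -
  assume "p \<in> grid n"
  then have "fst p \<le> n" "snd p \<le> n" by (auto simp: grid_def)
  moreover from this have "fst p * (n + 1) \<le> n * (n + 1)" by (intro mult_right_mono) auto
  ultimately show ?thesis by (simp add: cell_code_def)
qed

definition sorted_polys :: "nat \<Rightarrow> (nat \<times> nat, 'k::ring_1) ncpoly set"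
  where "sorted_polys n = {p. \<forall>w\<in>Poly_Mapping.keys p. set (letters w) \<subseteq> grid n \<and>
    sorted (map (cell_code n) (letters w))}"

lemma sorted_polys_add: "p \<in> sorted_polys n \<Longrightarrow> r \<in> sorted_polys n \<Longrightarrow> p + r \<in> sorted_polys n"
  using Poly_Mapping.keys_add[of p r] unfolding sorted_polys_def by blast

lemma sorted_polys_scale: "p \<in> sorted_polys n \<Longrightarrow> ncconst c * p \<in> sorted_polys n"
  using keys_mult[of "ncconst c" p] unfolding sorted_polys_def ncconst_def
  by (force split: if_splits)

text \<open>The word \<open>a' b'\<close> in the correction term is as disordered in the columns as
  its predecessor may be, but its rows are exchanged. Comparing row weights before column weights
  makes both resulting words smaller. Only spanning by sorted words is shown here; their
  independence comes from the leading terms.\<close>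

lemma straighten:
  fixes R :: "(nat \<times> nat, 'k::field) ncpoly set"
  assumes R: "R \<subseteq> carrier (free_algebra (grid n))"
    and rel: "\<And>a b. a \<in> grid n \<Longrightarrow> b \<in> grid n \<Longrightarrow> cell_code n b < cell_code n a \<Longrightarrow>
      \<exists>c c' a' b'. a' \<in> grid n \<and> b' \<in> grid n \<and>
        (fst a' = fst b \<and> fst b' = fst a \<and> fst b < fst a \<or> a' = b \<and> b' = a) \<and>
        ncvar a * ncvar b - (ncconst c * (ncvar b * ncvar a) + ncconst c' * (ncvar a' * ncvar b')) \<in> R"
    and p: "p \<in> carrier (free_algebra (grid n))"
  shows "\<exists>p'\<in>sorted_polys n. p - p' \<in> Idl\<^bsub>free_algebra (grid n)\<^esub> R"
proof -
  let ?F = "free_algebra (grid n)" and ?J = "Idl\<^bsub>free_algebra (grid n)\<^esub> R"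
  note J = genideal_free_algebra[OF R]
  let ?w = "\<lambda>l. prod_list (map ncvar l) :: (nat \<times> nat, 'k) ncpoly"
  have wc: "?w l \<in> carrier ?F" if "set l \<subseteq> grid n" for l
    using that by (intro prod_list_carrier free_algebra_carrierI) auto
  have scale: "ncconst c * x \<in> ?J" if "x \<in> ?J" for c x
    by (rule J(5)[OF that free_algebra_carrierI(2)])
  have words: "\<exists>p'\<in>sorted_polys n. ?w l - p' \<in> ?J" if "set l \<subseteq> grid n" for l
    using that
  proof (induction l rule: wf_induct[OF wf_measures[of "[position_weight fst, position_weight snd]"]])
    case (1 l)
    show ?case
    proof (cases "sorted (map (cell_code n) l)")
      case True
      then have "?w l \<in> sorted_polys n" using 1 by (simp add: prod_list_ncvar sorted_polys_def)
      then show ?thesis using J(3) by (intro bexI[of _ "?w l"]) simp_all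
    next
      case False
      then obtain u a b v where l: "l = u @ a # b # v" and ab: "cell_code n b < cell_code n a"
        using not_sorted_descent by blast
      have g: "a \<in> grid n" "b \<in> grid n" "set u \<subseteq> grid n" "set v \<subseteq> grid n" using 1 l by auto
      obtain c c' a' b' where r: "a' \<in> grid n" "b' \<in> grid n"
        "fst a' = fst b \<and> fst b' = fst a \<and> fst b < fst a \<or> a' = b \<and> b' = a"
        "ncvar a * ncvar b - (ncconst c * (ncvar b * ncvar a) + ncconst c' * (ncvar a' * ncvar b')) \<in> R"
        using rel[OF g(1,2) ab] by blast
      let ?l1 = "u @ b # a # v" and ?l2 = "u @ a' # b' # v"
      have lt: "fst b < fst a \<or> fst b = fst a \<and> snd b < snd a"
        using ab cell_code_less[OF g(2,1)] by simp
      have m1: "(?l1, l) \<in> measures [position_weight fst, position_weight snd]"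
        using lt position_weight_swap[of fst b b a a u v] position_weight_swap[of snd b b a a u v]
        by (auto simp: l)
      have m2: "(?l2, l) \<in> measures [position_weight fst, position_weight snd]"
        using r(3)
      proof
        assume "fst a' = fst b \<and> fst b' = fst a \<and> fst b < fst a"
        then show ?thesis using position_weight_swap(1)[of fst a' b b' a u v] by (simp add: l)
      next
        assume "a' = b \<and> b' = a" then show ?thesis using m1 by simp
      qed
      have s: "set ?l1 \<subseteq> grid n" "set ?l2 \<subseteq> grid n" using g r by auto
      obtain p1 where p1: "p1 \<in> sorted_polys n" "?w ?l1 - p1 \<in> ?J" using 1(1) m1 s by blast
      obtain p2 where p2: "p2 \<in> sorted_polys n" "?w ?l2 - p2 \<in> ?J" using 1(1) m2 s by blast
      have "?w u * (ncvar a * ncvar b - (ncconst c * (ncvar b * ncvar a) + ncconst c' * (ncvar a' * ncvar b'))) * ?w v \<in> ?J"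
        by (intro J(5,6) J(2)[OF r(4)] wc g)
      also have "?w u * (ncvar a * ncvar b - (ncconst c * (ncvar b * ncvar a) + ncconst c' * (ncvar a' * ncvar b'))) * ?w v
          = ?w l - (?w u * ncconst c * (ncvar b * (ncvar a * ?w v)) + ?w u * ncconst c' * (ncvar a' * (ncvar b' * ?w v)))"
        by (simp add: l algebra_simps)
      also have "\<dots> = ?w l - (ncconst c * ?w ?l1 + ncconst c' * ?w ?l2)"
        by (simp only: ncconst_commute[symmetric] map_append prod_list.append list.map prod_list.Cons mult.assoc)
      finally have "?w l - (ncconst c * ?w ?l1 + ncconst c' * ?w ?l2) + ncconst c * (?w ?l1 - p1) + ncconst c' * (?w ?l2 - p2) \<in> ?J"
        by (intro J(4) scale p1 p2)
      also have "?w l - (ncconst c * ?w ?l1 + ncconst c' * ?w ?l2) + ncconst c * (?w ?l1 - p1) + ncconst c' * (?w ?l2 - p2)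
          = ?w l - (ncconst c * p1 + ncconst c' * p2)"
        by (simp only: right_diff_distrib) (simp only: algebra_simps)
      finally show ?thesis
        by (intro bexI[of _ "ncconst c * p1 + ncconst c' * p2"] sorted_polys_add sorted_polys_scale p1 p2)
    qed
  qed
  have keys: "set (letters w) \<subseteq> grid n" if "w \<in> Poly_Mapping.keys p" for w
    using p that by (simp add: free_algebra_def)
  have "\<exists>p'\<in>sorted_polys n. (\<Sum>w\<in>T. ncconst (Poly_Mapping.lookup p w) * ?w (letters w)) - p' \<in> ?J"
    if "finite T" "T \<subseteq> Poly_Mapping.keys p" for T
    using that
  proof (induction T)
    case empty
    then show ?case using J(3) by (intro bexI[of _ 0]) (simp_all add: sorted_polys_def)
  next
    case (insert w T)
    then obtain p1 where p1: "p1 \<in> sorted_polys n"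
      "(\<Sum>w\<in>T. ncconst (Poly_Mapping.lookup p w) * ?w (letters w)) - p1 \<in> ?J" by auto
    obtain p2 where p2: "p2 \<in> sorted_polys n" "?w (letters w) - p2 \<in> ?J"
      using words[OF keys, of w] insert by auto
    let ?c = "ncconst (Poly_Mapping.lookup p w)"
    have "?c * (?w (letters w) - p2) + ((\<Sum>w\<in>T. ncconst (Poly_Mapping.lookup p w) * ?w (letters w)) - p1) \<in> ?J"
      by (intro J(4) scale p1 p2)
    then show ?case
      using insert by (intro bexI[of _ "?c * p2 + p1"] sorted_polys_add sorted_polys_scale p1 p2)
        (simp add: right_diff_distrib add_diff_add)
  qed
  from this[of "Poly_Mapping.keys p"] show ?thesis using ncpoly_sum_words[of p] by simp
qed

section \<open>Recovering a sorted word from its weight\<close>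

lemma digits_unique:
  fixes a b :: "nat \<Rightarrow> nat"
  assumes "\<And>x. a x < B" "\<And>x. b x < B" "(\<Sum>x<N. a x * B ^ x) = (\<Sum>x<N. b x * B ^ x)"
  shows "\<forall>x<N. a x = b x"
  using assms(3)
proof (induction N)
  case (Suc N)
  have bound: "(\<Sum>x<N. f x * B ^ x) < B ^ N" if "\<And>x. f x < B" for f :: "nat \<Rightarrow> nat" and N
  proof (induction N)
    case (Suc N)
    have "(\<Sum>x<Suc N. f x * B ^ x) < B ^ N + f N * B ^ N" using Suc by simp
    also have "\<dots> = (f N + 1) * B ^ N" by simp
    also have "\<dots> \<le> B * B ^ N" using that[of N] by (intro mult_right_mono) auto
    finally show ?case by simp
  qed simp
  have B: "B > 0" using assms(1)[of 0] by simp
  have top: "(\<Sum>x<Suc N. f x * B ^ x) div B ^ N = f N" if "\<And>x. f x < B" for f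
    using bound[of f N, OF that] B by simp
  have "a N = b N" using top[of a] top[of b] assms(1,2) Suc.prems by simp
  then show ?case using Suc by (auto simp: less_Suc_eq)
qed simp

text \<open>In base \<open>B\<close> the digits of the weight are the multiplicities of the cells;
  these stay below \<open>B\<close> because the words are shorter than \<open>B\<close>. A sorted
  word is determined by its multiplicities.\<close>

lemma sorted_words_eq:
  assumes "sorted (map (cell_code n) l)" "sorted (map (cell_code n) l')"
    "set l \<subseteq> grid n" "set l' \<subseteq> grid n" "length l < B" "length l' < B"
    "sum_list (map (\<lambda>p. B ^ cell_code n p) l) = sum_list (map (\<lambda>p. B ^ cell_code n p) l')"
  shows "l = l'"
proof -
  let ?N = "(n + 1) * (n + 1)" and ?c = "cell_code n"
  have expand: "sum_list (map (\<lambda>p. B ^ ?c p) l) = (\<Sum>x<?N. count_list (map ?c l) x * B ^ x)"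
    if "set l \<subseteq> grid n" for l
    using that
  proof (induction l)
    case (Cons p l)
    have "(\<Sum>x<?N. count_list (map ?c (p # l)) x * B ^ x) =
      (\<Sum>x<?N. (if x = ?c p then B ^ ?c p else 0) + count_list (map ?c l) x * B ^ x)"
      by (intro sum.cong) auto
    also have "\<dots> = B ^ ?c p + (\<Sum>x<?N. count_list (map ?c l) x * B ^ x)"
      using cell_code_bound[of p n] Cons.prems by (simp add: sum.distrib)
    finally show ?case using Cons by simp
  qed simp
  have cl: "count_list (map ?c l) x < B" if "length l < B" for l x
    using count_le_length[of "map ?c l" x] that by simp
  have "\<forall>x<?N. count_list (map ?c l) x = count_list (map ?c l') x"
    using assms by (intro digits_unique[where B = B] cl) (simp_all add: expand)
  moreover have "count_list (map ?c l) x = 0" if "\<not> x < ?N" "set l \<subseteq> grid n" for l x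
    using that cell_code_bound by (auto simp: count_list_0_iff)
  ultimately have "mset (map ?c l) = mset (map ?c l')"
    using assms(3,4) by (intro multiset_eqI) (metis count_mset)
  then have "map ?c l = map ?c l'"
    using properties_for_sort[of "map ?c l" "map ?c l'"] assms(1,2) sorted_sort_id by metis
  then show ?thesis
    using assms(3,4) inj_on_subset[OF inj_on_cell_code, of "set l \<union> set l'"] by (auto dest: map_inj_on)
qed

section \<open>Leading coefficients\<close>

text \<open>Operator-valued polynomials in \<open>z\<close> of degree less than \<open>D\<close>.
  The point 0 is left out because the operators are built with inverse powers of \<open>z\<close>,
  which cancel only for nonzero \<open>z\<close>.\<close>

definition low :: "nat \<Rightarrow> ('k::field \<Rightarrow> ('i, 'k) lop) set"
  where "low D = {F. \<exists>c. \<forall>z. z \<noteq> 0 \<longrightarrow> F z = (\<Sum>r<D. z ^ r *\<^sub>c c r)}"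

lemma low_cong: "F \<in> low D \<Longrightarrow> (\<And>z. z \<noteq> 0 \<Longrightarrow> F z = G z) \<Longrightarrow> G \<in> low D"
  unfolding low_def by auto

lemma low_zero: "(\<lambda>z. 0) \<in> low D"
  unfolding low_def by (auto intro!: exI[of _ "\<lambda>_. 0"] simp: smul_simps)

lemma low_add: "F \<in> low D \<Longrightarrow> G \<in> low D \<Longrightarrow> (\<lambda>z. F z + G z) \<in> low D"
proof -
  assume "F \<in> low D" "G \<in> low D"
  then obtain c d where "\<And>z. z \<noteq> 0 \<Longrightarrow> F z = (\<Sum>r<D. z ^ r *\<^sub>c c r)" "\<And>z. z \<noteq> 0 \<Longrightarrow> G z = (\<Sum>r<D. z ^ r *\<^sub>c d r)"
    unfolding low_def by blast
  then show ?thesis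
    unfolding low_def by (auto intro!: exI[of _ "\<lambda>r. c r + d r"] simp: smul_simps sum.distrib)
qed

lemma low_sum: "(\<And>j. j \<in> J \<Longrightarrow> F j \<in> low D) \<Longrightarrow> (\<lambda>z. \<Sum>j\<in>J. F j z) \<in> low D"
  by (induction J rule: infinite_finite_induct) (simp_all add: low_zero low_add)

lemma low_monomial:
  assumes "e < D" shows "(\<lambda>z. z ^ e *\<^sub>c T) \<in> low D"
proof -
  have "(\<Sum>r<D. z ^ r *\<^sub>c (if r = e then T else 0)) = (\<Sum>r<D. if r = e then z ^ e *\<^sub>c T else 0)" for z
    by (intro sum.cong) (auto simp: smul_simps)
  then have "z ^ e *\<^sub>c T = (\<Sum>r<D. z ^ r *\<^sub>c (if r = e then T else 0))" for z
    using assms by simp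
  then show ?thesis
    unfolding low_def by (auto intro!: exI[of _ "\<lambda>r. if r = e then T else 0"])
qed

lemma lowE:
  assumes "F \<in> low D"
  obtains c where "\<And>z. z \<noteq> 0 \<Longrightarrow> F z = (\<Sum>r<D. z ^ r *\<^sub>c c r)"
  using assms unfolding low_def by blast

lemma low_mono: "F \<in> low D \<Longrightarrow> D \<le> E \<Longrightarrow> F \<in> low E"
proof (erule lowE)
  fix c assume "D \<le> E" and c: "\<And>z. z \<noteq> 0 \<Longrightarrow> F z = (\<Sum>r<D. z ^ r *\<^sub>c c r)"
  have "(\<lambda>z. \<Sum>r<D. z ^ r *\<^sub>c c r) \<in> low E" using \<open>D \<le> E\<close> by (intro low_sum low_monomial) auto
  then show ?thesis by (rule low_cong) (simp add: c)
qed

lemma low_mult: "F \<in> low D \<Longrightarrow> G \<in> low E \<Longrightarrow> (\<lambda>z. F z * G z) \<in> low (D + E)"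
proof (elim lowE)
  fix c d assume c: "\<And>z. z \<noteq> 0 \<Longrightarrow> F z = (\<Sum>r<D. z ^ r *\<^sub>c c r)" "\<And>z. z \<noteq> 0 \<Longrightarrow> G z = (\<Sum>r<E. z ^ r *\<^sub>c d r)"
  have "(\<lambda>z. \<Sum>r<D. \<Sum>s<E. z ^ (r + s) *\<^sub>c (c r * d s)) \<in> low (D + E)"
    by (intro low_sum low_monomial) auto
  then show ?thesis
    by (rule low_cong) (simp add: c sum_product smul_mult smul_simps power_add mult.commute)
qed

lemma low_scale: "F \<in> low D \<Longrightarrow> (\<lambda>z. z ^ e *\<^sub>c (T * F z)) \<in> low (D + e)"
proof (erule lowE)
  fix c assume c: "\<And>z. z \<noteq> 0 \<Longrightarrow> F z = (\<Sum>r<D. z ^ r *\<^sub>c c r)"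
  have "(\<lambda>z. \<Sum>r<D. z ^ (e + r) *\<^sub>c (T * c r)) \<in> low (D + e)"
    by (intro low_sum low_monomial) auto
  then show ?thesis
    by (rule low_cong) (simp add: c sum_distrib_left smul_mult smul_simps power_add)
qed

lemma low_scale_right: "F \<in> low D \<Longrightarrow> (\<lambda>z. z ^ e *\<^sub>c (F z * T)) \<in> low (D + e)"
proof (erule lowE)
  fix c assume c: "\<And>z. z \<noteq> 0 \<Longrightarrow> F z = (\<Sum>r<D. z ^ r *\<^sub>c c r)"
  have "(\<lambda>z. \<Sum>r<D. z ^ (e + r) *\<^sub>c (c r * T)) \<in> low (D + e)"
    by (intro low_sum low_monomial) auto
  then show ?thesis
    by (rule low_cong) (simp add: c sum_distrib_right smul_mult smul_simps power_add)
qed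

definition leading :: "('k::field \<Rightarrow> ('i, 'k) lop) \<Rightarrow> nat \<Rightarrow> ('i, 'k) lop \<Rightarrow> bool"
  where "leading F D L \<longleftrightarrow> (\<lambda>z. F z - z ^ D *\<^sub>c L) \<in> low D"

lemma leading_monomial: "leading (\<lambda>z. z ^ D *\<^sub>c L) D L"
  by (simp add: leading_def low_zero)

lemma leading_cong: "leading F D L \<Longrightarrow> (\<And>z. z \<noteq> 0 \<Longrightarrow> F z = G z) \<Longrightarrow> leading G D L"
  unfolding leading_def by (erule low_cong) simp

lemma leading_add_low: "leading F D L \<Longrightarrow> G \<in> low D \<Longrightarrow> leading (\<lambda>z. F z + G z) D L"
  unfolding leading_def by (drule (1) low_add) (simp add: algebra_simps)

lemma leading_imp_low: "leading F D L \<Longrightarrow> F \<in> low (Suc D)"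
proof -
  assume "leading F D L"
  then have "(\<lambda>z. F z - z ^ D *\<^sub>c L) \<in> low (Suc D)" unfolding leading_def by (rule low_mono) simp
  then have "(\<lambda>z. (F z - z ^ D *\<^sub>c L) + z ^ D *\<^sub>c L) \<in> low (Suc D)"
    by (intro low_add low_monomial) auto
  then show ?thesis by simp
qed

lemma leading_mult:
  assumes "leading F D L" "leading G E T"
  shows "leading (\<lambda>z. F z * G z) (D + E) (L * T)"
proof -
  let ?f = "\<lambda>z. F z - z ^ D *\<^sub>c L" and ?g = "\<lambda>z. G z - z ^ E *\<^sub>c T"
  have f: "?f \<in> low D" and g: "?g \<in> low E" using assms by (simp_all add: leading_def)
  have "(\<lambda>z. ?f z * ?g z + z ^ D *\<^sub>c (L * ?g z) + z ^ E *\<^sub>c (?f z * T)) \<in> low (D + E)"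
    using low_scale[OF g, of D L] by (intro low_add low_mult f g low_scale_right) (simp add: add.commute)
  then have "(\<lambda>z. F z * G z - z ^ (D + E) *\<^sub>c (L * T)) \<in> low (D + E)"
    by (rule low_cong) (simp add: algebra_simps smul_mult smul_simps power_add mult.commute)
  then show ?thesis by (simp add: leading_def)
qed

lemma leading_prod_list:
  "(\<And>g. g \<in> set l \<Longrightarrow> leading (\<lambda>z. F z g) (D g) (L g)) \<Longrightarrow>
    leading (\<lambda>z. prod_list (map (F z) l)) (sum_list (map D l)) (prod_list (map L l))"
proof (induction l)
  case Nil
  then show ?case using leading_monomial[of 0 1] by (simp add: smul_simps)
qed (simp add: leading_mult)

text \<open>If the field were finite, adding 1 to the product of all linear factors would give a
  nonconstant polynomial without a root.\<close>

lemma alg_closed_infinite: "infinite (UNIV :: 'k::alg_closed_field set)"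
proof
  assume fin: "finite (UNIV :: 'k set)"
  let ?p = "\<Prod>a\<in>(UNIV :: 'k set). [:- a, 1:]"
  have deg: "degree ?p = card (UNIV :: 'k set)"
    by (subst degree_prod_eq_sum_degree) auto
  have "card (UNIV :: 'k set) > 0" using fin by (simp add: card_gt_0_iff)
  then have "degree (?p + 1) > 0" using deg by (simp add: degree_add_eq_left)
  then obtain x where "poly (?p + 1) x = 0" using alg_closed_imp_poly_has_root by blast
  moreover have "poly ?p x = 0" using fin by (auto simp: poly_prod prod_zero_iff)
  ultimately show False by simp
qed

text \<open>Each single value is a polynomial in \<open>z\<close> with scalar coefficients. It
  vanishes at infinitely many points, so its top coefficient is 0.\<close>

lemma leading_eq_0:
  fixes F :: "'k::alg_closed_field \<Rightarrow> ('i, 'k) lop"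
  assumes "leading F D L" "\<And>z. z \<noteq> 0 \<Longrightarrow> app (F z) f x = 0"
  shows "app L f x = 0"
proof -
  obtain c where c: "\<And>z. z \<noteq> 0 \<Longrightarrow> F z - z ^ D *\<^sub>c L = (\<Sum>r<D. z ^ r *\<^sub>c c r)"
    by (rule lowE[OF assms(1)[unfolded leading_def]]) blast
  define P where "P = monom (app L f x) D + (\<Sum>r<D. monom (app (c r) f x) r)"
  have as: "app (sum g J) f x = (\<Sum>j\<in>J. app (g j) f x)" for g :: "nat \<Rightarrow> ('i, 'k) lop" and J
    by (induction J rule: infinite_finite_induct) (simp_all add: app_simps)
  have "poly P z = 0" if "z \<noteq> 0" for z
  proof -
    have "F z = z ^ D *\<^sub>c L + (\<Sum>r<D. z ^ r *\<^sub>c c r)" using c[OF that] by (simp add: algebra_simps)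
    then have "app (F z) f x = poly P z"
      by (simp add: P_def app_simps as smul_def app_scal poly_monom poly_sum mult.commute)
    then show ?thesis using assms(2)[OF that] by simp
  qed
  then have "UNIV - {0} \<subseteq> {z. poly P z = 0}" by auto
  moreover have "infinite (UNIV - {0 :: 'k})" using alg_closed_infinite by (simp add: infinite_remove)
  ultimately have "P = 0" using poly_roots_finite[of P] finite_subset by blast
  moreover have "coeff P D = app L f x" by (simp add: P_def coeff_sum)
  ultimately show ?thesis by simp
qed

text \<open>In the last sum the term \<open>k = j\<close> reproduces the previous operator, as
  \<open>U\<close> and \<open>V\<close> cancel. A term \<open>k < j\<close> has degree
  \<open>w r j - w r k + w i k\<close>, which \<open>steep\<close> keeps below \<open>w i j\<close>,
  so every row addition only changes lower terms.\<close>

lemma leading_matrix_op: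
  fixes U V :: "nat \<Rightarrow> nat \<Rightarrow> ('i, 'k::field) lop" and w :: "nat \<Rightarrow> nat \<Rightarrow> nat"
  assumes UV: "\<And>r j. r \<in> {1..n} \<Longrightarrow> j \<in> {1..n} \<Longrightarrow> U r j * V r j = 1"
    and mono: "\<And>r k j. k \<le> j \<Longrightarrow> w r k \<le> w r j"
    and steep: "\<And>r i k j. r \<in> {1..n} \<Longrightarrow> i \<in> {1..n} \<Longrightarrow> j \<in> {1..n} \<Longrightarrow> k \<in> {1..n} \<Longrightarrow> r < i \<Longrightarrow> k < j \<Longrightarrow>
      w r j + w i k < w i j + w r k"
    and dij: "d < i" "i \<in> {1..n}" "j \<in> {1..n}"
  shows "leading (\<lambda>z. matrix_op (\<lambda>r j. z ^ w r j *\<^sub>c U r j) (\<lambda>r j. inverse (z ^ w r j) *\<^sub>c V r j) d i j)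
    (w i j) (U i j)"
  using dij
proof (induction d arbitrary: j)
  case 0
  then show ?case by (simp add: leading_monomial)
next
  case (Suc d)
  let ?M = "\<lambda>z. matrix_op (\<lambda>r j. z ^ w r j *\<^sub>c U r j) (\<lambda>r j. inverse (z ^ w r j) *\<^sub>c V r j) d i"
  let ?r = "i - Suc d"
  have r: "?r \<in> {1..n}" "?r < i" using Suc.prems by auto
  \<comment> \<open>The subtraction is not truncated for \<open>k \<le> j\<close> by
    \<open>mono\<close>; this is where the inverse powers of \<open>z\<close> disappear.\<close>
  define e where "e k = w ?r j - w ?r k" for k
  have tm: "(z ^ w ?r j *\<^sub>c U ?r j) * ((inverse (z ^ w ?r k) *\<^sub>c V ?r k) * ?M z k) =
      z ^ e k *\<^sub>c (U ?r j * V ?r k * ?M z k)" if "k \<le> j" "z \<noteq> 0" for k z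
  proof -
    have "z ^ w ?r j * inverse (z ^ w ?r k) = z ^ e k"
      using mono[OF that(1), of ?r] that(2) unfolding e_def by (simp add: power_diff divide_inverse)
    then show ?thesis by (simp add: smul_mult smul_simps mult.assoc mult.commute[of "inverse _"])
  qed
  have lt: "(\<lambda>z. z ^ e k *\<^sub>c (U ?r j * V ?r k * ?M z k)) \<in> low (w i j)" if k: "k \<in> {1..<j}" for k
  proof -
    have k': "k \<in> {1..n}" using k Suc.prems by auto
    have "leading (\<lambda>z. ?M z k) (w i k) (U i k)" using Suc.IH[of k] k' Suc.prems by simp
    then have "(\<lambda>z. z ^ e k *\<^sub>c (U ?r j * V ?r k * ?M z k)) \<in> low (Suc (w i k) + e k)"
      by (intro low_scale leading_imp_low)
    moreover have "Suc (w i k) + e k \<le> w i j"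
      using steep[OF r(1) Suc.prems(2,3) k' r(2)] k mono[of k j ?r] by (simp add: e_def)
    ultimately show ?thesis by (rule low_mono)
  qed
  have "leading (\<lambda>z. ?M z j + (\<Sum>k\<in>{1..<j}. z ^ e k *\<^sub>c (U ?r j * V ?r k * ?M z k))) (w i j) (U i j)"
    using Suc by (intro leading_add_low low_sum lt) auto
  then show ?case
  proof (rule leading_cong)
    fix z :: 'k assume z: "z \<noteq> 0"
    have "{1..j} = insert j {1..<j}" using Suc.prems by auto
    then have "matrix_op (\<lambda>r j. z ^ w r j *\<^sub>c U r j) (\<lambda>r j. inverse (z ^ w r j) *\<^sub>c V r j) (Suc d) i j =
      (\<Sum>k\<in>insert j {1..<j}. (z ^ w ?r j *\<^sub>c U ?r j) * ((inverse (z ^ w ?r k) *\<^sub>c V ?r k) * ?M z k))"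
      by (simp only: matrix_op.simps sum_distrib_left)
    also have "\<dots> = (\<Sum>k\<in>insert j {1..<j}. z ^ e k *\<^sub>c (U ?r j * V ?r k * ?M z k))"
      using z by (intro sum.cong refl tm) auto
    also have "\<dots> = ?M z j + (\<Sum>k\<in>{1..<j}. z ^ e k *\<^sub>c (U ?r j * V ?r k * ?M z k))"
      using UV[OF r(1) Suc.prems(3)] by (simp add: e_def smul_simps)
    finally show "?M z j + (\<Sum>k\<in>{1..<j}. z ^ e k *\<^sub>c (U ?r j * V ?r k * ?M z k)) =
      matrix_op (\<lambda>r j. z ^ w r j *\<^sub>c U r j) (\<lambda>r j. inverse (z ^ w r j) *\<^sub>c V r j) (Suc d) i j" by simp
  qed
qed

section \<open>PI degrees of the quantum matrix algebra and its quantum affine space\<close>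

lemma ncconst_0: "ncconst 0 = 0"
  by (simp add: ncconst_def)

lemma app_smul: "app (c *\<^sub>c T) f x = c * app T f x"
  by (simp add: smul_def app_simps app_scal)

lemma preserves_smul: "preserves r T \<Longrightarrow> preserves r (c *\<^sub>c T)"
  by (simp add: smul_def preserves_intros)

lemma leading_smul: "leading F D L \<Longrightarrow> leading (\<lambda>z. c *\<^sub>c F z) D (c *\<^sub>c L)"
proof -
  assume "leading F D L"
  then have "(\<lambda>z. z ^ 0 *\<^sub>c (scal c * (F z - z ^ D *\<^sub>c L))) \<in> low (D + 0)"
    unfolding leading_def by (rule low_scale)
  moreover have "z ^ 0 *\<^sub>c (scal c * (F z - z ^ D *\<^sub>c L)) = c *\<^sub>c F z - z ^ D *\<^sub>c (c *\<^sub>c L)" for z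
    by (simp add: smul_simps flip: smul_def) (simp add: smul_simps mult.commute)
  ultimately show ?thesis by (simp add: leading_def)
qed

section \<open>Clock and shift operators for the affine generators\<close>

context
  fixes q :: "'k::alg_closed_field" and m n :: nat
  assumes q: "primitive_root_of_unity m q"
begin

abbreviation cells :: "(nat \<times> nat) set" where "cells \<equiv> odd_cells n"

abbreviation per :: "(nat \<times> nat \<Rightarrow> int) \<Rightarrow> nat \<times> nat \<Rightarrow> int" where "per \<equiv> red m cells"

definition gvec :: "nat \<Rightarrow> nat \<Rightarrow> (nat \<times> nat) lat"
  where "gvec i j = evec n (zigzag n i) (zigzag n j)"

definition gop :: "nat \<Rightarrow> nat \<Rightarrow> (nat \<times> nat \<Rightarrow> int, 'k) lop"
  where "gop i j = torus q cells (gvec i j)"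

definition ginv :: "nat \<Rightarrow> nat \<Rightarrow> (nat \<times> nat \<Rightarrow> int, 'k) lop"
  where "ginv i j = q powi (- dot cells (fst (gvec i j)) (snd (gvec i j))) *\<^sub>c torus q cells (- gvec i j)"

lemma q0: "q \<noteq> 0"
  by (rule q_nonzero[OF q finite_odd_cells])

lemma gop_ginv: "gop i j * ginv i j = 1" "ginv i j * gop i j = 1"
proof -
  let ?v = "gvec i j"
  have "torus q cells ?v * torus q cells (- ?v) = scal (q powi dot cells (fst ?v) (snd ?v))"
    "torus q cells (- ?v) * torus q cells ?v = scal (q powi dot cells (fst ?v) (snd ?v))"
    by (simp_all add: torus_mult[OF q0] torus_0[OF q0] dot_simps)
  moreover have "q powi (- dot cells (fst ?v) (snd ?v)) * q powi dot cells (fst ?v) (snd ?v) = 1"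
    using q0 by (simp flip: power_int_add)
  ultimately show "gop i j * ginv i j = 1" "ginv i j * gop i j = 1"
    by (simp_all add: gop_def ginv_def smul_mult) (simp_all add: smul_def scal_hom(1) flip: scal_hom(3))
qed

lemma gop_commute:
  assumes "(i, j) \<in> grid n" "(s, t) \<in> grid n"
  shows "gop i j * gop s t = q powi (of_bool (s < i \<and> j \<le> t) - of_bool (i < s \<and> t \<le> j)) *\<^sub>c (gop s t * gop i j)"
  using torus_commute[OF q0, of cells "gvec i j" "gvec s t"] symp_evec_zigzag[OF assms]
  by (simp add: gop_def gvec_def smul_def)

lemma preserves_gop: "preserves per (gop i j)" "preserves per (ginv i j)"
  unfolding gop_def ginv_def
  by (rule preserves_torus[OF q finite_odd_cells], rule preserves_smul, rule preserves_torus[OF q finite_odd_cells])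

lemma prod_list_gop:
  "\<exists>c v. c \<noteq> 0 \<and> prod_list (map (\<lambda>p. gop (fst p) (snd p)) l) = c *\<^sub>c torus q cells v"
proof (induction l)
  case Nil
  show ?case using torus_0[OF q0, of cells] by (intro exI[of _ 1] exI[of _ 0]) (simp add: smul_simps)
next
  case (Cons p l)
  then obtain c v where c: "c \<noteq> 0" "prod_list (map (\<lambda>p. gop (fst p) (snd p)) l) = c *\<^sub>c torus q cells v" by blast
  let ?d = "q powi (- dot cells (fst v) (snd (gvec (fst p) (snd p))))"
  have "prod_list (map (\<lambda>p. gop (fst p) (snd p)) (p # l)) = c *\<^sub>c (gop (fst p) (snd p) * torus q cells v)"
    by (simp add: c(2) smul_mult)
  also have "\<dots> = (c * ?d) *\<^sub>c torus q cells (gvec (fst p) (snd p) + v)"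
    unfolding gop_def torus_mult[OF q0] smul_def[symmetric] by (simp add: smul_simps)
  finally have "prod_list (map (\<lambda>p. gop (fst p) (snd p)) (p # l)) = (c * ?d) *\<^sub>c torus q cells (gvec (fst p) (snd p) + v)" .
  then show ?case using c(1) q0
    by (intro exI[of _ "c * ?d"] exI[of _ "gvec (fst p) (snd p) + v"] conjI) simp_all
qed

section \<open>The image of one representation\<close>

context
  fixes u :: "nat \<times> nat \<Rightarrow> (nat \<times> nat \<Rightarrow> int, 'k) lop"
  assumes u: "\<And>p. preserves per (u p)"
begin

abbreviation Im :: "(nat \<times> nat \<Rightarrow> int, 'k) lop set" where "Im \<equiv> image_ops per (grid n) u"

lemma image_smul: "T \<in> Im \<Longrightarrow> c *\<^sub>c T \<in> Im"
  unfolding smul_def by (rule image_ops_mult[OF u image_ops_scal[OF u]])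

lemma image_unsmul: "c \<noteq> 0 \<Longrightarrow> c *\<^sub>c T \<in> Im \<Longrightarrow> T \<in> Im"
  using image_smul[of "c *\<^sub>c T" "inverse c"] by (simp add: smul_simps)

lemma image_torus_neg:
  assumes "torus q cells v \<in> Im" shows "torus q cells (- v) \<in> Im"
proof -
  obtain c where c: "c \<noteq> 0" "\<And>f. periodic per f \<Longrightarrow>
      app (torus q cells v ^ (m - 1)) f = app (scal c * torus q cells (- v)) f"
    using torus_power_periodic[OF q finite_odd_cells] by blast
  have pow: "torus q cells v ^ k \<in> Im" for k
  proof (induction k)
    case 0
    then show ?case using image_ops_scal[OF u, of 1] by (simp add: scal_hom(1))
  qed (simp add: image_ops_mult[OF u] assms)
  have "c *\<^sub>c torus q cells (- v) \<in> Im"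
    unfolding smul_def by (rule image_ops_cong[OF u pow c(2)])
  then show ?thesis by (rule image_unsmul[OF c(1)])
qed

lemma image_torus_add:
  assumes "torus q cells v \<in> Im" "torus q cells v' \<in> Im"
  shows "torus q cells (v + v') \<in> Im"
proof -
  have "torus q cells v * torus q cells v' \<in> Im" by (rule image_ops_mult[OF u assms])
  then show ?thesis unfolding torus_mult[OF q0] smul_def[symmetric]
    by (rule image_unsmul[rotated]) (simp add: q0)
qed

lemma image_ginv:
  assumes "gop i j \<in> Im" shows "ginv i j \<in> Im"
  unfolding ginv_def by (intro image_smul image_torus_neg) (use assms in \<open>simp add: gop_def\<close>)

text \<open>The exponents of torus operators in the image form a subgroup, negatives being supplied
  by powers. So \<open>lattice_span\<close> applies and yields the clocks and shifts that generate
  all matrices.\<close>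

lemma block_onto:
  assumes "\<And>i j. (i, j) \<in> grid n \<Longrightarrow> gop i j \<in> Im"
  shows "\<exists>p\<in>carrier (free_algebra (grid n)). \<forall>x\<in>range per. \<forall>y\<in>range per.
    block per (nc_subst scal u p) x y = Y x y"
proof (rule image_ops_onto[OF q finite_odd_cells u])
  let ?L = "{v. torus q cells v \<in> Im}"
  have L: "0 \<in> ?L" "\<And>v v'. v \<in> ?L \<Longrightarrow> v' \<in> ?L \<Longrightarrow> v + v' \<in> ?L" "\<And>v. v \<in> ?L \<Longrightarrow> - v \<in> ?L"
    using image_ops_scal[OF u, of 1]
    by (simp_all add: torus_0[OF q0] scal_hom(1) image_torus_add image_torus_neg)
  have ev: "evec n a b \<in> ?L" if "(a, b) \<in> grid n" for a b
  proof -
    obtain i j where "1 \<le> i" "i \<le> n" "zigzag n i = a" "1 \<le> j" "j \<le> n" "zigzag n j = b"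
      using zigzag_surj[of a n] zigzag_surj[of b n] \<open>(a, b) \<in> grid n\<close> by (auto simp: grid_def)
    moreover from this have "gop i j \<in> Im" by (intro assms) (simp add: grid_def)
    ultimately show ?thesis by (simp add: gop_def gvec_def)
  qed
  note span = lattice_span[OF L ev]
  show "torus q cells (\<lambda>x. of_bool (x = w), 0) \<in> Im" if "w \<in> cells" for w
  proof -
    have "(\<lambda>x. of_bool (x = w)) = delta n w" using that by (auto simp: delta_def fun_eq_iff)
    then show ?thesis using span(1)[of w] by simp
  qed
  show "torus q cells (0, \<kappa>) \<in> Im" if "\<And>w. w \<notin> cells \<Longrightarrow> \<kappa> w = 0" for \<kappa>
    using span(2)[of \<kappa>] that by simp
qed

end

text \<open>The argument common to both algebras. The weights involve a base \<open>B\<close> chosen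
  after the polynomial to be tested, so the faithful family is indexed by pairs of \<open>B\<close>
  and \<open>z\<close>; for surjectivity the member \<open>uop 2 1\<close> is enough.\<close>

lemma PI_min_degree_of_leading:
  fixes R :: "(nat \<times> nat, 'k) ncpoly set" and uop :: "nat \<Rightarrow> 'k \<Rightarrow> nat \<times> nat \<Rightarrow> (nat \<times> nat \<Rightarrow> int, 'k) lop"
  assumes R: "R \<subseteq> carrier (free_algebra (grid n))"
    and rel: "\<And>a b. a \<in> grid n \<Longrightarrow> b \<in> grid n \<Longrightarrow> cell_code n b < cell_code n a \<Longrightarrow>
      \<exists>c c' a' b'. a' \<in> grid n \<and> b' \<in> grid n \<and>
        (fst a' = fst b \<and> fst b' = fst a \<and> fst b < fst a \<or> a' = b \<and> b' = a) \<and>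
        ncvar a * ncvar b - (ncconst c * (ncvar b * ncvar a) + ncconst c' * (ncvar a' * ncvar b')) \<in> R"
    and kill: "\<And>B z r. z \<noteq> 0 \<Longrightarrow> r \<in> R \<Longrightarrow> nc_subst scal (uop B z) r = 0"
    and pres: "\<And>B z p. preserves per (uop B z p)"
    and lead: "\<And>B p. B \<ge> 2 \<Longrightarrow> p \<in> grid n \<Longrightarrow>
      leading (\<lambda>z. uop B z p) (B ^ cell_code n p) (gop (fst p) (snd p))"
    and gen: "\<And>i j. (i, j) \<in> grid n \<Longrightarrow> gop i j \<in> image_ops per (grid n) (uop 2 1)"
  shows "PI_min_degree (presented_algebra (grid n) R) = 2 * m ^ (n\<^sup>2 div 2)"
proof -
  let ?I = "range per" and ?J = "Idl\<^bsub>free_algebra (grid n)\<^esub> R"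
  let ?\<rho> = "\<lambda>t p. block per (nc_subst scal (uop (fst t) (snd t)) p)"
  have fin: "finite ?I" by (rule finite_range_red[OF q finite_odd_cells])
  have rep: "matrix_rep ?I (?\<rho> t)" for t
    by (rule matrix_rep_block[OF red_red[OF q finite_odd_cells] fin pres])
  note killJ = nc_subst_genideal[OF central_hom_scal R kill]
  have faithful: "p \<in> ?J" if p: "p \<in> carrier (free_algebra (grid n))"
    and zero: "\<And>t x y. x \<in> ?I \<Longrightarrow> y \<in> ?I \<Longrightarrow> ?\<rho> t p x y = 0" for p
  proof -
    obtain p' where p': "p' \<in> sorted_polys n" "p - p' \<in> ?J" using straighten[OF R rel p] by blast
    have "p' = 0"
    proof (rule ccontr)
      assume "p' \<noteq> 0"
      let ?S = "Poly_Mapping.keys p'" and ?l = "Poly_Mapping.lookup p'"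
      have S: "?S \<noteq> {}" "finite ?S" using \<open>p' \<noteq> 0\<close> by auto
      \<comment> \<open>Larger than the length of every word of \<open>p'\<close>, so that different
        sorted words have different weights, and at least 2 as \<open>lead\<close> demands.\<close>
      define B where "B = Suc (Suc (\<Sum>w\<in>?S. length (letters w)))"
      have len: "length (letters w) < B" if "w \<in> ?S" for w
        using member_le_sum[of w ?S "\<lambda>w. length (letters w)"] that by (simp add: B_def)
      define D where "D w = sum_list (map (\<lambda>p. B ^ cell_code n p) (letters w))" for w
      have sw: "set (letters w) \<subseteq> grid n" "sorted (map (cell_code n) (letters w))" if "w \<in> ?S" for w
        using p'(1) that by (auto simp: sorted_polys_def)
      have Dinj: "w = w'" if "w \<in> ?S" "w' \<in> ?S" "D w = D w'" for w w'
        using sorted_words_eq[of n "letters w" "letters w'" B] sw len that by (simp add: D_def word.expand)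
      have "Max (D ` ?S) \<in> D ` ?S" using S by (intro Max_in) auto
      then obtain w where w: "w \<in> ?S" "D w = Max (D ` ?S)" by auto
      have less: "D w' < D w" if "w' \<in> ?S - {w}" for w'
      proof -
        have "D w' \<le> D w" using w(2) that S by simp
        moreover have "D w' \<noteq> D w" using Dinj[of w' w] that w(1) by auto
        ultimately show ?thesis by simp
      qed
      let ?L = "\<lambda>w. prod_list (map (\<lambda>p. gop (fst p) (snd p)) (letters w))"
      let ?F = "\<lambda>w z. ?l w *\<^sub>c prod_list (map (uop B z) (letters w))"
      have lw: "leading (?F w) (D w) (?l w *\<^sub>c ?L w)" if "w \<in> ?S" for w
        unfolding D_def using sw[OF that] by (intro leading_smul leading_prod_list lead) (auto simp: B_def)
      have "(\<lambda>z. \<Sum>w'\<in>?S - {w}. ?F w' z) \<in> low (D w)"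
      proof (rule low_sum)
        fix w' assume w': "w' \<in> ?S - {w}"
        show "?F w' \<in> low (D w)"
          using low_mono[OF leading_imp_low[OF lw]] w' less[OF w'] by auto
      qed
      then have "leading (\<lambda>z. ?F w z + (\<Sum>w'\<in>?S - {w}. ?F w' z)) (D w) (?l w *\<^sub>c ?L w)"
        by (rule leading_add_low[OF lw[OF w(1)]])
      moreover have "?F w z + (\<Sum>w'\<in>?S - {w}. ?F w' z) = nc_subst scal (uop B z) p'" for z
        unfolding nc_subst_def smul_def by (rule sum.remove[OF S(2) w(1), symmetric])
      ultimately have leadF: "leading (\<lambda>z. nc_subst scal (uop B z) p') (D w) (?l w *\<^sub>c ?L w)" by simp
      obtain c v where cv: "c \<noteq> 0" "?L w = c *\<^sub>c torus q cells v" using prod_list_gop by blast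
      \<comment> \<open>An entry at which a torus operator cannot vanish: at \<open>?x\<close> it
        reads the indicator at \<open>?x - snd v\<close>, which lies in the fibre of
        \<open>?y\<close>, and multiplies by a power of \<open>q\<close>.\<close>
      let ?x = "per 0"
      let ?y = "per (?x - snd v)"
      let ?f = "\<lambda>x. of_bool (per x = ?y) :: 'k"
      have "app (nc_subst scal (uop B z) p') ?f ?x = 0" if z: "z \<noteq> 0" for z
      proof -
        have "nc_subst scal (uop B z) (p - p') = 0" by (rule killJ[OF z _ p'(2)])
        then have "nc_subst scal (uop B z) p' = nc_subst scal (uop B z) p"
          by (simp add: nc_subst_diff[OF central_hom_scal])
        then show ?thesis using zero[of ?x ?y "(B, z)"] by (simp add: block_def)
      qed
      then have "app (?l w *\<^sub>c ?L w) ?f ?x = 0" by (rule leading_eq_0[OF leadF])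
      moreover have "app (torus q cells v) ?f ?x \<noteq> 0"
        using q0 by (simp add: torus_def app_wop)
      moreover have "?l w \<noteq> 0" using w(1) by (simp add: in_keys_iff)
      ultimately show False using cv by (simp add: app_smul)
    qed
    then show ?thesis using p'(2) by simp
  qed
  have "PI_min_degree (presented_algebra (grid n) R) = 2 * card ?I"
  proof (rule PI_min_degree_presented_algebra[where \<rho> = ?\<rho>, OF R fin rep _ _ rep faithful])
    show "?\<rho> (2, 1) p x y = 0" if "p \<in> ?J" for p x y
    proof -
      have "nc_subst scal (uop 2 1) p = 0" by (rule killJ[OF _ _ that]) simp_all
      then show ?thesis by (simp add: block_def app_simps)
    qed
    show "\<exists>p\<in>carrier (free_algebra (grid n)). \<forall>x\<in>?I. \<forall>y\<in>?I. ?\<rho> (2, 1) p x y = Y x y" for Y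
      using block_onto[where u = "uop 2 1" and Y = Y, OF pres gen] by simp
  qed
  then show ?thesis
    by (simp add: card_range_red[OF q finite_odd_cells] card_odd_cells)
qed

theorem PI_min_degree_quantum_affine_space:
  "PI_min_degree (quantum_affine_space n q) = 2 * m ^ (n\<^sup>2 div 2)"
  unfolding quantum_affine_space_def
\<comment> \<open>Monomials in the weighted generators have the required leading terms trivially.
  Letters off the grid do not occur in the algebra; the default 1 is an operator that preserves
  periodicity.\<close>
proof (rule PI_min_degree_of_leading[where uop = "\<lambda>B z p. if p \<in> grid n then z ^ (B ^ cell_code n p) *\<^sub>c gop (fst p) (snd p) else 1"])
  let ?R = "affine_relations n q"
  let ?u = "\<lambda>B z p. if p \<in> grid n then z ^ (B ^ cell_code n p) *\<^sub>c gop (fst p) (snd p) else 1"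
  show "?R \<subseteq> carrier (free_algebra (grid n))"
    unfolding affine_relations_def by (auto intro!: free_algebra_carrierI simp: grid_def)
  show "\<exists>c c' a' b'. a' \<in> grid n \<and> b' \<in> grid n \<and>
        (fst a' = fst b \<and> fst b' = fst a \<and> fst b < fst a \<or> a' = b \<and> b' = a) \<and>
        ncvar a * ncvar b - (ncconst c * (ncvar b * ncvar a) + ncconst c' * (ncvar a' * ncvar b')) \<in> ?R"
    if ab: "a \<in> grid n" "b \<in> grid n" "cell_code n b < cell_code n a" for a b
  proof -
    obtain i j s t where st: "a = (i, j)" "b = (s, t)" by (cases a; cases b)
    have "\<exists>c. ncvar a * ncvar b - ncconst c * (ncvar b * ncvar a) \<in> ?R"
    proof (cases "s < i")
      case True
      show ?thesis
      proof (cases "j \<le> t")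
        case True
        then have "ncvar a * ncvar b - ncconst q * (ncvar b * ncvar a) \<in> ?R"
          unfolding affine_relations_def st using \<open>s < i\<close> ab st by blast
        then show ?thesis by blast
      next
        case False
        then have "ncvar a * ncvar b - ncvar b * ncvar a \<in> ?R"
          unfolding affine_relations_def st using \<open>s < i\<close> ab st by (auto simp: not_le)
        then show ?thesis by (intro exI[of _ 1]) (simp add: ncconst_1)
      qed
    next
      case False
      then have "s = i" using ab cell_code_less[OF ab(2,1)] by (simp add: st)
      then have "ncvar a * ncvar b - ncvar b * ncvar a \<in> ?R"
        unfolding affine_relations_def st using ab st by blast
      then show ?thesis by (intro exI[of _ 1]) (simp add: ncconst_1)
    qed
    then obtain c where "ncvar a * ncvar b - ncconst c * (ncvar b * ncvar a) \<in> ?R" by blast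
    then show ?thesis
      using ab by (intro exI[of _ c] exI[of _ 0] exI[of _ b] exI[of _ a]) (simp add: ncconst_0)
  qed
  show "nc_subst scal (?u B z) r = 0" if "z \<noteq> 0" "r \<in> ?R" for B z r
  proof -
    note hom = nc_subst_diff[OF central_hom_scal] nc_subst_mult[OF central_hom_scal]
      nc_subst_ncvar[OF central_hom_scal] nc_subst_ncconst[OF central_hom_scal]
    from \<open>r \<in> ?R\<close> consider
      i j s t where "r = ncvar (i, j) * ncvar (s, t) - ncconst q * (ncvar (s, t) * ncvar (i, j))"
        "(i, j) \<in> grid n" "(s, t) \<in> grid n" "s < i" "j \<le> t"
      | i j s t where "r = ncvar (i, j) * ncvar (s, t) - ncvar (s, t) * ncvar (i, j)"
        "(i, j) \<in> grid n" "(s, t) \<in> grid n" "s < i" "t < j"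
      | i j k where "r = ncvar (i, j) * ncvar (i, k) - ncvar (i, k) * ncvar (i, j)"
        "(i, j) \<in> grid n" "(i, k) \<in> grid n"
      unfolding affine_relations_def by blast
    then show ?thesis
    proof cases
      case 1
      then show ?thesis
        using gop_commute[OF 1(2,3)]
        by (simp add: hom smul_mult smul_simps mult.commute mult.left_commute flip: smul_def)
    next
      case 2
      then show ?thesis
        using gop_commute[OF 2(2,3)]
        by (simp add: hom smul_mult smul_simps mult.commute mult.left_commute flip: smul_def)
    next
      case 3
      then show ?thesis
        using gop_commute[OF 3(2,3)]
        by (simp add: hom smul_mult smul_simps mult.commute mult.left_commute flip: smul_def)
    qed
  qed
  have pres: "preserves per (?u B z p)" for B :: nat and z p
    by (auto intro: preserves_smul preserves_gop preserves_intros)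
  show "preserves per (?u B z p)" for B z p
    by (rule pres)
  show "leading (\<lambda>z. ?u B z p) (B ^ cell_code n p) (gop (fst p) (snd p))" if "p \<in> grid n" for B p
    using that by (simp add: leading_monomial)
  show "gop i j \<in> image_ops per (grid n) (?u 2 1)" if "(i, j) \<in> grid n" for i j
    using image_ops_var[where u = "?u 2 1" and r = per, OF pres that] that by (simp add: smul_simps)
qed

section \<open>Representations of the quantum matrix algebra\<close>

lemma preserves_matrix_op:
  assumes "\<And>i j. preserves r (X i j)" "\<And>i j. preserves r (Xi i j)"
  shows "preserves r (matrix_op X Xi d i j)"
  by (induction d arbitrary: j) (auto intro!: assms preserves_intros preserves_sum)

text \<open>Row additions are invertible inside the image. The rows above \<open>i\<close> are
  available by induction, together with their inverses; dividing by such a row leaves partial sums,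
  and their differences give back the entries before the addition.\<close>

lemma image_gop_matrix_op:
  assumes u: "\<And>p. preserves per (u p)"
    and M: "\<And>i j. (i, j) \<in> grid n \<Longrightarrow> matrix_op gop ginv (i - 1) i j \<in> image_ops per (grid n) u"
  shows "(i, j) \<in> grid n \<Longrightarrow> gop i j \<in> image_ops per (grid n) u"
proof (induction i arbitrary: j rule: less_induct)
  case (less i)
  let ?Im = "image_ops per (grid n) u"
  have i: "i \<in> {1..n}" using less.prems by (auto simp: grid_def)
  have rows: "\<forall>j\<in>{1..n}. matrix_op gop ginv (i - 1 - e) i j \<in> ?Im" if "e \<le> i - 1" for e
    using that
  proof (induction e)
    case 0
    then show ?case using M i by (auto simp: grid_def)
  next
    case (Suc e)
    \<comment> \<open>The row removed in this step is \<open>i - Suc d = e + 1\<close>: the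
      additions ended with the first row, so they are undone from the first row downwards.\<close>
    define d where "d = i - 1 - Suc e"
    have d: "i - 1 - e = Suc d" using Suc.prems by (simp add: d_def)
    let ?r = "i - Suc d"
    have r: "?r < i" "?r \<in> {1..n}" using Suc.prems i by (auto simp: d_def)
    have g: "gop ?r j \<in> ?Im" "ginv ?r j \<in> ?Im" if "j \<in> {1..n}" for j
    proof -
      show "gop ?r j \<in> ?Im" using less.IH[OF r(1), of j] r(2) that by (auto simp: grid_def)
      then show "ginv ?r j \<in> ?Im" by (rule image_ginv[OF u])
    qed
    define S where "S j = (\<Sum>k\<in>{1..j}. ginv ?r k * matrix_op gop ginv d i k)" for j
    have SI: "S j \<in> ?Im" if "j \<le> n" for j
    proof (cases "j = 0")
      case True
      then show ?thesis using image_ops_scal[OF u, of 0] by (simp add: S_def scal_simps)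
    next
      case False
      then have j: "j \<in> {1..n}" using that by simp
      have "S j = ginv ?r j * matrix_op gop ginv (Suc d) i j"
        by (simp add: S_def gop_ginv flip: mult.assoc)
      also have "\<dots> \<in> ?Im" using Suc j g(2)[OF j] d by (intro image_ops_mult[OF u]) auto
      finally show ?thesis .
    qed
    show ?case
      unfolding d_def[symmetric]
    proof
      fix j assume j: "j \<in> {1..n}"
      then obtain j' where j': "j = Suc j'" by (cases j) auto
      have "matrix_op gop ginv d i j = gop ?r j * (S j - S j')"
        by (simp add: S_def j' gop_ginv flip: mult.assoc)
      also have "\<dots> \<in> ?Im"
        using j j' by (intro image_ops_mult[OF u] image_ops_minus[OF u] SI g) auto
      finally show "matrix_op gop ginv d i j \<in> ?Im" .
    qed
  qed
  from rows[of "i - 1"] show ?case using less.prems by (auto simp: grid_def)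
qed

theorem PI_min_degree_quantum_matrix_algebra:
  "PI_min_degree (quantum_matrix_algebra n q) = 2 * m ^ (n\<^sup>2 div 2)"
proof -
  let ?R = "matq_relations n q"
  define w where "w B i j = B ^ cell_code n (i, j)" for B i j :: nat
  define X where "X B z i j = z ^ w B i j *\<^sub>c gop i j" for B z i j
  define Xi where "Xi B z i j = inverse (z ^ w B i j) *\<^sub>c ginv i j" for B z i j
  define uop where "uop B z p = (if p \<in> grid n then matrix_op (X B z) (Xi B z) (fst p - 1) (fst p) (snd p) else 1)"
    for B z p
  have arr: "affine_array q n (X B z) (Xi B z)" if z: "z \<noteq> 0" for B z
  proof
    show "q \<noteq> 0" by (rule q0)
    show "X B z r j * X B z r l = X B z r l * X B z r j" if "r \<in> {1..n}" "j \<in> {1..n}" "l \<in> {1..n}" for r j l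
      using gop_commute[of r j r l] that
      by (simp add: X_def smul_mult smul_simps mult.commute grid_def)
    show "Xi B z r j * X B z r j = 1" "X B z r j * Xi B z r j = 1" if "r \<in> {1..n}" "j \<in> {1..n}" for r j
      using z by (simp_all add: X_def Xi_def smul_mult smul_simps gop_ginv)
    show "X B z r j * X B z s l = (if j \<le> l then q else 1) *\<^sub>c (X B z s l * X B z r j)"
      if "r \<in> {1..n}" "s \<in> {1..n}" "s < r" "j \<in> {1..n}" "l \<in> {1..n}" for r s j l
      using gop_commute[of r j s l] that
      by (simp add: X_def smul_mult smul_simps mult.commute mult.left_commute grid_def)
  qed
  have pres: "preserves per (uop B z p)" for B z p
    by (auto simp: uop_def X_def Xi_def intro!: preserves_matrix_op preserves_smul preserves_gop preserves_intros)
  have R: "?R \<subseteq> carrier (free_algebra (grid n))"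
    unfolding matq_relations_def by (auto intro!: free_algebra_carrierI simp: grid_def)
  show ?thesis
    unfolding quantum_matrix_algebra_def
  proof (rule PI_min_degree_of_leading[where uop = uop, OF R _ _ pres])
    show "\<exists>c c' a' b'. a' \<in> grid n \<and> b' \<in> grid n \<and>
        (fst a' = fst b \<and> fst b' = fst a \<and> fst b < fst a \<or> a' = b \<and> b' = a) \<and>
        ncvar a * ncvar b - (ncconst c * (ncvar b * ncvar a) + ncconst c' * (ncvar a' * ncvar b')) \<in> ?R"
      if ab: "a \<in> grid n" "b \<in> grid n" "cell_code n b < cell_code n a" for a b
    proof -
      obtain i j s t where st: "a = (i, j)" "b = (s, t)" by (cases a; cases b)
      show ?thesis
      proof (cases "s < i")
        case si: True
        show ?thesis
        proof (cases "j \<le> t")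
          case True
          then have "ncvar a * ncvar b - ncconst q * (ncvar b * ncvar a) \<in> ?R"
            unfolding matq_relations_def st using si ab st by blast
          then show ?thesis
            using ab by (intro exI[of _ q] exI[of _ 0] exI[of _ b] exI[of _ a]) (simp add: ncconst_0)
        next
          case False
          then have "t < j" by simp
          then have "ncvar a * ncvar b - (ncvar b * ncvar a + ncconst (q - 1) * (ncvar (s, j) * ncvar (i, t))) \<in> ?R"
            unfolding matq_relations_def st using si ab st by blast
          moreover have "(s, j) \<in> grid n" "(i, t) \<in> grid n" using ab st by (auto simp: grid_def)
          ultimately show ?thesis
            using si st by (intro exI[of _ 1] exI[of _ "q - 1"] exI[of _ "(s, j)"] exI[of _ "(i, t)"])
              (simp add: ncconst_1)
        qed
      next
        case False
        then have "s = i" using ab cell_code_less[OF ab(2,1)] by (simp add: st)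
        then have "ncvar a * ncvar b - ncvar b * ncvar a \<in> ?R"
          unfolding matq_relations_def st using ab st by blast
        then show ?thesis
          using ab by (intro exI[of _ 1] exI[of _ 0] exI[of _ b] exI[of _ a]) (simp add: ncconst_0 ncconst_1)
      qed
    qed
    show "nc_subst scal (uop B z) r = 0" if z: "z \<noteq> 0" and r: "r \<in> ?R" for B z r
    proof -
      note hom = nc_subst_diff[OF central_hom_scal] nc_subst_add[OF central_hom_scal] nc_subst_mult[OF central_hom_scal]
        nc_subst_ncvar[OF central_hom_scal] nc_subst_ncconst[OF central_hom_scal]
      note rels = affine_array.matrix_op_relations[OF arr[OF z, of B]]
      from r consider
        i j s t where "r = ncvar (i, j) * ncvar (s, t) - ncconst q * (ncvar (s, t) * ncvar (i, j))"
          "(i, j) \<in> grid n" "(s, t) \<in> grid n" "s < i" "j \<le> t"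
        | i j s t where "r = ncvar (i, j) * ncvar (s, t) -
            (ncvar (s, t) * ncvar (i, j) + ncconst (q - 1) * (ncvar (s, j) * ncvar (i, t)))"
          "(i, j) \<in> grid n" "(s, t) \<in> grid n" "s < i" "t < j"
        | i j k where "r = ncvar (i, j) * ncvar (i, k) - ncvar (i, k) * ncvar (i, j)"
          "(i, j) \<in> grid n" "(i, k) \<in> grid n"
        unfolding matq_relations_def by blast
      then show ?thesis
      proof cases
        case 1
        then show ?thesis using rels(2)[of i j t s] by (simp add: hom uop_def grid_def flip: smul_def)
      next
        case 2
        then show ?thesis using rels(3)[of i j t s] by (simp add: hom uop_def grid_def flip: smul_def)
      next
        case 3
        then show ?thesis using rels(1)[of i j k] by (simp add: hom uop_def grid_def)
      qed
    qed
    show "leading (\<lambda>z. uop B z p) (B ^ cell_code n p) (gop (fst p) (snd p))" if B: "B \<ge> 2" and p: "p \<in> grid n" for B p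
    proof -
      obtain i j where ij: "p = (i, j)" by (cases p)
      have "leading (\<lambda>z. matrix_op (X B z) (Xi B z) (i - 1) i j) (w B i j) (gop i j)"
        unfolding X_def Xi_def
      proof (rule leading_matrix_op)
        show "gop r j * ginv r j = 1" for r j by (rule gop_ginv)
        show "w B r k \<le> w B r j" if "k \<le> j" for r k j
          unfolding w_def using that B by (intro power_increasing) (auto simp: cell_code_def)
        show "w B r j + w B i k < w B i j + w B r k"
          if "r \<in> {1..n}" "i \<in> {1..n}" "j \<in> {1..n}" "k \<in> {1..n}" "r < i" "k < j" for r i k j
        proof -
          have g: "(r, j) \<in> grid n" "(i, j) \<in> grid n" "(i, k) \<in> grid n" using that by (auto simp: grid_def)
          have c: "cell_code n (r, j) < cell_code n (i, j)" "cell_code n (i, k) < cell_code n (i, j)"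
            using cell_code_less[OF g(1,2)] cell_code_less[OF g(3,2)] that by auto
          \<comment> \<open>The weights at least double from one cell code to the next. Both
            \<open>w B r j\<close> and \<open>w B i k\<close> belong to smaller codes than
            \<open>(i, j)\<close>, so their sum is at most \<open>w B i j\<close>; the positive term
            \<open>w B r k\<close> makes the inequality strict.\<close>
          have half: "2 * w B i' j' \<le> w B i j" if "cell_code n (i', j') < cell_code n (i, j)" for i' j'
          proof -
            have "2 * w B i' j' \<le> B ^ Suc (cell_code n (i', j'))" using B by (simp add: w_def)
            also have "\<dots> \<le> w B i j" unfolding w_def using that B by (intro power_increasing) auto
            finally show ?thesis .
          qed
          have "w B r k > 0" using B by (simp add: w_def)
          then show ?thesis using half[OF c(1)] half[OF c(2)] by linarith
        qed
      qed (use p ij in \<open>auto simp: grid_def\<close>)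
      then show ?thesis using p by (simp add: uop_def w_def ij)
    qed
    \<comment> \<open>At \<open>z = 1\<close> the scaling disappears, and what remains is the bare
      array of torus operators, from which surjectivity is read off.\<close>
    have X1: "X 2 1 = gop" "Xi 2 1 = ginv" by (simp_all add: X_def Xi_def fun_eq_iff smul_simps)
    show "gop i j \<in> image_ops per (grid n) (uop 2 1)" if "(i, j) \<in> grid n" for i j
    proof (rule image_gop_matrix_op[OF pres _ that])
      fix i j assume ij: "(i, j) \<in> grid n"
      show "matrix_op gop ginv (i - 1) i j \<in> image_ops per (grid n) (uop 2 1)"
        using image_ops_var[where u = "uop 2 1" and r = per, OF pres ij] ij by (simp add: uop_def X1)
    qed
  qed
qed

end

theorem mainTheorem5:
  fixes q :: "'k::alg_closed_field" and m n :: nat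
  assumes "primitive_root_of_unity m q" and "n \<ge> 1"
  shows "PI_deg (quantum_matrix_algebra n q) = PI_deg (quantum_affine_space n q) \<and>
    PI_deg (quantum_affine_space n q) =
      (if even n then real m ^ (n\<^sup>2 div 2) else real m ^ ((n\<^sup>2 - 1) div 2))"
proof -
  have "n\<^sup>2 div 2 = (n\<^sup>2 - 1) div 2" if "odd n"
  proof -
    have "odd (n\<^sup>2)" using that by simp
    then show ?thesis by presburger
  qed
  then show ?thesis
    using PI_min_degree_quantum_matrix_algebra[OF assms(1), of n]
      PI_min_degree_quantum_affine_space[OF assms(1), of n]
    by (simp add: PI_deg_def)
qed

end
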